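(* The functions $f_0,g_0:[-1,1]\rightarrow\mathbb{R}$, \[f_0(\rho)=\rho+\frac{\sqrt{1-\rho^2}}{\arcsin\rho+\frac{\pi}{2}}-\frac{\pi}{2}\frac{(1+\rho)^2}{(\arcsin\rho+\frac{\pi}{2})^2},\] \[g_0(\rho)=\frac{\rho(\arcsin\rho+\frac{\pi}{2})^2+\sqrt{1-\rho^2}(\arcsin\rho+\frac{\pi}{2})-\frac{\pi}{2}(1+\rho)^2}{(\arcsin\rho+\frac{\pi}{2})^2+\rho\sqrt{1-\rho^2}(\arcsin\rho+\frac{\pi}{2})-\frac{\pi}{2}(1+\rho)^2},\] are absolutely monotone on $[0,1]$, i.e., all their derivatives are nonnegative there.
   Formalization: Nonnegativity of all derivatives is stated on [0,1), with one-sided derivatives at 0 and continuity on [0,1]; at the endpoint 1 derivatives are not required, since f_0'(1) = +∞ does not exist as a finite number. *)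

theory Defs
  imports "HOL-Analysis.Analysis"
begin

definition f0 :: "real \<Rightarrow> real" where
  "f0 \<rho> = \<rho> + sqrt (1 - \<rho>\<^sup>2) / (arcsin \<rho> + pi/2)
           - (pi/2) * (1 + \<rho>)\<^sup>2 / (arcsin \<rho> + pi/2)\<^sup>2"

definition g0 :: "real \<Rightarrow> real" where
  "g0 \<rho> = (\<rho> * (arcsin \<rho> + pi/2)\<^sup>2 + sqrt (1 - \<rho>\<^sup>2) * (arcsin \<rho> + pi/2)
              - (pi/2) * (1 + \<rho>)\<^sup>2)
          / ((arcsin \<rho> + pi/2)\<^sup>2 + \<rho> * sqrt (1 - \<rho>\<^sup>2) * (arcsin \<rho> + pi/2)
              - (pi/2) * (1 + \<rho>)\<^sup>2)"

definition absolutely_monotone_01 :: "(real \<Rightarrow> real) \<Rightarrow> bool" where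
  "absolutely_monotone_01 f \<longleftrightarrow>
     continuous_on {0..1} f \<and>
     (\<exists>D :: nat \<Rightarrow> real \<Rightarrow> real.
        (\<forall>x\<in>{0..<1}. D 0 x = f x) \<and>
        (\<forall>n. \<forall>x\<in>{0..<1}. (D n has_real_derivative D (Suc n) x) (at x within {0..<1})) \<and>
        (\<forall>n. \<forall>x\<in>{0..<1}. D n x \<ge> 0))"

end

theory Submission
  imports Defs "HOL-Complex_Analysis.Complex_Analysis" "HOL-Real_Asymp.Real_Asymp"
begin

text \<open>
  Put \<open>\<rho> = - cos t\<close>, so that \<open>arcsin \<rho> + pi/2 = t\<close> and \<open>sqrt (1 - \<rho>\<^sup>2) = sin t\<close>. In the variable \<open>t\<close> the two functions
  become \<open>A / t\<^sup>2\<close> and \<open>A / B\<close> with \<open>A\<close>, \<open>B\<close> entire, even and divisible by \<open>t\<^sup>4\<close>; hence as functions of \<open>\<rho>\<close>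
  they are regular at \<open>-1\<close> and only branch at \<open>1\<close>. A Taylor coefficient at \<open>\<rho> = 0\<close> is the residue at \<open>t = pi/2\<close>
  of \<open>F t * sin t / (- cos t) ^ (n + 1)\<close>. Integrate over the boundary of \<open>[0, pi] \<times> [-R, R]\<close>: the side on
  the imaginary axis contributes nothing because the integrand is odd, the horizontal sides vanish as
  \<open>R \<rightarrow> \<infinity>\<close>, and on \<open>t = pi + i s\<close> the real part of the integral is that of \<open>Im F * sinh s / cosh s ^ (n + 1)\<close>.
  For \<open>f0\<close> this density is nonnegative, which settles \<open>n \<ge> 2\<close> (the horizontal sides
  do not vanish for smaller \<open>n\<close>); the first two coefficients are \<open>0\<close> and \<open>(1 - 2/pi)\<^sup>2\<close>.

  For \<open>g0\<close> the density is \<open>pi * sinh s ^ 4 * Q s / \<bar>B\<bar>\<^sup>2\<close> with \<open>Q\<close> decreasing and changing sign near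
  \<open>s = 1.0835\<close>. Therefore the coefficients of \<open>(x - \<rho>) * g0\<close> are considered instead, where \<open>x = 1.653\<close>
  compensates the change of sign; as \<open>g0 0 = 0\<close>, their nonnegativity implies that of the coefficients of \<open>g0\<close>.
  The denominator \<open>B\<close> has a pair of conjugate zeros at \<open>t \<approx> pi - 0.0004 \<plusminus> 1.0883 i\<close>, extremely close to the
  line of integration. The contour avoids them by a detour around a box of side \<open>0.01\<close>, on which
  \<open>(x - \<rho>) * g0\<close> is nearly the constant \<open>1.14\<close>; subtracting this constant, which only affects the coefficient of
  index \<open>0\<close>, makes the contribution of the detour smaller than a part of the positive main term. That \<open>B\<close> has no
  further zeros follows from the open mapping theorem: \<open>B / (1 - cos t)\<^sup>2\<close> takes no value in \<open>(-\<infinity>, 0]\<close> on the boundary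
  of the remaining region, so it cannot take one of minimal real part inside.
\<close>

section \<open>Taylor coefficients as contour integrals in the variable t\<close>

lemma higher_deriv_higher_deriv: "(deriv ^^ m) ((deriv ^^ n) f) = (deriv ^^ (m + n)) f"
  by (simp add: funpow_add)

text \<open>Each derivative of \<open>h\<close> is given on the disc by its own power series at 0,
  whose coefficients are positive multiples of later derivatives of \<open>h\<close> at 0; at a
  point of [0,1) every term has nonnegative real part. The real derivatives demanded by the
  definition are the real parts of the complex ones.\<close>

lemma absolutely_monotone_01_of_Taylor_coeffs:
  assumes h: "h holomorphic_on ball 0 1"
    and nonneg: "\<And>n. 0 \<le> Re ((deriv ^^ n) h 0)"
    and f: "\<And>x. x \<in> {0..<1} \<Longrightarrow> f x = Re (h (of_real x))"
    and cont: "continuous_on {0..1} f"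
  shows "absolutely_monotone_01 f"
  unfolding absolutely_monotone_01_def
proof (intro conjI exI[of _ "\<lambda>n x. Re ((deriv ^^ n) h (of_real x))"] ballI allI)
  show "continuous_on {0..1} f" by (rule cont)
  fix x :: real assume x: "x \<in> {0..<1}"
  then have xb: "of_real x \<in> ball (0::complex) 1" by simp
  show "Re ((deriv ^^ 0) h (of_real x)) = f x" using f x by simp
  fix n :: nat
  have hol: "(deriv ^^ n) h holomorphic_on ball 0 1"
    by (simp add: h holomorphic_higher_deriv)
  have "((deriv ^^ n) h has_field_derivative (deriv ^^ Suc n) h (of_real x)) (at (of_real x))"
    using holomorphic_derivI[OF hol open_ball xb] by simp
  then have "((\<lambda>x. (deriv ^^ n) h (of_real x)) has_vector_derivative (deriv ^^ Suc n) h (of_real x))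
               (at x within {0..<1})"
    by (rule has_vector_derivative_real_field)
  then show "((\<lambda>x. Re ((deriv ^^ n) h (of_real x))) has_real_derivative
          Re ((deriv ^^ Suc n) h (of_real x))) (at x within {0..<1})"
    by (auto simp: has_real_derivative_iff_has_vector_derivative has_vector_derivative_complex_iff)
  have "(\<lambda>k. (deriv ^^ k) ((deriv ^^ n) h) 0 / fact k * (of_real x - 0) ^ k) sums
          (deriv ^^ n) h (of_real x)"
    by (rule holomorphic_power_series[OF hol xb])
  then have sm: "(\<lambda>k. Re ((deriv ^^ (k + n)) h 0 / fact k * of_real x ^ k)) sums
          Re ((deriv ^^ n) h (of_real x))"
    by (intro sums_Re) (simp add: higher_deriv_higher_deriv)
  have nn: "0 \<le> Re ((deriv ^^ (k + n)) h 0 / fact k * of_real x ^ k)" for k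
  proof -
    have "Re ((deriv ^^ (k + n)) h 0 / fact k * of_real x ^ k) =
            Re ((deriv ^^ (k + n)) h 0 * of_real (x ^ k / fact k))"
      by (rule arg_cong[where f = Re]) simp
    also have "\<dots> = Re ((deriv ^^ (k + n)) h 0) * (x ^ k / fact k)"
      by (simp only: Re_complex_of_real Im_complex_of_real times_complex.sel mult_zero_right diff_zero)
    also have "\<dots> \<ge> 0" using x by (intro mult_nonneg_nonneg nonneg) auto
    finally show ?thesis .
  qed
  show "0 \<le> Re ((deriv ^^ n) h (of_real x))"
    by (rule sums_le[OF nn sums_zero sm])
qed

lemma cos_eq_0_vertical_strip:
  assumes "cos (t::complex) = 0" "0 \<le> Re t" "Re t \<le> pi"
  shows "t = of_real (pi/2)"
proof -
  obtain n :: int where n: "t = of_real (of_int n * pi) + of_real pi / 2"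
    using assms(1) unfolding cos_eq_0 by (auto simp: algebra_simps)
  then have "Re t = of_int n * pi + pi/2" by simp
  then have "0 \<le> (of_int n + 1/2) * pi" "(of_int n + 1/2) * pi \<le> 1 * pi"
    using assms(2,3) by (auto simp: algebra_simps)
  then have "0 \<le> real_of_int n + 1/2" "real_of_int n + 1/2 \<le> 1"
    using pi_gt_zero by (auto simp: zero_le_mult_iff simp del: pi_gt_zero)
  then have "n = 0" by linarith
  then show ?thesis using n by simp
qed

lemma holomorphic_on_comp_minus_cos:
  assumes "h holomorphic_on ball 0 1" "\<And>t. t \<in> S \<Longrightarrow> cmod (cos t) < 1"
  shows "(\<lambda>t. h (- cos t)) holomorphic_on S"
proof -
  have "h \<circ> (\<lambda>t. - cos t) holomorphic_on S"
    by (rule holomorphic_on_compose_gen[OF _ assms(1)]) (use assms(2) in \<open>auto intro!: holomorphic_intros\<close>)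
  then show ?thesis by (simp add: o_def)
qed

text \<open>This is Cauchy's coefficient formula after substituting \<open>- cos t\<close> for the
  variable. Instead of transforming a contour, the induction integrates by parts:
  \<open>h (- cos t) / (- cos t) ^ Suc n\<close> is single-valued, so its derivative integrates to 0
  around pi/2, which ties the residue for \<open>h\<close> at order n + 1 to that for
  \<open>deriv h\<close> at order n.\<close>

lemma residue_of_cos_substitution:
  assumes "h holomorphic_on ball 0 1"
  shows "residue (\<lambda>t. h (- cos t) * sin t / (- cos t) ^ Suc n) (of_real (pi/2)) =
           (deriv ^^ n) h 0 / fact n"
  using assms
proof (induction n arbitrary: h)
  let ?z = "of_real (pi/2) :: complex"
  define S where "S = {t. cmod (cos t) < 1 \<and> 0 < Re t \<and> Re t < pi}"
  have oS: "open S" unfolding S_def by (intro open_Collect_conj open_Collect_less continuous_intros)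
  have zS: "?z \<in> S" by (simp add: S_def flip: cos_of_real)
  have nz: "cos t \<noteq> 0" if "t \<in> S - {?z}" for t
    using that cos_eq_0_vertical_strip[of t] by (auto simp: S_def)
  {
    case (0 h)
    have holc: "(\<lambda>t. h (- cos t)) holomorphic_on S"
      by (rule holomorphic_on_comp_minus_cos[OF 0]) (simp add: S_def)
    have "(\<lambda>t. h (- cos t) * sin t / (- cos t) ^ Suc 0) holomorphic_on S - {?z}"
      using nz by (intro holomorphic_intros holomorphic_on_subset[OF holc]) auto
    moreover have "((\<lambda>w. h (- cos w) * sin w / (- cos w) ^ Suc 0 * (w - ?z)) \<longlongrightarrow> h 0) (at ?z)"
    proof -
      have "((\<lambda>t. - cos t) has_field_derivative sin ?z) (at ?z)"
        by (auto intro!: derivative_eq_intros)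
      then have "((\<lambda>w. (- cos w - (- cos ?z)) / (w - ?z)) \<longlongrightarrow> 1) (at ?z)"
        unfolding has_field_derivative_iff by (simp flip: sin_of_real cos_of_real)
      then have q: "((\<lambda>w. (- cos w) / (w - ?z)) \<longlongrightarrow> 1) (at ?z)"
        by (simp flip: cos_of_real)
      have "isCont (\<lambda>t. h (- cos t) * sin t) ?z"
        using holomorphic_on_imp_continuous_on[OF holc] oS zS
        by (auto intro!: continuous_intros simp: continuous_on_eq_continuous_at)
      then have "((\<lambda>t. h (- cos t) * sin t) \<longlongrightarrow> h 0) (at ?z)"
        by (simp add: isCont_def flip: sin_of_real cos_of_real)
      from tendsto_divide[OF this q] show ?thesis
        by (simp add: field_simps)
    qed
    ultimately show ?case
      using residue_simple'[OF oS zS] by simp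
  next
    case (Suc n h)
    have hol': "deriv h holomorphic_on ball 0 1" using Suc.prems by (simp add: holomorphic_deriv)
    let ?f = "\<lambda>h m t. h (- cos t) * sin t / (- cos t) ^ Suc m"
    have holf: "?f h m holomorphic_on S - {?z}" if h: "h holomorphic_on ball 0 1" for h m
    proof -
      have "(\<lambda>t. h (- cos t)) holomorphic_on S"
        by (rule holomorphic_on_comp_minus_cos[OF h]) (simp add: S_def)
      then have "(\<lambda>t. h (- cos t)) holomorphic_on S - {?z}" by (rule holomorphic_on_subset) auto
      then show ?thesis using nz by (intro holomorphic_intros) auto
    qed
    obtain r where r: "r > 0" "cball ?z r \<subseteq> S" using oS zS open_contains_cball by blast
    have pim: "path_image (circlepath ?z r) \<subseteq> S - {?z}" using r by (auto simp: sphere_def)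
    let ?D = "\<lambda>t. ?f (deriv h) n t - of_nat (Suc n) * ?f h (Suc n) t"
    have "((\<lambda>t. h (- cos t) / (- cos t) ^ Suc n) has_field_derivative ?D t) (at t within S - {?z})"
      if t: "t \<in> S - {?z}" for t
    proof -
      have "(h has_field_derivative deriv h (- cos t)) (at (- cos t))"
        using Suc.prems t by (intro holomorphic_derivI[of h "ball 0 1"]) (auto simp: S_def)
      then have "((\<lambda>t. h (- cos t)) has_field_derivative deriv h (- cos t) * sin t) (at t)"
        by (rule DERIV_chain2) (auto intro!: derivative_eq_intros)
      then have "((\<lambda>t. h (- cos t) / (- cos t) ^ Suc n) has_field_derivative
           (deriv h (- cos t) * sin t * (- cos t) ^ Suc n -
             h (- cos t) * (of_nat (Suc n) * ((- cos t) ^ n * sin t))) /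
            ((- cos t) ^ Suc n * (- cos t) ^ Suc n)) (at t)"
        using nz[OF t] by (auto intro!: derivative_eq_intros simp del: power_Suc)
      also have "(deriv h (- cos t) * sin t * (- cos t) ^ Suc n -
             h (- cos t) * (of_nat (Suc n) * ((- cos t) ^ n * sin t))) /
            ((- cos t) ^ Suc n * (- cos t) ^ Suc n) = ?D t"
      proof -
        have "c \<noteq> 0 \<Longrightarrow> (d * s * c ^ Suc n - e * (N * (c ^ n * s))) / (c ^ Suc n * c ^ Suc n) =
            d * s / c ^ Suc n - N * (e * s / c ^ Suc (Suc n))" for c d s e N :: complex
          by (simp add: field_simps)
        then show ?thesis using nz[OF t] by (simp del: power_Suc)
      qed
      finally show ?thesis by (rule has_field_derivative_at_within)
    qed
    from contour_integral_primitive[OF this _ pim]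
    have "(?D has_contour_integral 0) (circlepath ?z r)" by simp
    moreover have "(?D has_contour_integral
        2 * pi * \<i> * residue (?f (deriv h) n) ?z
          - of_nat (Suc n) * (2 * pi * \<i> * residue (?f h (Suc n)) ?z)) (circlepath ?z r)"
      by (intro has_contour_integral_diff has_contour_integral_lmul
           base_residue[OF oS zS r(1) holf r(2)] hol' Suc.prems)
    ultimately have "0 = 2 * pi * \<i> * residue (?f (deriv h) n) ?z
          - of_nat (Suc n) * (2 * pi * \<i> * residue (?f h (Suc n)) ?z)"
      by (rule has_contour_integral_unique)
    then have "residue (?f (deriv h) n) ?z = of_nat (Suc n) * residue (?f h (Suc n)) ?z"
      (is "?a = ?N * ?b")
    proof -
      have "0 = 2 * pi * \<i> * a - N * (2 * pi * \<i> * b) \<Longrightarrow> a = N * b" for a b N :: complex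
        by (simp add: field_simps)
      then show "0 = 2 * pi * \<i> * ?a - ?N * (2 * pi * \<i> * ?b) \<Longrightarrow> ?a = ?N * ?b" .
    qed
    moreover have "residue (?f (deriv h) n) ?z = (deriv ^^ Suc n) h 0 / fact n"
      unfolding Suc.IH[OF hol'] funpow_Suc_right by simp
    ultimately show ?case
    proof -
      have "a = N * b \<Longrightarrow> a = X / d \<Longrightarrow> N \<noteq> 0 \<Longrightarrow> d \<noteq> 0 \<Longrightarrow> b = X / (N * d)" for a b N X d :: complex
        by (simp add: field_simps)
      from this[of ?a ?N ?b "(deriv ^^ Suc n) h 0" "fact n"] show "?a = ?N * ?b \<Longrightarrow> ?a = (deriv ^^ Suc n) h 0 / fact n \<Longrightarrow>
          ?b = (deriv ^^ Suc n) h 0 / fact (Suc n)"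
        unfolding fact_Suc by (simp del: of_nat_Suc power_Suc funpow.simps)
    qed
  }
qed

text \<open>The neighbourhood is the Minkowski sum of \<open>K\<close> and a small ball, both
  convex. It supplies the connected domain for the residue theorem.\<close>

lemma open_convex_neighbourhood:
  fixes K :: "'a::euclidean_space set"
  assumes "compact K" "convex K" "open U" "K \<subseteq> U"
  obtains S where "open S" "convex S" "K \<subseteq> S" "S \<subseteq> U"
proof (cases "K = {}")
  case True then show ?thesis using that[of "{}"] by simp
next
  case False
  obtain e where e: "e > 0" "{x. infdist x K \<le> e} \<subseteq> U"
    using compact_in_open_separated[OF False assms(1,3,4)] by blast
  let ?S = "\<Union>y\<in>ball 0 e. \<Union>x\<in>K. {y + x}"
  have "open ?S" by (rule open_sums) simp
  moreover have "convex ?S" by (rule convex_sums) (use assms in auto)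
  moreover have "K \<subseteq> ?S" using e(1) by force
  moreover have "?S \<subseteq> U"
  proof clarsimp
    fix x y :: 'a assume "x \<in> K" "norm y < e"
    then have "infdist (y + x) K \<le> e"
      using infdist_le[of x K "y + x"] by (simp add: dist_norm)
    then show "y + x \<in> U" using e by auto
  qed
  ultimately show ?thesis using that by blast
qed

text \<open>\<open>F\<close> continues \<open>h (- cos t)\<close> beyond the region
  \<open>cmod (cos t) < 1\<close>, so the rectangle may leave the preimage of the unit disc; the
  residue only sees \<open>F\<close> near pi/2. The right side \<open>a\<close> is kept variable
  because for \<open>g0\<close> it has to lie to the left of pi.\<close>

lemma rectangle_integral_Taylor_coeff:
  assumes h: "h holomorphic_on ball 0 1"
    and F: "F holomorphic_on T" "open T" "cbox (Complex 0 (-R)) (Complex a R) \<subseteq> T"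
    and a: "pi/2 < a" "a \<le> pi" and R: "0 < R"
    and Fh: "\<And>t. \<lbrakk>0 < Re t; Re t < pi; cmod (cos t) < 1\<rbrakk> \<Longrightarrow> F t = h (- cos t)"
  shows "contour_integral (rectpath (Complex 0 (-R)) (Complex a R))
            (\<lambda>t. F t * sin t / (- cos t) ^ Suc n) = 2 * pi * \<i> * ((deriv ^^ n) h 0 / fact n)"
proof -
  let ?z = "of_real (pi/2) :: complex"
  let ?K = "cbox (Complex 0 (-R)) (Complex a R)"
  let ?\<Phi> = "\<lambda>t. F t * sin t / (- cos t) ^ Suc n"
  let ?\<gamma> = "rectpath (Complex 0 (-R)) (Complex a R)"
  have zb: "?z \<in> box (Complex 0 (-R)) (Complex a R)"
    using a R by (simp add: in_box_complex_iff)
  \<comment> \<open>Removing the other zeros of \<open>cos\<close> leaves pi/2 as the only possible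
    pole. The set stays open because the unit ball around pi/2 contains no further zero.\<close>
  define T' where "T' = T - ({t. cos t = 0} - {?z})"
  have "open T'"
  proof -
    have "{t. cos t = 0} - {?z} = {t. cos t = (0::complex)} - ball ?z 1"
    proof -
      have "t = ?z" if "cos t = 0" "t \<in> ball ?z 1" for t
      proof (rule cos_eq_0_vertical_strip[OF that(1)])
        have "\<bar>Re (?z - t)\<bar> < 1" using that(2) abs_Re_le_cmod[of "?z - t"] by (simp add: dist_norm)
        then show "0 \<le> Re t" "Re t \<le> pi" using pi_gt3 by auto
      qed
      then show ?thesis by (auto simp del: mem_ball)
    qed
    moreover have "closed ({t. cos t = (0::complex)} - ball ?z 1)"
      by (intro closed_Diff closed_Collect_eq continuous_intros) auto
    ultimately show ?thesis unfolding T'_def using F(2) by (simp add: open_Diff)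
  qed
  moreover have "?K \<subseteq> T'"
    using F(3) a cos_eq_0_vertical_strip by (force simp: T'_def in_cbox_complex_iff)
  ultimately obtain S where S: "open S" "convex S" "?K \<subseteq> S" "S \<subseteq> T'"
    using open_convex_neighbourhood[of ?K T'] by (metis compact_cbox convex_box(1))
  have hol: "?\<Phi> holomorphic_on S - {?z}"
  proof -
    have "F holomorphic_on S - {?z}" by (rule holomorphic_on_subset[OF F(1)]) (use S(4) in \<open>auto simp: T'_def\<close>)
    then show ?thesis using S(4) by (intro holomorphic_intros) (auto simp: T'_def)
  qed
  have zS: "?z \<in> S" using zb S(3) box_subset_cbox by blast
  have sub: "path_image ?\<gamma> \<subseteq> S - {?z}"
    using path_image_rectpath_cbox_minus_box[of "Complex 0 (-R)" "Complex a R"] a R S(3) zb by auto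
  have "contour_integral ?\<gamma> ?\<Phi> = 2 * pi * \<i> * (\<Sum>p\<in>{?z}. winding_number ?\<gamma> p * residue ?\<Phi> p)"
  proof (rule Residue_theorem[OF S(1) convex_connected[OF S(2)] _ hol _ _ sub])
    show "\<forall>z. z \<notin> S \<longrightarrow> winding_number ?\<gamma> z = 0"
      using S(3) a R by (auto intro!: winding_number_rectpath_outside)
  qed auto
  then have "contour_integral ?\<gamma> ?\<Phi> = 2 * pi * \<i> * (winding_number ?\<gamma> ?z * residue ?\<Phi> ?z)"
    by simp
  also have "winding_number ?\<gamma> ?z = 1" by (rule winding_number_rectpath[OF zb])
  also have "residue ?\<Phi> ?z = residue (\<lambda>t. h (- cos t) * sin t / (- cos t) ^ Suc n) ?z"
  proof (rule residue_cong)
    have "eventually (\<lambda>t. t \<in> {t. 0 < Re t \<and> Re t < pi \<and> cmod (cos t) < 1}) (nhds ?z)"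
      by (rule eventually_nhds_in_open)
         (auto intro!: open_Collect_conj open_Collect_less continuous_intros simp flip: cos_of_real)
    then show "eventually (\<lambda>t. ?\<Phi> t = h (- cos t) * sin t / (- cos t) ^ Suc n) (at ?z)"
      unfolding eventually_at_filter by eventually_elim (auto simp: Fh)
  qed simp
  finally show ?thesis using residue_of_cos_substitution[OF h] by simp
qed

section \<open>Numerator and denominator in the variable t\<close>

text \<open>The divided difference at 0 with its removable singularity filled. Iterating it produces
  the entire quotients below without handling power series.\<close>

definition divdiff :: "(complex \<Rightarrow> complex) \<Rightarrow> complex \<Rightarrow> complex" where
  "divdiff f z = (if z = 0 then deriv f 0 else (f z - f 0) / z)"

lemma divdiff_eq: "f z = f 0 + z * divdiff f z"
  by (simp add: divdiff_def)

lemma divdiff_holomorphic: "f holomorphic_on UNIV \<Longrightarrow> divdiff f holomorphic_on UNIV"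
  using pole_lemma[of f UNIV 0] unfolding divdiff_def[abs_def] diff_zero by simp

lemma deriv_even_at_0:
  assumes "f holomorphic_on UNIV" "\<And>z. f (- z) = f (z::complex)"
  shows "deriv f 0 = 0"
proof -
  have "(f has_field_derivative deriv f 0) (at 0)"
    using assms(1) by (auto intro: holomorphic_derivI)
  moreover from this have "((\<lambda>z. f (- z)) has_field_derivative deriv f 0 * (-1)) (at 0)"
    by (intro DERIV_chain2[where f = f and g = uminus]) (auto intro!: derivative_eq_intros)
  then have "(f has_field_derivative - deriv f 0) (at 0)" by (simp add: assms(2))
  ultimately have "deriv f 0 = - deriv f 0" by (rule DERIV_unique)
  then show ?thesis by simp
qed

definition sinc :: "complex \<Rightarrow> complex" where "sinc = divdiff sin"

text \<open>The entire function (sin z - z) / z^3: \<open>sinc\<close> is even with value 1 at 0, so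
  \<open>sinc z - 1\<close> has a double zero there.\<close>

definition sinc2 :: "complex \<Rightarrow> complex" where "sinc2 = divdiff (divdiff sinc)"

lemma sinc_holomorphic: "sinc holomorphic_on UNIV"
  unfolding sinc_def by (intro divdiff_holomorphic holomorphic_intros)

lemma sinc2_holomorphic: "sinc2 holomorphic_on UNIV"
  unfolding sinc2_def by (intro divdiff_holomorphic sinc_holomorphic)

lemma sin_eq_sinc: "sin z = z * sinc z"
  using divdiff_eq[of sin z] by (simp add: sinc_def)

lemma sinc_0: "sinc 0 = 1"
  by (simp add: sinc_def divdiff_def DERIV_imp_deriv[OF DERIV_sin])

lemma sinc_even: "sinc (- z) = sinc z"
  by (simp add: sinc_def divdiff_def)

lemma sinc_eq_sinc2: "sinc z = 1 + z\<^sup>2 * sinc2 z"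
proof -
  have "divdiff sinc 0 = 0"
    using deriv_even_at_0[OF sinc_holomorphic sinc_even] by (simp add: divdiff_def)
  then have "divdiff sinc z = z * sinc2 z"
    using divdiff_eq[of "divdiff sinc" z] by (simp add: sinc2_def)
  then show ?thesis
    using divdiff_eq[of sinc z] by (simp add: sinc_0 power2_eq_square)
qed

lemma sin_eq_sinc2: "sin z = z + z ^ 3 * sinc2 z"
  using sin_eq_sinc[of z] sinc_eq_sinc2[of z] by (simp add: algebra_simps power2_eq_square power3_eq_cube)

lemma one_minus_cos_eq_sinc: "1 - cos z = z\<^sup>2 / 2 * (sinc (z/2))\<^sup>2"
proof -
  have "1 - cos z = 2 * (sin (z/2))\<^sup>2"
    using cos_double_sin[of "z/2"] by simp
  then show ?thesis by (simp add: sin_eq_sinc[of "z/2"] power_mult_distrib power_divide)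
qed

definition Anum :: "complex \<Rightarrow> complex" where
  "Anum t = - (t\<^sup>2 * cos t) + t * sin t - of_real (pi/2) * (1 - cos t)\<^sup>2"

definition Bden :: "complex \<Rightarrow> complex" where
  "Bden t = t\<^sup>2 - t * sin t * cos t - of_real (pi/2) * (1 - cos t)\<^sup>2"

text \<open>\<open>Ared\<close>, \<open>Bred\<close> and \<open>Cred\<close> are the quotients of
  \<open>Anum\<close>, \<open>Bden\<close> and the square of \<open>1 - cos t\<close> by t^4. The
  point 0 lies on the left side of the contour, so expressions regular at 0 are required.\<close>

definition Ared :: "complex \<Rightarrow> complex" where
  "Ared t = sinc2 t + (sinc (t/2))\<^sup>2 / 2 - of_real (pi/8) * sinc (t/2) ^ 4"

definition Bred :: "complex \<Rightarrow> complex" where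
  "Bred t = - 4 * sinc2 (2 * t) - of_real (pi/8) * sinc (t/2) ^ 4"

definition Cred :: "complex \<Rightarrow> complex" where
  "Cred t = sinc (t/2) ^ 4 / 4"

lemma Cred_eq: "(1 - cos t)\<^sup>2 = t ^ 4 * Cred t"
  by (simp add: one_minus_cos_eq_sinc Cred_def power_mult_distrib power_divide flip: power_mult)

lemma Anum_eq: "Anum t = t ^ 4 * Ared t"
proof -
  have 1: "cos t = 1 - t\<^sup>2 / 2 * (sinc (t/2))\<^sup>2" unfolding one_minus_cos_eq_sinc[symmetric] by simp
  have "Anum t = t ^ 4 * sinc2 t + t ^ 4 * ((sinc (t/2))\<^sup>2 / 2) - of_real (pi/2) * (1 - cos t)\<^sup>2"
    unfolding Anum_def sin_eq_sinc2[of t] by (subst 1) (simp add: algebra_simps power4_eq_xxxx power2_eq_square power3_eq_cube)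
  also have "of_real (pi/2) * (1 - cos t)\<^sup>2 = t ^ 4 * (of_real (pi/8) * sinc (t/2) ^ 4)"
    by (simp add: Cred_eq Cred_def)
  finally show ?thesis by (simp add: Ared_def algebra_simps)
qed

lemma Bden_eq: "Bden t = t ^ 4 * Bred t"
proof -
  have "sin (2 * t) = 2 * t + 8 * t ^ 3 * sinc2 (2 * t)"
    by (subst sin_eq_sinc2) (simp add: power_mult_distrib)
  moreover have "sin t * cos t = sin (2 * t) / 2" by (simp add: sin_double)
  ultimately have "sin t * cos t = t + 4 * t ^ 3 * sinc2 (2 * t)"
    by (simp add: add_divide_distrib)
  then have "t * sin t * cos t = t * (t + 4 * t ^ 3 * sinc2 (2 * t))"
    by (metis mult.assoc)
  then have "Bden t = t ^ 4 * (- 4 * sinc2 (2 * t)) - of_real (pi/2) * (1 - cos t)\<^sup>2"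
    unfolding Bden_def by (simp add: algebra_simps power2_eq_square power3_eq_cube power4_eq_xxxx)
  also have "of_real (pi/2) * (1 - cos t)\<^sup>2 = t ^ 4 * (of_real (pi/8) * sinc (t/2) ^ 4)"
    by (simp add: Cred_eq Cred_def)
  finally show ?thesis by (simp add: Bred_def algebra_simps)
qed

lemma sinc_compose_holomorphic: "(\<lambda>t. sinc (t/2)) holomorphic_on UNIV" "(\<lambda>t. sinc2 (2*t)) holomorphic_on UNIV"
  using holomorphic_on_compose_gen[OF _ sinc_holomorphic, of "\<lambda>t. t/2" UNIV]
        holomorphic_on_compose_gen[OF _ sinc2_holomorphic, of "\<lambda>t. 2*t" UNIV]
  by (simp_all add: o_def holomorphic_intros)

lemma red_holomorphic: "Ared holomorphic_on UNIV" "Bred holomorphic_on UNIV" "Cred holomorphic_on UNIV"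
  unfolding Ared_def[abs_def] Bred_def[abs_def] Cred_def[abs_def]
  by (intro holomorphic_intros sinc_compose_holomorphic sinc2_holomorphic; simp)+

lemma Anum_even: "Anum (- t) = Anum t" and Bden_even: "Bden (- t) = Bden t"
  by (simp_all add: Anum_def Bden_def)

lemma Ared_even: "Ared (- t) = Ared t" and Bred_even: "Bred (- t) = Bred t"
  using Anum_even[of t] Bden_even[of t] by (cases "t = 0"; simp add: Anum_eq Bden_eq)+

lemma Anum_cnj: "Anum (cnj t) = cnj (Anum t)" and Bden_cnj: "Bden (cnj t) = cnj (Bden t)"
  by (simp_all add: Anum_def Bden_def cnj_sin cnj_cos)

lemma Cred_nonzero: assumes "\<bar>Re t\<bar> < 2 * pi" shows "Cred t \<noteq> 0"
proof (cases "t = 0")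
  case True then show ?thesis by (simp add: Cred_def sinc_0)
next
  case False
  have "cos t \<noteq> 1"
  proof
    assume "cos t = 1"
    then obtain n :: int where n: "t = of_real (2 * pi * of_int n)"
      by (auto simp: cos_eq_1 algebra_simps)
    then have "2 * pi * \<bar>of_int n\<bar> < 2 * pi * 1" using assms by (simp add: abs_mult)
    then have "\<bar>real_of_int n\<bar> < 1" by (subst (asm) mult_less_cancel_left_pos) auto
    then have "n = 0" by simp
    with n False show False by simp
  qed
  then show ?thesis using Cred_eq[of t] by auto
qed

section \<open>Size of sine and cosine in the complex plane\<close>

lemma cos_Complex: "cos (Complex x y) = Complex (cos x * cosh y) (- sin x * sinh y)"
  and sin_Complex: "sin (Complex x y) = Complex (sin x * cosh y) (cos x * sinh y)"
  by (auto simp: complex_eq_iff Re_cos Im_cos Re_sin Im_sin cosh_def sinh_def field_simps)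

lemma cmod_cos_squared: "(cmod (cos t))\<^sup>2 = (cos (Re t))\<^sup>2 + (sinh (Im t))\<^sup>2"
proof -
  have "(cmod (cos (Complex (Re t) (Im t))))\<^sup>2 = (cos (Re t))\<^sup>2 * (cosh (Im t))\<^sup>2 + (sin (Re t))\<^sup>2 * (sinh (Im t))\<^sup>2"
    unfolding cos_Complex by (simp add: cmod_power2 power_mult_distrib)
  then show ?thesis by (simp add: cosh_square_eq sin_squared_eq algebra_simps)
qed

lemma cmod_sin_squared: "(cmod (sin t))\<^sup>2 = (sin (Re t))\<^sup>2 + (sinh (Im t))\<^sup>2"
proof -
  have "(cmod (sin (Complex (Re t) (Im t))))\<^sup>2 = (sin (Re t))\<^sup>2 * (cosh (Im t))\<^sup>2 + (cos (Re t))\<^sup>2 * (sinh (Im t))\<^sup>2"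
    unfolding sin_Complex by (simp add: cmod_power2 power_mult_distrib)
  then show ?thesis by (simp add: cosh_square_eq cos_squared_eq algebra_simps)
qed

lemma cmod_cos_bounds: "\<bar>sinh (Im t)\<bar> \<le> cmod (cos t)" "cmod (cos t) \<le> cosh (Im t)"
proof -
  have "\<bar>sinh (Im t)\<bar>\<^sup>2 \<le> (cmod (cos t))\<^sup>2" by (simp add: cmod_cos_squared)
  then show "\<bar>sinh (Im t)\<bar> \<le> cmod (cos t)" by (rule power2_le_imp_le) simp
  have "(cmod (cos t))\<^sup>2 \<le> (cosh (Im t))\<^sup>2"
    by (simp add: cmod_cos_squared cosh_square_eq) (simp add: cos_squared_eq)
  then show "cmod (cos t) \<le> cosh (Im t)" by (rule power2_le_imp_le) simp
qed

lemma cmod_sin_bounds: "\<bar>sinh (Im t)\<bar> \<le> cmod (sin t)" "cmod (sin t) \<le> cosh (Im t)"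
proof -
  have "\<bar>sinh (Im t)\<bar>\<^sup>2 \<le> (cmod (sin t))\<^sup>2" by (simp add: cmod_sin_squared)
  then show "\<bar>sinh (Im t)\<bar> \<le> cmod (sin t)" by (rule power2_le_imp_le) simp
  have "(cmod (sin t))\<^sup>2 \<le> (cosh (Im t))\<^sup>2"
    by (simp add: cmod_sin_squared cosh_square_eq) (simp add: sin_squared_eq)
  then show "cmod (sin t) \<le> cosh (Im t)" by (rule power2_le_imp_le) simp
qed

section \<open>Contour integrals over rectangles\<close>

lemma contour_integral_rectpath_split:
  assumes "continuous_on (path_image (rectpath (Complex x0 y0) (Complex x1 y1))) f" "x0 \<le> x1" "y0 \<le> y1"
  shows "contour_integral (rectpath (Complex x0 y0) (Complex x1 y1)) f =
    contour_integral (linepath (Complex x0 y0) (Complex x1 y0)) f +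
    contour_integral (linepath (Complex x1 y0) (Complex x1 y1)) f +
    contour_integral (linepath (Complex x1 y1) (Complex x0 y1)) f +
    contour_integral (linepath (Complex x0 y1) (Complex x0 y0)) f"
proof -
  have "path_image (rectpath (Complex x0 y0) (Complex x1 y1)) =
     closed_segment (Complex x0 y0) (Complex x1 y0) \<union> closed_segment (Complex x1 y0) (Complex x1 y1)
     \<union> closed_segment (Complex x1 y1) (Complex x0 y1) \<union> closed_segment (Complex x0 y1) (Complex x0 y0)"
    by (simp add: rectpath_def Let_def path_image_join Un_assoc)
  then have "f contour_integrable_on linepath (Complex x0 y0) (Complex x1 y0)"
    "f contour_integrable_on linepath (Complex x1 y0) (Complex x1 y1)"
    "f contour_integrable_on linepath (Complex x1 y1) (Complex x0 y1)"
    "f contour_integrable_on linepath (Complex x0 y1) (Complex x0 y0)"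
    using assms(1) by (auto intro!: contour_integrable_continuous_linepath elim: continuous_on_subset)
  then show ?thesis by (simp add: rectpath_def Let_def)
qed

lemma Cauchy_theorem_rectangle:
  assumes "f holomorphic_on cbox (Complex x0 y0) (Complex x1 y1)" "x0 \<le> x1" "y0 \<le> y1"
  shows "contour_integral (linepath (Complex x0 y0) (Complex x1 y0)) f +
    contour_integral (linepath (Complex x1 y0) (Complex x1 y1)) f +
    contour_integral (linepath (Complex x1 y1) (Complex x0 y1)) f +
    contour_integral (linepath (Complex x0 y1) (Complex x0 y0)) f = 0"
proof -
  have sub: "path_image (rectpath (Complex x0 y0) (Complex x1 y1)) \<subseteq> cbox (Complex x0 y0) (Complex x1 y1)"
    using assms by (intro path_image_rectpath_subset_cbox) auto
  have "(f has_contour_integral 0) (rectpath (Complex x0 y0) (Complex x1 y1))"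
    by (rule Cauchy_theorem_convex_simple[OF assms(1)]) (use sub in auto)
  moreover have "continuous_on (path_image (rectpath (Complex x0 y0) (Complex x1 y1))) f"
    using holomorphic_on_imp_continuous_on[OF assms(1)] sub continuous_on_subset by blast
  ultimately show ?thesis
    using contour_integral_rectpath_split[of x0 y0 x1 y1 f] assms by (simp add: contour_integral_unique)
qed

text \<open>The reflection t -> -t reverses the segment, but leaves f(t) dt unchanged because
  \<open>f\<close> is odd; hence the integral equals its own negative.\<close>

lemma contour_integral_odd_segment:
  assumes "continuous_on (closed_segment a (- a)) f" "\<And>z. f (- z) = - f z"
  shows "contour_integral (linepath a (- a)) f = 0"
proof -
  have "contour_integral (linepath (- a) a) f = contour_integral (uminus \<circ> linepath a (- a)) f"
    by (rule arg_cong2[where f = contour_integral]) (auto simp: linepath_def fun_eq_iff algebra_simps)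
  also have "\<dots> = contour_integral (linepath a (- a)) f"
    by (simp add: contour_integral_negatepath assms(2) contour_integral_neg)
  finally show ?thesis
    using contour_integral_reverse_linepath[OF assms(1)] by simp
qed

lemma continuous_on_cos_quotient:
  assumes "continuous_on S F" "\<And>t. t \<in> S \<Longrightarrow> cos t \<noteq> 0"
  shows "continuous_on S (\<lambda>t. F t * sin t / (- cos t) ^ Suc n :: complex)"
  using assms by (intro continuous_intros) auto

text \<open>The left side drops out, since \<open>F\<close> is even and the sine makes the integrand
  odd. Each horizontal side has length \<open>a \<le> pi\<close> and so costs at most
  \<open>pi * M\<close>; what remains is the right side.\<close>

lemma Taylor_coeff_right_side:
  assumes h: "h holomorphic_on ball 0 1"
    and F: "F holomorphic_on T" "open T" "cbox (Complex 0 (-R)) (Complex a R) \<subseteq> T"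
    and a: "pi/2 < a" "a \<le> pi" and R: "0 < R"
    and Fh: "\<And>t. \<lbrakk>0 < Re t; Re t < pi; cmod (cos t) < 1\<rbrakk> \<Longrightarrow> F t = h (- cos t)"
    and even: "\<And>t. F (- t) = F t"
    and M: "0 \<le> M" "\<And>t. \<lbrakk>0 \<le> Re t; Re t \<le> a; \<bar>Im t\<bar> = R\<rbrakk> \<Longrightarrow> cmod (F t * sin t / (- cos t) ^ Suc n) \<le> M"
  shows "cmod (2 * pi * \<i> * ((deriv ^^ n) h 0 / fact n)
      - contour_integral (linepath (Complex a (-R)) (Complex a R)) (\<lambda>t. F t * sin t / (- cos t) ^ Suc n))
     \<le> 2 * pi * M"
proof -
  let ?\<Phi> = "\<lambda>t. F t * sin t / (- cos t) ^ Suc n"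
  let ?P = "path_image (rectpath (Complex 0 (-R)) (Complex a R))"
  let ?I = "\<lambda>z w. contour_integral (linepath z w) ?\<Phi>"
  have sub: "?P \<subseteq> cbox (Complex 0 (-R)) (Complex a R)"
    using a R by (intro path_image_rectpath_subset_cbox) auto
  have nz: "cos t \<noteq> 0" if "t \<in> ?P" for t
  proof
    assume "cos t = 0"
    moreover have "0 \<le> Re t" "Re t \<le> pi" using that sub a by (auto simp: in_cbox_complex_iff)
    ultimately have "t = of_real (pi/2)" by (rule cos_eq_0_vertical_strip)
    then have "Re t = pi/2" "Im t = 0" by (simp_all only: Re_complex_of_real Im_complex_of_real)
    then have "t \<in> box (Complex 0 (-R)) (Complex a R)" using a R by (simp add: in_box_complex_iff)
    then show False
      using that path_image_rectpath_inter_box[of "Complex 0 (-R)" "Complex a R"] a R by auto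
  qed
  have cont: "continuous_on ?P ?\<Phi>"
    by (rule continuous_on_cos_quotient[OF _ nz])
       (use sub F in \<open>blast intro: holomorphic_on_imp_continuous_on continuous_on_subset\<close>)
  have P: "?P = closed_segment (Complex 0 (-R)) (Complex a (-R)) \<union> closed_segment (Complex a (-R)) (Complex a R)
     \<union> closed_segment (Complex a R) (Complex 0 R) \<union> closed_segment (Complex 0 R) (Complex 0 (-R))"
    by (simp add: rectpath_def Let_def path_image_join Un_assoc)
  have "2 * pi * \<i> * ((deriv ^^ n) h 0 / fact n) = contour_integral (rectpath (Complex 0 (-R)) (Complex a R)) ?\<Phi>"
    by (rule rectangle_integral_Taylor_coeff[OF h F a R Fh, symmetric])
  also have "\<dots> = ?I (Complex 0 (-R)) (Complex a (-R)) + ?I (Complex a (-R)) (Complex a R) +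
     ?I (Complex a R) (Complex 0 R) + ?I (Complex 0 R) (Complex 0 (-R))"
    using a R by (intro contour_integral_rectpath_split[OF cont]) auto
  also have "?I (Complex 0 R) (Complex 0 (-R)) = 0"
  proof -
    have "- Complex 0 R = Complex 0 (- R)" by (simp add: complex_eq_iff)
    moreover have "continuous_on (closed_segment (Complex 0 R) (Complex 0 (- R))) ?\<Phi>"
      by (rule continuous_on_subset[OF cont]) (auto simp: P)
    ultimately show ?thesis
      using contour_integral_odd_segment[of "Complex 0 R" ?\<Phi>] by (simp add: even)
  qed
  finally have eq: "2 * pi * \<i> * ((deriv ^^ n) h 0 / fact n) - ?I (Complex a (-R)) (Complex a R) =
     ?I (Complex 0 (-R)) (Complex a (-R)) + ?I (Complex a R) (Complex 0 R)" by simp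
  have horiz: "cmod (?I (Complex x y) (Complex x' y)) \<le> M * cmod (Complex x' y - Complex x y)"
    if "closed_segment (Complex x y) (Complex x' y) \<subseteq> ?P" "\<bar>y\<bar> = R" "0 \<le> x" "x \<le> a" "0 \<le> x'" "x' \<le> a" for x x' y
  proof (rule contour_integral_bound_linepath[OF _ M(1)])
    show "?\<Phi> contour_integrable_on linepath (Complex x y) (Complex x' y)"
      by (intro contour_integrable_continuous_linepath continuous_on_subset[OF cont] that)
    fix t assume "t \<in> closed_segment (Complex x y) (Complex x' y)"
    then have "t \<in> cbox (Complex 0 y) (Complex a y)"
      using closed_segment_subset[of "Complex x y" "cbox (Complex 0 y) (Complex a y)" "Complex x' y"] that
      by (auto simp: in_cbox_complex_iff)
    then show "cmod (?\<Phi> t) \<le> M"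
      using that(2) by (intro M(2)) (auto simp: in_cbox_complex_iff)
  qed
  have "cmod (?I (Complex 0 (-R)) (Complex a (-R))) \<le> M * a"
    using horiz[of 0 "-R" a] a R by (auto simp: P cmod_def)
  moreover have "cmod (?I (Complex a R) (Complex 0 R)) \<le> M * a"
    using horiz[of a R 0] a R by (auto simp: P cmod_def)
  moreover have "M * a \<le> pi * M" using a M(1) by (simp add: mult.commute mult_left_mono)
  moreover have "2 * pi * M = pi * M + pi * M" by simp
  ultimately show ?thesis
    unfolding eq by (intro order_trans[OF norm_triangle_ineq]) linarith
qed

section \<open>The function f0\<close>

definition tau :: "real \<Rightarrow> real" where "tau x = arcsin x + pi/2"

lemma tau_pos: "\<lbrakk>-1 < x; x \<le> 1\<rbrakk> \<Longrightarrow> 0 < tau x"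
  using arcsin_less_mono[of "-1" x] by (simp add: tau_def abs_le_iff)

lemma cos_tau: "\<lbrakk>-1 \<le> x; x \<le> 1\<rbrakk> \<Longrightarrow> cos (tau x) = - x"
  by (simp add: tau_def cos_add)

lemma sin_tau: "\<lbrakk>-1 \<le> x; x \<le> 1\<rbrakk> \<Longrightarrow> sin (tau x) = sqrt (1 - x\<^sup>2)"
  by (simp add: tau_def sin_add cos_arcsin)

lemma Arccos_minus_of_real:
  assumes "-1 < x" "x < 1"
  shows "Arccos (- of_real x) = of_real (tau x)"
proof -
  have "tau x < pi" using arcsin_less_mono[of x 1] assms by (simp add: tau_def abs_le_iff)
  then have "Arccos (cos (of_real (tau x))) = of_real (tau x)"
    using tau_pos assms by (intro Arccos_cos) auto
  moreover have "cos (of_real (tau x) :: complex) = - of_real x"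
    using cos_tau[of x] assms by (simp add: cos_of_real)
  ultimately show ?thesis by simp
qed

lemma Anum_of_real: "Anum (of_real s) = of_real (- (s\<^sup>2 * cos s) + s * sin s - pi/2 * (1 - cos s)\<^sup>2)"
  and Bden_of_real: "Bden (of_real s) = of_real (s\<^sup>2 - s * sin s * cos s - pi/2 * (1 - cos s)\<^sup>2)"
  by (simp_all add: Anum_def Bden_def flip: cos_of_real sin_of_real)

lemma cmod_cos_Arccos_strip:
  assumes "z \<in> ball 0 1"
  shows "0 < Re (Arccos (- z))" "Re (Arccos (- z)) < pi" "cmod (cos (Arccos (- z))) < 1"
  using Arccos_bounds[of "- z"] abs_Re_le_cmod[of z] assms by auto

lemma Arccos_minus_holomorphic: "(\<lambda>z. Arccos (- z)) holomorphic_on ball 0 1"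
proof -
  have "Arccos holomorphic_on ball 0 1"
    using abs_Re_le_cmod by (intro holomorphic_on_Arccos) (force intro: le_less_trans)
  then have "Arccos \<circ> uminus holomorphic_on ball 0 1"
    by (intro holomorphic_on_compose_gen[of uminus _ Arccos "ball 0 1"]) (auto intro: holomorphic_intros)
  then show ?thesis by (simp add: o_def)
qed

text \<open>\<open>Arccos (- z)\<close> inverts z = - cos t on the strip 0 < Re t < pi, so this is
  the continuation of \<open>f0\<close> to the unit disc.\<close>

definition hf :: "complex \<Rightarrow> complex" where
  "hf z = (Arccos (- z))\<^sup>2 * Ared (Arccos (- z))"

lemma hf_holomorphic: "hf holomorphic_on ball 0 1"
proof -
  have "(\<lambda>t. t\<^sup>2 * Ared t) holomorphic_on UNIV" by (intro holomorphic_intros red_holomorphic)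
  from holomorphic_on_compose_gen[OF Arccos_minus_holomorphic this]
  show ?thesis by (simp add: o_def hf_def[abs_def])
qed

lemma hf_minus_cos: "\<lbrakk>0 < Re t; Re t < pi\<rbrakk> \<Longrightarrow> hf (- cos t) = t\<^sup>2 * Ared t"
  by (simp add: hf_def Arccos_cos)

lemma Ared_eq: "t \<noteq> 0 \<Longrightarrow> t\<^sup>2 * Ared t = Anum t / t\<^sup>2"
  by (simp add: Anum_eq field_simps power4_eq_xxxx power2_eq_square)

lemma hf_of_real:
  assumes "-1 < x" "x < 1"
  shows "hf (of_real x) = of_real (f0 x)"
proof -
  have "of_real (tau x) \<noteq> (0::complex)" using tau_pos[of x] assms by simp
  then have "hf (of_real x) = Anum (of_real (tau x)) / (of_real (tau x))\<^sup>2"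
    unfolding hf_def Arccos_minus_of_real[OF assms] by (rule Ared_eq)
  also have "\<dots> = of_real ((tau x ^ 2 * x + tau x * sqrt (1 - x\<^sup>2) - pi/2 * (1 + x)\<^sup>2) / (tau x)\<^sup>2)"
    using assms by (simp add: Anum_of_real cos_tau sin_tau)
  also have "(tau x ^ 2 * x + tau x * sqrt (1 - x\<^sup>2) - pi/2 * (1 + x)\<^sup>2) / (tau x)\<^sup>2 = f0 x"
    using tau_pos[of x] assms unfolding f0_def tau_def[symmetric]
    by (simp add: diff_divide_distrib add_divide_distrib power2_eq_square)
  finally show ?thesis .
qed

lemma Anum_right_line: 
  "Anum (Complex pi s) = Complex ((pi\<^sup>2 - s\<^sup>2) * cosh s + s * sinh s - pi/2 * (1 + cosh s)\<^sup>2)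
      (2 * pi * s * cosh s - pi * sinh s)"
  and Bden_right_line: 
  "Bden (Complex pi s) = Complex (pi\<^sup>2 - s\<^sup>2 + s * sinh s * cosh s - pi/2 * (1 + cosh s)\<^sup>2)
      (2 * pi * s - pi * sinh s * cosh s)"
  unfolding Anum_def Bden_def cos_Complex sin_Complex
  by (simp_all add: complex_eq_iff power2_eq_square algebra_simps)

section \<open>Hyperbolic inequalities and the sign of the density of f0\<close>

lemma nonneg_of_deriv_nonneg:
  fixes f :: "real \<Rightarrow> real"
  assumes "\<And>y. \<lbrakk>0 \<le> y; y \<le> x\<rbrakk> \<Longrightarrow> (f has_real_derivative f' y) (at y)"
    "\<And>y. \<lbrakk>0 \<le> y; y \<le> x\<rbrakk> \<Longrightarrow> 0 \<le> f' y" "0 \<le> f 0" "0 \<le> x"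
  shows "0 \<le> f x"
  using DERIV_nonneg_imp_nondecreasing[of 0 x f] assms by force

lemma sinh_ge_self: "0 \<le> x \<Longrightarrow> x \<le> sinh (x::real)"
  using nonneg_of_deriv_nonneg[of x "\<lambda>x. sinh x - x" "\<lambda>x. cosh x - 1"]
  by (force intro!: derivative_eq_intros simp: cosh_real_ge_1)

lemma cosh_ge_quadratic: "0 \<le> x \<Longrightarrow> 1 + x\<^sup>2 / 2 \<le> cosh (x::real)"
  using nonneg_of_deriv_nonneg[of x "\<lambda>x. cosh x - (1 + x\<^sup>2 / 2)" "\<lambda>x. sinh x - x"]
  by (force intro!: derivative_eq_intros simp: sinh_ge_self)

lemma sinh_le_self_cosh: "0 \<le> x \<Longrightarrow> sinh x \<le> x * cosh (x::real)"
  using nonneg_of_deriv_nonneg[of x "\<lambda>x. x * cosh x - sinh x" "\<lambda>x. x * sinh x"]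
  by (force intro!: derivative_eq_intros)

lemma sinh_le_half_one_plus_cosh:
  assumes "0 \<le> s" shows "sinh s \<le> s / 2 * (1 + cosh (s::real))"
proof -
  have "sinh (2 * (s/2)) = 2 * cosh (s/2) * sinh (s/2)" "1 + cosh (2 * (s/2)) = 2 * (cosh (s/2))\<^sup>2"
    by (simp_all only: sinh_double cosh_double_cosh) simp_all
  moreover have "cosh (s/2) * sinh (s/2) \<le> cosh (s/2) * (s/2 * cosh (s/2))"
    using assms sinh_le_self_cosh[of "s/2"] by (intro mult_left_mono) auto
  ultimately show ?thesis by (simp add: power2_eq_square algebra_simps)
qed

text \<open>Combine sinh s <= s/2 (1 + cosh s) with (pi^2 + s^2)/2 <= pi (1 + cosh s); the latter
  follows from pi < 4 and cosh s >= 1 + s^2/2. The difference of the two sides is the numerator of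
  the density of \<open>f0\<close>.\<close>

lemma sinh_le_cosh_bound:
  assumes "0 \<le> (s::real)"
  shows "sinh s * (pi\<^sup>2 + s\<^sup>2) \<le> pi * s * (1 + cosh s)\<^sup>2"
proof -
  have "pi\<^sup>2 \<le> 4 * pi" "1 * s\<^sup>2 \<le> pi * s\<^sup>2"
    using pi_less_4 pi_gt3 by (simp add: power2_eq_square, intro mult_right_mono) auto
  moreover have "pi * (1 + (1 + s\<^sup>2/2)) \<le> pi * (1 + cosh s)"
    using cosh_ge_quadratic[OF assms] by simp
  ultimately have "(pi\<^sup>2 + s\<^sup>2) / 2 \<le> pi * (1 + cosh s)" by (simp add: algebra_simps)
  then have "s * (1 + cosh s) * ((pi\<^sup>2 + s\<^sup>2) / 2) \<le> s * (1 + cosh s) * (pi * (1 + cosh s))"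
    using assms by (intro mult_left_mono mult_nonneg_nonneg) (auto intro: add_nonneg_nonneg)
  moreover have "sinh s * (pi\<^sup>2 + s\<^sup>2) \<le> s / 2 * (1 + cosh s) * (pi\<^sup>2 + s\<^sup>2)"
    using sinh_le_half_one_plus_cosh[OF assms] by (intro mult_right_mono) auto
  ultimately show ?thesis by (simp add: power2_eq_square algebra_simps)
qed

text \<open>Over the denominator (pi^2 + s^2)^2 the imaginary part is pi times the difference of the
  two sides of \<open>sinh_le_cosh_bound\<close>. This difference is odd in s, so it has the sign of
  \<open>sinh s\<close>.\<close>

lemma Re_f_right_line: "0 \<le> Im ((Complex pi s)\<^sup>2 * Ared (Complex pi s)) * sinh s"
proof -
  have nz: "Complex pi s \<noteq> 0" by (simp add: complex_eq_iff)
  let ?d = "(pi\<^sup>2 + s\<^sup>2)\<^sup>2"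
  have d: "?d > 0" by (simp add: sum_power2_gt_zero_iff)
  have 1: "(Complex pi s)\<^sup>2 = Complex (pi\<^sup>2 - s\<^sup>2) (2 * pi * s)"
    by (simp add: complex_eq_iff power2_eq_square)
  have "Im (Anum (Complex pi s) / (Complex pi s)\<^sup>2) =
     ((2 * pi * s * cosh s - pi * sinh s) * (pi\<^sup>2 - s\<^sup>2) -
       ((pi\<^sup>2 - s\<^sup>2) * cosh s + s * sinh s - pi/2 * (1 + cosh s)\<^sup>2) * (2 * pi * s)) /
      ((pi\<^sup>2 - s\<^sup>2)\<^sup>2 + (2 * pi * s)\<^sup>2)"
    unfolding 1 Anum_right_line by (simp add: Im_divide)
  also have "(pi\<^sup>2 - s\<^sup>2)\<^sup>2 + (2 * pi * s)\<^sup>2 = ?d" by (simp add: power2_eq_square algebra_simps)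
  also have "(2 * pi * s * cosh s - pi * sinh s) * (pi\<^sup>2 - s\<^sup>2) -
       ((pi\<^sup>2 - s\<^sup>2) * cosh s + s * sinh s - pi/2 * (1 + cosh s)\<^sup>2) * (2 * pi * s) =
     pi * (pi * s * (1 + cosh s)\<^sup>2 - sinh s * (pi\<^sup>2 + s\<^sup>2))"
    by (simp add: power2_eq_square algebra_simps)
  finally have eq: "Im ((Complex pi s)\<^sup>2 * Ared (Complex pi s)) =
      pi * (pi * s * (1 + cosh s)\<^sup>2 - sinh s * (pi\<^sup>2 + s\<^sup>2)) / ?d"
    by (simp add: Ared_eq[OF nz])
  show ?thesis
  proof (cases "0 \<le> s")
    case True
    then show ?thesis unfolding eq using sinh_le_cosh_bound[of s] d
      by (intro mult_nonneg_nonneg divide_nonneg_nonneg) auto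
  next
    case False
    then have "pi * s * (1 + cosh s)\<^sup>2 - sinh s * (pi\<^sup>2 + s\<^sup>2) \<le> 0" using sinh_le_cosh_bound[of "-s"] by simp
    then show ?thesis unfolding eq using d False
      by (intro mult_nonpos_nonpos divide_nonpos_nonneg) (auto simp: mult_le_0_iff)
  qed
qed

text \<open>On this line - cos t = cosh s is real and sin t = - i sinh s is purely imaginary, so
  only the imaginary part of \<open>F\<close> enters.\<close>

lemma Re_\<Phi>_right_line:
  "Re (F (Complex pi s) * sin (Complex pi s) / (- cos (Complex pi s)) ^ Suc n) =
     Im (F (Complex pi s)) * sinh s / cosh s ^ Suc n"
proof -
  have "- cos (Complex pi s) = of_real (cosh s)" "sin (Complex pi s) = - \<i> * of_real (sinh s)"
    unfolding cos_Complex sin_Complex by (simp_all add: complex_eq_iff)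
  then have "F (Complex pi s) * sin (Complex pi s) / (- cos (Complex pi s)) ^ Suc n =
      - \<i> * F (Complex pi s) * of_real (sinh s / cosh s ^ Suc n)"
    by simp
  then show ?thesis by (simp only:) (simp del: of_real_divide of_real_power power_Suc)
qed

lemma continuous_on_vertical:
  assumes "continuous_on S f" "\<And>s. s \<in> {a..b} \<Longrightarrow> Complex c s \<in> S"
  shows "continuous_on {a..b} (\<lambda>s. f (Complex c s))"
proof -
  have "continuous_on {a..b} (\<lambda>s. Complex c s)" unfolding Complex_eq by (intro continuous_intros)
  then show ?thesis using continuous_on_compose2[OF assms(1)] assms(2) by blast
qed

lemma Re_vertical_integral:
  assumes "a < b"
  shows "Re (contour_integral (linepath (Complex c a) (Complex c b)) f / (2 * pi * \<i>)) =
     Re (integral {a..b} (\<lambda>x. f (Complex c x))) / (2 * pi)"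
proof -
  have "contour_integral (linepath (Complex c a) (Complex c b)) f = \<i> * integral {a..b} (\<lambda>x. f (Complex c x))"
    using assms by (intro contour_integral_linepath_same_Re) auto
  then have "contour_integral (linepath (Complex c a) (Complex c b)) f / (2 * pi * \<i>) =
      integral {a..b} (\<lambda>x. f (Complex c x)) / of_real (2 * pi)" by simp
  then show ?thesis by (simp only: Re_divide_of_real)
qed

text \<open>The minorant \<open>\<phi>\<close> only needs a known integral and may jump: it is taken
  to be 0, or a polynomial cut off to two intervals.\<close>

lemma Re_vertical_integral_ge:
  assumes "a < b" "continuous_on {a..b} (\<lambda>s. f (Complex c s))"
    "(\<phi> has_integral I) {a..b}" "\<And>s. s \<in> {a..b} \<Longrightarrow> \<phi> s \<le> Re (f (Complex c s))"
  shows "I / (2 * pi) \<le> Re (contour_integral (linepath (Complex c a) (Complex c b)) f / (2 * pi * \<i>))"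
proof -
  have "((\<lambda>s. f (Complex c s)) has_integral integral {a..b} (\<lambda>s. f (Complex c s))) {a..b}"
    using assms(2) by (simp add: integrable_continuous_real integrable_integral)
  then have "((\<lambda>s. Re (f (Complex c s))) has_integral Re (integral {a..b} (\<lambda>s. f (Complex c s)))) {a..b}"
    using has_integral_linear[OF _ bounded_linear_Re] by (simp add: o_def)
  then have "I \<le> Re (integral {a..b} (\<lambda>s. f (Complex c s)))"
    using assms(3,4) by (meson has_integral_le)
  then show ?thesis
    unfolding Re_vertical_integral[OF assms(1)] by (simp add: divide_right_mono)
qed

lemma Re_divide_fact_nonneg: "0 \<le> Re (z / fact n) \<longleftrightarrow> 0 \<le> Re z"
proof -
  have "Re (z / fact n) = Re z / fact n"
    using Re_divide_of_real[of z "fact n"] by (simp only: of_real_fact)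
  moreover have "\<not> fact n \<le> (0::real)" by (simp add: not_le)
  ultimately show ?thesis by (simp add: zero_le_divide_iff)
qed

lemma hf_coeff_nonneg:
  assumes n: "2 \<le> n"
  shows "0 \<le> Re ((deriv ^^ n) hf 0)"
proof -
  let ?F = "\<lambda>t. t\<^sup>2 * Ared t"
  let ?\<Phi> = "\<lambda>t. ?F t * sin t / (- cos t) ^ Suc n"
  let ?c = "(deriv ^^ n) hf 0 / fact n"
  \<comment> \<open>A majorant of the integrand on the horizontal sides, exact in order for n = 2:
    its last term decays only like 1 / R^2, the other two exponentially.\<close>
  define M where "M R = (cosh R + cosh R / R + pi/2 * (1 + cosh R)\<^sup>2 / R\<^sup>2) * cosh R / sinh R ^ 3" for R :: real
  have hol: "?F holomorphic_on UNIV" by (intro holomorphic_intros red_holomorphic)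
  have "- M R \<le> Re ?c" if R: "1 \<le> R" for R
  proof -
    have sR: "1 \<le> sinh R" using R sinh_ge_self[of R] by simp
    have M0: "0 \<le> M R" using R sR unfolding M_def
      by (intro divide_nonneg_nonneg mult_nonneg_nonneg add_nonneg_nonneg) auto
    have top: "cmod (?\<Phi> t) \<le> M R" if t: "0 \<le> Re t" "Re t \<le> pi" "\<bar>Im t\<bar> = R" for t
    proof -
      have ch: "cosh (Im t) = cosh R" and sh: "\<bar>sinh (Im t)\<bar> = sinh R"
        using t(3) cosh_real_abs[of "Im t"] sinh_real_abs[of "Im t"] by auto
      have cosb: "cmod (cos t) \<le> cosh R" "sinh R \<le> cmod (cos t)" "cmod (sin t) \<le> cosh R"
        using cmod_cos_bounds[of t] cmod_sin_bounds[of t] ch sh by auto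
      have tR: "R \<le> cmod t" using abs_Im_le_cmod[of t] t(3) by simp
      then have nz: "t \<noteq> 0" using R by auto
      have "?F t = - cos t + sin t / t - of_real (pi/2) * (1 - cos t)\<^sup>2 / t\<^sup>2"
        unfolding Ared_eq[OF nz] Anum_def using nz by (simp add: field_simps power2_eq_square)
      also have "cmod \<dots> \<le> cmod (- cos t) + cmod (sin t / t) + cmod (of_real (pi/2) * (1 - cos t)\<^sup>2 / t\<^sup>2)"
        by (intro order_trans[OF norm_triangle_ineq4] add_mono norm_triangle_ineq order_refl)
      also have "\<dots> \<le> cosh R + cosh R / R + pi/2 * (1 + cosh R)\<^sup>2 / R\<^sup>2"
      proof (intro add_mono)
        show "cmod (- cos t) \<le> cosh R" using cosb by simp
        show "cmod (sin t / t) \<le> cosh R / R"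
          unfolding norm_divide using cosb tR R by (intro frac_le) auto
        have "cmod (1 - cos t) \<le> 1 + cosh R"
          using norm_triangle_ineq4[of 1 "cos t"] cosb by simp
        then show "cmod (of_real (pi/2) * (1 - cos t)\<^sup>2 / t\<^sup>2) \<le> pi/2 * (1 + cosh R)\<^sup>2 / R\<^sup>2"
          unfolding norm_divide norm_mult norm_power using tR R by (intro frac_le mult_mono power_mono) auto
      qed
      finally have Fb: "cmod (?F t) \<le> cosh R + cosh R / R + pi/2 * (1 + cosh R)\<^sup>2 / R\<^sup>2" .
      have "sinh R ^ 3 \<le> cmod (cos t) ^ 3" using cosb sR R by (intro power_mono) auto
      \<comment> \<open>As \<open>cmod (cos t)\<close> is at least 1, exponents above 3 only help;
        here \<open>2 \<le> n\<close> enters.\<close>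
      also have "\<dots> \<le> cmod (cos t) ^ Suc n" using cosb sR n by (intro power_increasing) auto
      finally have "sinh R ^ 3 \<le> cmod ((- cos t) ^ Suc n)" by (simp only: norm_power norm_minus_cancel)
      moreover have "0 \<le> cosh R + cosh R / R + pi/2 * (1 + cosh R)\<^sup>2 / R\<^sup>2"
        using norm_ge_zero Fb by (rule order_trans)
      ultimately show ?thesis
        unfolding norm_divide norm_mult[of "?F t"] M_def using Fb cosb sR R
        by (intro frac_le mult_mono mult_nonneg_nonneg) auto
    qed
    have "cmod (2 * pi * \<i> * ?c - contour_integral (linepath (Complex pi (-R)) (Complex pi R)) ?\<Phi>) \<le> 2 * pi * M R"
      by (rule Taylor_coeff_right_side[OF hf_holomorphic hol open_UNIV subset_UNIV _ _ _ _ _ M0 top])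
         (use R in \<open>simp_all add: hf_minus_cos Ared_even\<close>)
    moreover have "?c - contour_integral (linepath (Complex pi (-R)) (Complex pi R)) ?\<Phi> / (2 * pi * \<i>) =
       (2 * pi * \<i> * ?c - contour_integral (linepath (Complex pi (-R)) (Complex pi R)) ?\<Phi>) / (2 * pi * \<i>)"
      by (simp add: diff_divide_distrib)
    ultimately have "cmod (?c - contour_integral (linepath (Complex pi (-R)) (Complex pi R)) ?\<Phi> / (2 * pi * \<i>)) \<le> M R"
      by (simp add: norm_divide norm_mult field_simps del: power_Suc)
    then have "\<bar>Re (?c - contour_integral (linepath (Complex pi (-R)) (Complex pi R)) ?\<Phi> / (2 * pi * \<i>))\<bar> \<le> M R"
      by (rule order_trans[OF abs_Re_le_cmod])
    moreover have "0 \<le> Re (contour_integral (linepath (Complex pi (-R)) (Complex pi R)) ?\<Phi> / (2 * pi * \<i>))"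
    proof -
      have "continuous_on {-R..R} (\<lambda>s. ?\<Phi> (Complex pi s))"
      proof (rule continuous_on_vertical[where S = "{t. Re t = pi}"])
        show "continuous_on {t. Re t = pi} ?\<Phi>"
        proof (rule continuous_on_cos_quotient)
          show "continuous_on {t. Re t = pi} ?F"
            using holomorphic_on_imp_continuous_on[OF hol] continuous_on_subset by blast
          show "cos t \<noteq> 0" if "t \<in> {t. Re t = pi}" for t
          proof
            assume "cos t = 0"
            then have "t = of_real (pi/2)" using that by (intro cos_eq_0_vertical_strip) auto
            then have "Re t = pi/2" by (simp only: Re_complex_of_real)
            then show False using that by simp
          qed
        qed
      qed simp
      moreover have "0 \<le> Re (?\<Phi> (Complex pi s))" for s
        unfolding Re_\<Phi>_right_line[of ?F] using Re_f_right_line[of s] by (intro divide_nonneg_nonneg) auto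
      ultimately show ?thesis
        using Re_vertical_integral_ge[of "-R" R ?\<Phi> pi "\<lambda>_. 0" 0] R by (simp del: power_Suc)
    qed
    ultimately show ?thesis by simp
  qed
  then have "eventually (\<lambda>R. - M R \<le> Re ?c) at_top"
    by (rule eventually_mono[OF eventually_ge_at_top])
  moreover have "(M \<longlongrightarrow> 0) at_top"
    unfolding M_def[abs_def] sinh_field_def cosh_field_def by real_asymp
  then have "((\<lambda>R. - M R) \<longlongrightarrow> 0) at_top" using tendsto_minus by fastforce
  ultimately have "0 \<le> Re ?c" by (intro tendsto_upperbound[of "\<lambda>R. - M R"]) auto
  then show ?thesis by (simp only: Re_divide_fact_nonneg)
qed

lemma f0_deriv_at_0: "(f0 has_real_derivative (1 - 2/pi)\<^sup>2) (at 0)"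
proof -
  have "(f0 has_real_derivative
     1 + (0 * (pi/2) - 1 * 1) / (pi/2 * (pi/2)) -
      ((pi/2 * 2) * (pi/2)\<^sup>2 - pi/2 * (2 * (pi/2))) / ((pi/2)\<^sup>2 * (pi/2)\<^sup>2)) (at 0)"
    unfolding f0_def[abs_def]
    by (auto intro!: derivative_eq_intros simp: power2_eq_square)
  also have "1 + (0 * (pi/2) - 1 * 1) / (pi/2 * (pi/2)) -
      ((pi/2 * 2) * (pi/2)\<^sup>2 - pi/2 * (2 * (pi/2))) / ((pi/2)\<^sup>2 * (pi/2)\<^sup>2) = (1 - 2/pi)\<^sup>2"
    by (simp add: field_simps power2_eq_square)
  finally show ?thesis .
qed

text \<open>The complex derivative at a real point can be computed along the real axis. This gives
  the coefficient of index 1 of \<open>hf\<close>, which the contour argument does not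
  reach.\<close>

lemma Re_deriv_of_real_extension:
  assumes "h holomorphic_on ball 0 1" "\<And>x. \<lbrakk>-1 < x; x < 1\<rbrakk> \<Longrightarrow> h (of_real x) = of_real (f x)"
    "(f has_real_derivative d) (at 0)"
  shows "Re (deriv h 0) = d"
proof -
  have "(h has_field_derivative deriv h (of_real 0)) (at (of_real 0))"
    using holomorphic_derivI[OF assms(1) open_ball, of 0] by simp
  then have "((\<lambda>x. h (of_real x)) has_vector_derivative deriv h (of_real 0)) (at 0 within {-1<..<1})"
    by (rule has_vector_derivative_real_field)
  then have "((\<lambda>x. Re (h (of_real x))) has_real_derivative Re (deriv h 0)) (at 0)"
    by (auto simp: has_real_derivative_iff_has_vector_derivative has_vector_derivative_complex_iff at_within_open[of _ "{-1<..<1}"])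
  then have "(f has_real_derivative Re (deriv h 0)) (at 0)"
    by (rule DERIV_cong_ev[THEN iffD1, rotated -1])
       (auto intro!: eventually_nhds_in_open[of "{-1<..<1}", THEN eventually_mono] simp: assms(2))
  then show ?thesis using assms(3) by (rule DERIV_unique)
qed

lemma absolutely_monotone_f0: "absolutely_monotone_01 f0"
proof (rule absolutely_monotone_01_of_Taylor_coeffs[OF hf_holomorphic])
  show "f0 x = Re (hf (of_real x))" if "x \<in> {0..<1}" for x
    using that hf_of_real[of x] by simp
  show "continuous_on {0..1} f0"
    unfolding f0_def[abs_def]
    using tau_pos by (intro continuous_intros) (force simp: tau_def)+
  show "0 \<le> Re ((deriv ^^ n) hf 0)" for n
  proof -
    consider "n = 0" | "n = 1" | "2 \<le> n" by linarith
    then show ?thesis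
    proof cases
      case 1
      have "f0 0 = 0" by (simp add: f0_def power2_eq_square)
      then show ?thesis using hf_of_real[of 0] 1 by simp
    next
      case 2
      then show ?thesis using Re_deriv_of_real_extension[OF hf_holomorphic hf_of_real f0_deriv_at_0] by simp
    next
      case 3 then show ?thesis by (rule hf_coeff_nonneg)
    qed
  qed
qed

section \<open>The density of g0 on the right-hand line\<close>

lemma exp_Taylor_bound:
  fixes x :: real
  assumes "\<bar>x\<bar> \<le> 2"
  shows "\<bar>exp x - (\<Sum>m<n. x ^ m / fact m)\<bar> \<le> 9 * \<bar>x\<bar> ^ n / fact n"
proof -
  obtain t where t: "\<bar>t\<bar> \<le> \<bar>x\<bar>" "exp x = (\<Sum>m<n. x ^ m / fact m) + exp t / fact n * x ^ n"
    using Maclaurin_exp_le[of x n] by blast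
  \<comment> \<open>The factor 9 is the crude bound for exp 2 in the Lagrange remainder.\<close>
  have "exp t \<le> exp (1 + 1)" using t(1) assms by simp
  also have "\<dots> \<le> 3 * 3" unfolding exp_add using exp_le by (intro mult_mono) auto
  finally have "exp t * \<bar>x\<bar> ^ n / fact n \<le> 9 * \<bar>x\<bar> ^ n / fact n"
    by (intro divide_right_mono mult_right_mono) auto
  then show ?thesis unfolding t(2) by (simp add: abs_mult power_abs)
qed

lemma exp_Taylor_bounds_12:
  fixes x :: real
  assumes "0 \<le> x" "x \<le> 2"
  shows "\<bar>exp x - (1 + x + x^2/2 + x^3/6 + x^4/24 + x^5/120 + x^6/720 + x^7/5040 + x^8/40320
             + x^9/362880 + x^10/3628800 + x^11/39916800)\<bar> \<le> 9 * x^12 / 479001600"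
    "\<bar>exp (-x) - (1 - x + x^2/2 - x^3/6 + x^4/24 - x^5/120 + x^6/720 - x^7/5040 + x^8/40320
             - x^9/362880 + x^10/3628800 - x^11/39916800)\<bar> \<le> 9 * x^12 / 479001600"
  using exp_Taylor_bound[of x 12] exp_Taylor_bound[of "-x" 12] assms
  by (simp_all add: lessThan_nat_numeral lessThan_Suc fact_numeral algebra_simps)

text \<open>Half the sum and half the difference of the expansions of exp x and exp (-x); by
  averaging, the error bound remains that of a single exponential.\<close>

lemma cosh_sinh_bounds:
  fixes x :: real
  assumes "0 \<le> x" "x \<le> 2"
  defines "C \<equiv> 1 + x^2/2 + x^4/24 + x^6/720 + x^8/40320 + x^10/3628800"
    and "S \<equiv> x + x^3/6 + x^5/120 + x^7/5040 + x^9/362880 + x^11/39916800"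
    and "e \<equiv> 9 * x^12 / 479001600"
  shows "C - e \<le> cosh x" "cosh x \<le> C + e" "S - e \<le> sinh x" "sinh x \<le> S + e"
proof -
  have "\<And>a b c :: real. \<bar>a - b\<bar> \<le> c \<Longrightarrow> b - c \<le> a \<and> a \<le> b + c" by linarith
  note e = this[OF exp_Taylor_bounds_12(1)[OF assms(1,2)]] this[OF exp_Taylor_bounds_12(2)[OF assms(1,2)]]
  show "C - e \<le> cosh x" "cosh x \<le> C + e" "S - e \<le> sinh x" "sinh x \<le> S + e"
    using e[THEN conjunct1] e[THEN conjunct2]
    unfolding cosh_field_def sinh_field_def C_def S_def e_def by argo+
qed

text \<open>The four evaluation points: 1.083 and 1.093 are the heights of the lower and upper sides
  of the box around the zero of the denominator, 1.088 is the height of its centre, and 1.05 is the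
  right end of the interval on which the density gets a positive lower bound.\<close>

lemma cosh_sinh_1088: "1.6526100 \<le> cosh (1.088::real)" "cosh (1.088::real) \<le> 1.6526111"
   "1.3157204 \<le> sinh (1.088::real)" "sinh (1.088::real) \<le> 1.3157215"
  by (rule order_trans[OF _ cosh_sinh_bounds(1)] order_trans[OF cosh_sinh_bounds(2)]
       order_trans[OF _ cosh_sinh_bounds(3)] order_trans[OF cosh_sinh_bounds(4)]; simp add: power_divide)+

lemma cosh_sinh_1083: "1.6460520 \<le> cosh (1.083::real)" "cosh (1.083::real) \<le> 1.6460531"
   "1.3074737 \<le> sinh (1.083::real)" "sinh (1.083::real) \<le> 1.3074748"
  by (rule order_trans[OF _ cosh_sinh_bounds(1)] order_trans[OF cosh_sinh_bounds(2)]
       order_trans[OF _ cosh_sinh_bounds(3)] order_trans[OF cosh_sinh_bounds(4)]; simp add: power_divide)+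

lemma cosh_sinh_1093: "1.6592093 \<le> cosh (1.093::real)" "cosh (1.093::real) \<le> 1.6592104"
   "1.3239999 \<le> sinh (1.093::real)" "sinh (1.093::real) \<le> 1.3240010"
  by (rule order_trans[OF _ cosh_sinh_bounds(1)] order_trans[OF cosh_sinh_bounds(2)]
       order_trans[OF _ cosh_sinh_bounds(3)] order_trans[OF cosh_sinh_bounds(4)]; simp add: power_divide)+

lemma cosh_sinh_105: "1.603794 \<le> cosh (1.05::real)" "cosh (1.05::real) \<le> 1.603795"
   "1.253856 \<le> sinh (1.05::real)" "sinh (1.05::real) \<le> 1.253857"
  by (rule order_trans[OF _ cosh_sinh_bounds(1)] order_trans[OF cosh_sinh_bounds(2)]
       order_trans[OF _ cosh_sinh_bounds(3)] order_trans[OF cosh_sinh_bounds(4)]; simp add: power_divide)+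

lemma sinh_ge_cubic: "0 \<le> x \<Longrightarrow> x + x^3 / 6 \<le> sinh (x::real)"
  using nonneg_of_deriv_nonneg[of x "\<lambda>x. sinh x - (x + x^3 / 6)" "\<lambda>x. cosh x - (1 + x\<^sup>2 / 2)"]
  by (force intro!: derivative_eq_intros simp: cosh_ge_quadratic)

text \<open>\<open>Kq s\<close> is s coth(s/2). \<open>Qq\<close> is the factor of the density of
  \<open>g0\<close> that changes sign; it is split off in
  \<open>Im_quotient_right_line\<close>.\<close>

definition Kq :: "real \<Rightarrow> real" where "Kq s = s * (1 + cosh s) / sinh s"
definition Qq :: "real \<Rightarrow> real" where "Qq s = pi\<^sup>2 + s\<^sup>2 - pi * Kq s - pi/2 * (1 + cosh s)"

lemma Kq_deriv:
  assumes "0 < s"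
  shows "(Kq has_real_derivative (1 + cosh s) * (sinh s - s) / (sinh s)\<^sup>2) (at s)"
proof -
  have "sinh s \<noteq> 0" using assms by simp
  then have "(Kq has_real_derivative ((1 * (1 + cosh s) + sinh s * s) * sinh s - s * (1 + cosh s) * cosh s) / (sinh s * sinh s)) (at s)"
    unfolding Kq_def[abs_def] by (auto intro!: derivative_eq_intros)
  also have "(1 * (1 + cosh s) + sinh s * s) * sinh s - s * (1 + cosh s) * cosh s = (1 + cosh s) * (sinh s - s)"
    using cosh_square_eq[of s] by (simp add: algebra_simps power2_eq_square)
  finally show ?thesis by (simp add: power2_eq_square)
qed

text \<open>Since 1 + cosh s >= 2 sinh s / s, the derivative of \<open>Kq\<close> is at least 2/s (1
  - s / sinh s); the cubic lower bound for sinh turns this into a rational function.\<close>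

lemma Kq_deriv_ge:
  fixes s :: real
  assumes "0 < s"
  shows "2 * s / (6 + s\<^sup>2) \<le> (1 + cosh s) * (sinh s - s) / (sinh s)\<^sup>2"
proof -
  have sp: "0 < sinh s" using assms sinh_ge_self[of s] by linarith
  have "2 * sinh s / s \<le> 1 + cosh s"
    using sinh_le_half_one_plus_cosh[of s] assms by (simp add: field_simps)
  then have "2 * sinh s / s * (sinh s - s) / (sinh s)\<^sup>2 \<le> (1 + cosh s) * (sinh s - s) / (sinh s)\<^sup>2"
    using sinh_ge_self[of s] assms by (intro divide_right_mono mult_right_mono) auto
  moreover have "2 * sinh s / s * (sinh s - s) / (sinh s)\<^sup>2 = 2 / s * (1 - s / sinh s)"
    using sp assms by (simp add: field_simps power2_eq_square)
  moreover have "s / sinh s \<le> 6 / (6 + s\<^sup>2)"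
  proof -
    have "s * (6 + s\<^sup>2) \<le> 6 * sinh s"
      using sinh_ge_cubic[of s] assms by (simp add: algebra_simps power2_eq_square power3_eq_cube)
    moreover have "6 + s\<^sup>2 > 0" by (simp add: add_pos_nonneg)
    ultimately show ?thesis using sp by (simp add: divide_simps mult.commute)
  qed
  then have "2 / s * (1 - 6 / (6 + s\<^sup>2)) \<le> 2 / s * (1 - s / sinh s)"
    using assms by (intro mult_left_mono) auto
  moreover have "2 / s * (1 - 6 / (6 + s\<^sup>2)) = 2 * s / (6 + s\<^sup>2)"
  proof -
    have "6 + s\<^sup>2 > 0" by (simp add: add_pos_nonneg)
    then show ?thesis using assms by (simp add: divide_simps) (simp add: power2_eq_square algebra_simps)
  qed
  ultimately show ?thesis by simp
qed

text \<open>With x = s^2, the estimates for sinh and for the derivative of \<open>Kq\<close> bound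
  the derivative of \<open>Qq + c * cosh\<close> by s times 2 - (pi/2 - c)(1 + x/6) - 2 pi/(6 + x),
  which the third hypothesis makes nonpositive. The case c = 0 is the monotonicity of
  \<open>Qq\<close>; c = 0.6 compares \<open>Qq\<close> with 1.653 - cosh.\<close>

lemma Qq_plus_cosh_antimono:
  assumes "0 < a" "a \<le> b"
    and "\<And>x. \<lbrakk>a\<^sup>2 \<le> x; x \<le> b\<^sup>2\<rbrakk> \<Longrightarrow> (2 - (pi/2 - c) * (1 + x/6)) * (6 + x) \<le> 2 * pi"
    and c: "c \<le> pi/2"
  shows "Qq b + c * cosh b \<le> Qq a + c * cosh a"
proof -
  let ?d = "\<lambda>s. 2 * s - pi * ((1 + cosh s) * (sinh s - s) / (sinh s)\<^sup>2) - pi/2 * sinh s + c * sinh s"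
  have der: "((\<lambda>s. Qq s + c * cosh s) has_real_derivative ?d s) (at s)" if "0 < s" for s
    unfolding Qq_def[abs_def] using Kq_deriv[OF that] by (auto intro!: derivative_eq_intros)
  have "?d s \<le> 0" if s: "a \<le> s" "s \<le> b" for s
  proof -
    have sp: "0 < s" using s assms by simp
    have p6: "6 + s\<^sup>2 > 0" by (simp add: add_pos_nonneg)
    have 1: "(pi/2 - c) * (s * (1 + s\<^sup>2/6)) \<le> (pi/2 - c) * sinh s"
      using sinh_ge_cubic[of s] sp c by (intro mult_left_mono) (auto simp: algebra_simps power2_eq_square power3_eq_cube)
    have 2: "pi * (2 * s / (6 + s\<^sup>2)) \<le> pi * ((1 + cosh s) * (sinh s - s) / (sinh s)\<^sup>2)"
      using Kq_deriv_ge[OF sp] by (intro mult_left_mono) auto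
    have 3: "s * (2 - (pi/2 - c) * (1 + s\<^sup>2/6)) \<le> s * (2 * pi / (6 + s\<^sup>2))"
    proof (rule mult_left_mono)
      have "a\<^sup>2 \<le> s\<^sup>2" "s\<^sup>2 \<le> b\<^sup>2" using s assms sp by (auto intro!: power_mono)
      from assms(3)[OF this] show "2 - (pi/2 - c) * (1 + s\<^sup>2/6) \<le> 2 * pi / (6 + s\<^sup>2)"
        using p6 by (simp add: pos_le_divide_eq)
    qed (use sp in auto)
    have 4: "s * (2 * pi / (6 + s\<^sup>2)) = pi * (2 * s / (6 + s\<^sup>2))" by simp
    have "2 * s - k - pi/2 * h + c * h \<le> 0"
      if "(pi/2 - c) * (s * z) \<le> (pi/2 - c) * h" "l \<le> k" "s * (2 - (pi/2 - c) * z) \<le> m" "m = l"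
      for k l m h z
      using that by (simp add: algebra_simps)
    from this[OF 1 2 3 4] show ?thesis .
  qed
  note nonpos = this
  show ?thesis
  proof (rule DERIV_nonpos_imp_nonincreasing[OF assms(2)])
    fix s assume s: "a \<le> s" "s \<le> b"
    then have "0 < s" using assms by simp
    from der[OF this] nonpos[OF s]
    show "\<exists>y. ((\<lambda>s. Qq s + c * cosh s) has_real_derivative y) (at s) \<and> y \<le> 0" by (intro exI conjI)
  qed
qed

lemma Qq_antimono: assumes "0 < a" "a \<le> b" shows "Qq b \<le> Qq a"
proof -
  have "(2 - pi/2 * (1 + x/6)) * (6 + x) \<le> 2 * pi" if "a\<^sup>2 \<le> x" for x
  proof -
    have x: "0 \<le> x" using that zero_le_power2[of a] by linarith
    have "(2 - pi/2 * (1 + x/6)) * (6 + x) = 12 - 3 * pi - (pi - 2) * x - pi * x\<^sup>2 / 12"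
      by (simp add: algebra_simps power2_eq_square)
    moreover have "0 \<le> (pi - 2) * x" "0 \<le> pi * x\<^sup>2 / 12" using x pi_gt3 by auto
    ultimately show ?thesis using pi_gt3 by linarith
  qed
  then show ?thesis using Qq_plus_cosh_antimono[OF assms, of 0] by simp
qed

lemma Qq_1083: "0 < Qq 1.083"
proof -
  have p: "3.1415926 \<le> pi" "pi \<le> 3.1415927" using pi_approx by auto
  have pp: "3.1415926 * 3.1415926 \<le> pi\<^sup>2" unfolding power2_eq_square using p by (intro mult_mono) auto
  note b = cosh_sinh_1083
  have "Kq 1.083 \<le> 1.083 * (1 + 1.6460531) / 1.3074737"
    unfolding Kq_def using b by (intro frac_le mult_mono) auto
  then have "pi * Kq 1.083 \<le> 3.1415927 * (1.083 * (1 + 1.6460531) / 1.3074737)"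
    using p b unfolding Kq_def by (intro mult_mono) auto
  moreover have "pi/2 * (1 + cosh 1.083) \<le> 3.1415927/2 * (1 + 1.6460531)"
    using p b by (intro mult_mono) auto
  ultimately show ?thesis using pp unfolding Qq_def by (simp add: power2_eq_square)
qed

lemma Qq_1093: "Qq 1.093 < 0"
proof -
  have p: "3.1415926 \<le> pi" "pi \<le> 3.1415927" using pi_approx by auto
  have pp: "pi\<^sup>2 \<le> 3.1415927 * 3.1415927" unfolding power2_eq_square using p by (intro mult_mono) auto
  note b = cosh_sinh_1093
  have "1.093 * (1 + 1.6592093) / 1.3240010 \<le> Kq 1.093"
    unfolding Kq_def using b by (intro frac_le mult_mono) auto
  then have "3.1415926 * (1.093 * (1 + 1.6592093) / 1.3240010) \<le> pi * Kq 1.093"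
    using p by (intro mult_mono) auto
  moreover have "3.1415926/2 * (1 + 1.6592093) \<le> pi/2 * (1 + cosh 1.093)"
    using p b by (intro mult_mono) auto
  ultimately show ?thesis using pp unfolding Qq_def by (simp add: power2_eq_square)
qed

lemma Qq_105: "0.6 * (1.653 - cosh 1.05) \<le> Qq 1.05"
proof -
  have p: "3.1415926 \<le> pi" "pi \<le> 3.1415927" using pi_approx by auto
  have pp: "3.1415926 * 3.1415926 \<le> pi\<^sup>2" unfolding power2_eq_square using p by (intro mult_mono) auto
  note b = cosh_sinh_105
  have "Kq 1.05 \<le> 1.05 * (1 + 1.603795) / 1.253856"
    unfolding Kq_def using b by (intro frac_le mult_mono) auto
  then have "pi * Kq 1.05 \<le> 3.1415927 * (1.05 * (1 + 1.603795) / 1.253856)"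
    using p b unfolding Kq_def by (intro mult_mono) auto
  moreover have "pi/2 * (1 + cosh 1.05) \<le> 3.1415927/2 * (1 + 1.603795)"
    using p b by (intro mult_mono) auto
  ultimately show ?thesis using pp b unfolding Qq_def by (simp add: power2_eq_square)
qed

text \<open>The difference of the two sides decreases up to 1.05, where \<open>Qq_105\<close>
  settles its sign. A bound proportional to 1.653 - cosh s is wanted because the denominator will be
  bounded by a multiple of its square.\<close>

lemma Qq_ge:
  assumes "0.7 \<le> s" "s \<le> 1.05"
  shows "0.6 * (1.653 - cosh s) \<le> Qq s"
proof -
  have "(2 - (pi/2 - 0.6) * (1 + x/6)) * (6 + x) \<le> 2 * pi" if x: "s\<^sup>2 \<le> x" "x \<le> 1.05\<^sup>2" for x
  proof -
    have "0.7\<^sup>2 \<le> s\<^sup>2" using assms by (intro power_mono) auto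
    then have x': "49/100 \<le> x" "x \<le> 441/400" using x by (auto simp: power2_eq_square)
    have p: "6283/2000 \<le> pi" using pi_approx by auto
    have "(2 - (6283/4000 - 3/5) * (1 + x/6)) * (6 + x) \<le> 6283/1000"
    proof -
      have "0 \<le> x * x" by simp
      then show ?thesis using x' by argo
    qed
    moreover have "(2 - (pi/2 - 0.6) * (1 + x/6)) * (6 + x) \<le> (2 - (6283/4000 - 3/5) * (1 + x/6)) * (6 + x)"
      using p x' by (intro mult_right_mono diff_left_mono) auto
    ultimately show ?thesis using p by linarith
  qed
  then have "Qq 1.05 + 0.6 * cosh 1.05 \<le> Qq s + 0.6 * cosh s"
    using assms pi_gt3 by (intro Qq_plus_cosh_antimono) auto
  then show ?thesis using Qq_105 by simp
qed

text \<open>Comparing this quotient with 2 decides the sign of pi (2 s - sinh s cosh s), the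
  imaginary part of the denominator on the right-hand line; by monotonicity one numerical value
  suffices on each side of the box.\<close>

lemma sinh_cosh_over_self_mono:
  fixes a b :: real
  assumes "0 < a" "a \<le> b"
  shows "sinh a * cosh a / a \<le> sinh b * cosh b / b"
proof (rule DERIV_nonneg_imp_nondecreasing[OF assms(2)])
  fix s assume "a \<le> s" "s \<le> b"
  then have s: "0 < s" using assms by simp
  have "((\<lambda>s. sinh s * cosh s / s) has_real_derivative
      ((cosh s * cosh s + sinh s * sinh s) * s - sinh s * cosh s * 1) / (s * s)) (at s)"
    using s by (auto intro!: derivative_eq_intros)
  moreover have "0 \<le> ((cosh s * cosh s + sinh s * sinh s) * s - sinh s * cosh s * 1) / (s * s)"
  proof (intro divide_nonneg_nonneg)
    have "sinh s * cosh s \<le> s * cosh s * cosh s"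
      using sinh_le_self_cosh[of s] s by (intro mult_right_mono) auto
    moreover have "0 \<le> sinh s * sinh s * s" using s by simp
    moreover have "(cosh s * cosh s + sinh s * sinh s) * s - sinh s * cosh s * 1 =
        (s * cosh s * cosh s - sinh s * cosh s) + sinh s * sinh s * s" by (simp add: algebra_simps)
    ultimately show "0 \<le> (cosh s * cosh s + sinh s * sinh s) * s - sinh s * cosh s * 1"
      by linarith
  qed simp
  ultimately show "\<exists>y. ((\<lambda>s. sinh s * cosh s / s) has_real_derivative y) (at s) \<and> 0 \<le> y" by blast
qed

lemma Im_B_pos: fixes s :: real assumes "0 < s" "s \<le> 1.083" shows "sinh s * cosh s < 2 * s"
proof -
  have "sinh (1.083::real) * cosh 1.083 \<le> 1.3074748 * 1.6460531"
    using cosh_sinh_1083 by (intro mult_mono) auto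
  moreover have "y \<le> 1.3074748 * 1.6460531 \<Longrightarrow> y / 1.083 < 2" for y :: real by simp
  ultimately have "sinh (1.083::real) * cosh 1.083 / 1.083 < 2" by blast
  then have "sinh s * cosh s / s < 2" using sinh_cosh_over_self_mono[OF assms] by linarith
  then show ?thesis using assms by (simp add: divide_simps)
qed

lemma Im_B_neg: fixes s :: real assumes "1.093 \<le> s" shows "2 * s < sinh s * cosh s"
proof -
  have "1.3239999 * 1.6592093 \<le> sinh (1.093::real) * cosh 1.093"
    using cosh_sinh_1093 by (intro mult_mono) auto
  moreover have "1.3239999 * 1.6592093 \<le> y \<Longrightarrow> 2 < y / 1.093" for y :: real by simp
  ultimately have "2 < sinh (1.093::real) * cosh 1.093 / 1.093" by blast
  moreover have "sinh (1.093::real) * cosh 1.093 / 1.093 \<le> sinh s * cosh s / s"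
    by (rule sinh_cosh_over_self_mono[OF _ assms]) simp
  ultimately have "2 < sinh s * cosh s / s" by linarith
  then show ?thesis using assms by (simp add: divide_simps)
qed

definition uB :: "real \<Rightarrow> real" where
  "uB s = pi\<^sup>2 - s\<^sup>2 + s * sinh s * cosh s - pi/2 * (1 + cosh s)\<^sup>2"

definition vB :: "real \<Rightarrow> real" where
  "vB s = 2 * pi * s - pi * sinh s * cosh s"

lemma Bden_right_line': "Bden (Complex pi s) = Complex (uB s) (vB s)"
  by (simp add: Bden_right_line uB_def vB_def)

text \<open>The numerator of the imaginary part factors: first cosh^2 - 1 = sinh^2 splits off, then
  a further sinh, and \<open>Qq\<close> is by definition what is left apart from pi.\<close>

lemma Im_quotient_right_line:
  assumes "0 < s"
  shows "Im (Anum (Complex pi s) / Bden (Complex pi s)) = pi * sinh s ^ 3 * Qq s / ((uB s)\<^sup>2 + (vB s)\<^sup>2)"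
proof -
  define c where "c = cosh s"
  define h where "h = sinh s"
  have hp: "h \<noteq> 0" using assms by (simp add: h_def)
  have c2: "c * c = h * h + 1" using cosh_square_eq[of s] by (simp add: c_def h_def power2_eq_square)
  have "Im (Anum (Complex pi s) / Bden (Complex pi s)) =
     ((2 * pi * s * c - pi * h) * uB s - ((pi\<^sup>2 - s\<^sup>2) * c + s * h - pi/2 * (1 + c)\<^sup>2) * vB s) / ((uB s)\<^sup>2 + (vB s)\<^sup>2)"
    unfolding Bden_right_line' Anum_right_line by (simp add: Im_divide c_def h_def)
  also have "(2 * pi * s * c - pi * h) * uB s - ((pi\<^sup>2 - s\<^sup>2) * c + s * h - pi/2 * (1 + c)\<^sup>2) * vB s
     = pi * (c * c - 1) * (h * (pi\<^sup>2 + s\<^sup>2) - pi/2 * (1 + c) * (2 * s + h))"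
    unfolding uB_def vB_def c_def[symmetric] h_def[symmetric] by algebra
  also have "c * c - 1 = h * h" using c2 by simp
  also have "h * (pi\<^sup>2 + s\<^sup>2) - pi/2 * (1 + c) * (2 * s + h) = h * Qq s"
    unfolding Qq_def Kq_def c_def[symmetric] h_def[symmetric] using hp by (simp add: field_simps)
  also have "pi * (h * h) * (h * Qq s) = pi * h ^ 3 * Qq s" by (simp add: power3_eq_cube)
  finally show ?thesis by (simp only: h_def)
qed

text \<open>For s > 0 both 1.653 - cosh s and \<open>Qq s\<close> decrease, and both change sign
  between 1.083 and 1.093, so outside this window they have the same sign. The constant 1.653 lies
  between cosh 1.083 and cosh 1.093.\<close>

lemma density_nonneg:
  assumes "0 \<le> s" "s \<le> 1.083 \<or> 1.093 \<le> s"
  shows "0 \<le> (1.653 - cosh s) * Im (Anum (Complex pi s) / Bden (Complex pi s)) * sinh s"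
proof (cases "s = 0")
  case False
  then have s: "0 < s" using assms by simp
  have "0 \<le> (1.653 - cosh s) * Qq s"
    using assms(2)
  proof
    assume le: "s \<le> 1.083"
    then have "cosh s \<le> cosh 1.083" using assms by (simp add: cosh_real_nonneg_le_iff)
    moreover have "Qq 1.083 \<le> Qq s" using s le by (rule Qq_antimono)
    ultimately show ?thesis using cosh_sinh_1083 Qq_1083 by (intro mult_nonneg_nonneg) auto
  next
    assume ge: "1.093 \<le> s"
    then have "cosh 1.093 \<le> cosh s" using assms by (simp add: cosh_real_nonneg_le_iff)
    moreover have "Qq s \<le> Qq 1.093" using ge by (intro Qq_antimono) auto
    ultimately show ?thesis using cosh_sinh_1093 Qq_1093 by (intro mult_nonpos_nonpos) auto
  qed
  then have "0 \<le> (1.653 - cosh s) * Qq s * (pi * sinh s ^ 4 / ((uB s)\<^sup>2 + (vB s)\<^sup>2))"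
    by (rule mult_nonneg_nonneg) (auto intro!: divide_nonneg_nonneg)
  also have "\<dots> = (1.653 - cosh s) * (pi * sinh s ^ 3 * Qq s / ((uB s)\<^sup>2 + (vB s)\<^sup>2)) * sinh s"
    by (simp add: power4_eq_xxxx power3_eq_cube)
  finally show ?thesis unfolding Im_quotient_right_line[OF s] .
qed simp

section \<open>Lower bound for the density between 0.7 and 1.05\<close>

lemma antimono_from_deriv:
  fixes f f' :: "real \<Rightarrow> real"
  assumes "a \<le> b" "\<And>x. \<lbrakk>a \<le> x; x \<le> b\<rbrakk> \<Longrightarrow> (f has_real_derivative f' x) (at x)"
    "\<And>x. \<lbrakk>a \<le> x; x \<le> b\<rbrakk> \<Longrightarrow> f' x \<le> 0"
  shows "f b \<le> f a"
  by (rule DERIV_nonpos_imp_nonincreasing[OF assms(1)]) (use assms(2,3) in blast)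

context
  fixes s :: real
  assumes s: "0.7 \<le> s" "s \<le> 1.05"
begin

lemma mid_bounds:
  assumes "s \<le> x" "x \<le> 1.05"
  shows "0.7 \<le> x" "0.75 \<le> sinh x" "sinh x \<le> 1.26" "1.24 \<le> cosh x" "cosh x \<le> 1.61"
proof -
  show x: "0.7 \<le> x" using s assms by simp
  have "0.7 ^ 3 \<le> x ^ 3" using x by (intro power_mono) auto
  then show "0.75 \<le> sinh x" using sinh_ge_cubic[of x] x by (simp add: power3_eq_cube)
  have "0.7 ^ 2 \<le> x ^ 2" using x by (intro power_mono) auto
  then show "1.24 \<le> cosh x" using cosh_ge_quadratic[of x] x by (simp add: power2_eq_square)
  have "sinh x \<le> sinh 1.05" using assms by (simp only: sinh_real_le_iff)
  then show "sinh x \<le> 1.26" by (rule order_trans) (use cosh_sinh_105 in simp)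
  have "cosh x \<le> cosh 1.05" using assms x by (simp add: cosh_real_nonneg_le_iff)
  then show "cosh x \<le> 1.61" by (rule order_trans) (use cosh_sinh_105 in simp)
qed

text \<open>This bound and the two for \<open>uB\<close> follow one scheme: the function to be shown
  nonnegative decreases up to 1.05 and is nonnegative there. Bounds proportional to 1.653 - cosh s
  are needed so that it cancels in \<open>density_ge\<close>.\<close>

lemma vB_le: "vB s \<le> 5.8 * (1.653 - cosh s)"
proof -
  let ?f = "\<lambda>s. 5.8 * (1.653 - cosh s) - vB s"
  have "?f 1.05 \<le> ?f s"
  proof (rule antimono_from_deriv[OF s(2)])
    show "(?f has_real_derivative - 5.8 * sinh x - (2 * pi - pi * (cosh x * cosh x + sinh x * sinh x))) (at x)" for x
      unfolding vB_def[abs_def] by (auto intro!: derivative_eq_intros simp: algebra_simps)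
    fix x assume x: "s \<le> x" "x \<le> 1.05"
    note b = mid_bounds[OF this]
    have "cosh x * cosh x = sinh x * sinh x + 1" using cosh_square_eq[of x] by (simp add: power2_eq_square)
    then have eq: "- 5.8 * sinh x - (2 * pi - pi * (cosh x * cosh x + sinh x * sinh x)) =
        sinh x * (2 * (pi * sinh x) - 5.8) - pi"
      by (simp add: algebra_simps)
    have "pi * sinh x \<le> 3.1416 * 1.26" using b pi_approx by (intro mult_mono) auto
    then have "sinh x * (2 * (pi * sinh x) - 5.8) \<le> sinh x * 2.2" using b by (intro mult_left_mono) auto
    moreover have "sinh x * 2.2 \<le> 1.26 * 2.2" using b by (intro mult_right_mono) auto
    moreover have "(1.26 * 2.2 :: real) \<le> 3" by simp
    ultimately show "- 5.8 * sinh x - (2 * pi - pi * (cosh x * cosh x + sinh x * sinh x)) \<le> 0"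
      unfolding eq using pi_gt3 by linarith
  qed
  moreover have "1.253856 * 1.603794 \<le> sinh (1.05::real) * cosh 1.05"
    using cosh_sinh_105 by (intro mult_mono) auto
  then have "pi * (2.1 - sinh 1.05 * cosh 1.05) \<le> 3.1416 * (2.1 - 1.253856 * 1.603794)"
    using pi_approx Im_B_pos[of "1.05"] by (intro mult_mono) auto
  then have "vB 1.05 \<le> 3.1416 * (2.1 - 1.253856 * 1.603794)" by (simp add: vB_def algebra_simps)
  then have "0 \<le> ?f 1.05" using cosh_sinh_105 by simp
  ultimately show ?thesis by linarith
qed

lemma uB_deriv: "(uB has_real_derivative
     (- x + 2 * x * (sinh x)\<^sup>2 + sinh x * (cosh x - pi - pi * cosh x))) (at x)"
proof -
  have "(uB has_real_derivative - (2 * x) + ((1 * sinh x + cosh x * x) * cosh x + sinh x * (x * sinh x))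
      - pi/2 * (2 * (1 + cosh x) * sinh x)) (at x)"
    unfolding uB_def[abs_def] by (auto intro!: derivative_eq_intros simp: algebra_simps power2_eq_square)
  also have "- (2 * x) + ((1 * sinh x + cosh x * x) * cosh x + sinh x * (x * sinh x))
      - pi/2 * (2 * (1 + cosh x) * sinh x) = - x + 2 * x * (sinh x)\<^sup>2 + sinh x * (cosh x - pi - pi * cosh x)"
    using cosh_square_eq[of x] by (simp add: algebra_simps power2_eq_square)
  finally show ?thesis .
qed

lemma uB_105: "0 \<le> uB 1.05" "uB 1.05 \<le> 6 * (1.653 - cosh 1.05)"
proof -
  have p: "3.14159 \<le> pi" "pi \<le> 3.1416" using pi_approx by auto
  have "3.14159 * 3.14159 \<le> pi * pi" using p by (intro mult_mono) auto
  moreover have "pi * pi \<le> 3.1416 * 3.1416" using p by (intro mult_mono) auto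
  moreover have "1.253856 * 1.603794 \<le> sinh (1.05::real) * cosh 1.05"
    using cosh_sinh_105 by (intro mult_mono) auto
  moreover have "sinh (1.05::real) * cosh 1.05 \<le> 1.253857 * 1.603795"
    using cosh_sinh_105 by (intro mult_mono) auto
  moreover have "3.14159 * (2.603794 * 2.603794) \<le> pi * ((1 + cosh 1.05) * (1 + cosh 1.05))"
    using p cosh_sinh_105 by (intro mult_mono) auto
  moreover have "pi * ((1 + cosh 1.05) * (1 + cosh 1.05)) \<le> 3.1416 * (2.603795 * 2.603795)"
    using p cosh_sinh_105 by (intro mult_mono) auto
  moreover have "uB 1.05 = pi * pi - 1.1025 + 1.05 * (sinh 1.05 * cosh 1.05) - pi * ((1 + cosh 1.05) * (1 + cosh 1.05)) / 2"
    by (simp add: uB_def power2_eq_square)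
  moreover have "0 \<le> a - 1.1025 + 1.05 * b - c / 2 \<and> a - 1.1025 + 1.05 * b - c / 2 \<le> 6 * (1.653 - 1.603795)"
    if "3.14159 * 3.14159 \<le> a" "a \<le> 3.1416 * 3.1416" "1.253856 * 1.603794 \<le> b" "b \<le> 1.253857 * 1.603795"
      "3.14159 * (2.603794 * 2.603794) \<le> c" "c \<le> 3.1416 * (2.603795 * 2.603795)" for a b c :: real
    using that by simp
  ultimately have "0 \<le> uB 1.05 \<and> uB 1.05 \<le> 6 * (1.653 - 1.603795)" by metis
  then show "0 \<le> uB 1.05" "uB 1.05 \<le> 6 * (1.653 - cosh 1.05)" using cosh_sinh_105 by simp_all
qed

lemma uB_le: "uB s \<le> 6 * (1.653 - cosh s)"
proof -
  let ?f = "\<lambda>s. 6 * (1.653 - cosh s) - uB s"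
  have "?f 1.05 \<le> ?f s"
  proof (rule antimono_from_deriv[OF s(2)])
    show "(?f has_real_derivative - 6 * sinh x - (- x + 2 * x * (sinh x)\<^sup>2 + sinh x * (cosh x - pi - pi * cosh x))) (at x)" for x
      by (auto intro!: derivative_eq_intros uB_deriv)
    fix x assume x: "s \<le> x" "x \<le> 1.05"
    note b = mid_bounds[OF this]
    \<comment> \<open>The variable x is multiplied by 1 - 2 sinh^2 <= 0, so it may be replaced by a
      lower bound; a multiple of sinh x is chosen to make sinh x a common factor. The number 1.305
      is 2.61 / 2.\<close>
    have "sinh x \<le> x / 2 * (1 + cosh x)" using b by (intro sinh_le_half_one_plus_cosh) auto
    also have "\<dots> \<le> x / 2 * 2.61" using b by (intro mult_left_mono) auto
    finally have x1: "sinh x / 1.305 \<le> x" by simp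
    have "0.75 * 0.75 \<le> sinh x * sinh x" using b by (intro mult_mono) auto
    then have neg: "1 - 2 * (sinh x)\<^sup>2 \<le> 0" by (simp add: power2_eq_square)
    have "x * (1 - 2 * (sinh x)\<^sup>2) \<le> sinh x / 1.305 * (1 - 2 * (sinh x)\<^sup>2)"
      using x1 neg by (rule mult_right_mono_neg)
    moreover have "sinh x / 1.305 * (1 - 2 * (sinh x)\<^sup>2) + sinh x * (pi - 6 + (pi - 1) * cosh x) \<le> 0"
    proof -
      have "pi * (1 + cosh x) \<le> 63/20 * (1 + cosh x)" using b pi_approx by (intro mult_right_mono) auto
      moreover have "(sinh x)\<^sup>2 = (cosh x)\<^sup>2 - 1" using cosh_square_eq[of x] by simp
      \<comment> \<open>This product bounds cosh^2 from below by a linear function of cosh, after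
        which linear arithmetic suffices.\<close>
      moreover have "0 \<le> (cosh x - 31/25) * (cosh x - 1)" using b by simp
      then have "56/25 * cosh x - 31/25 \<le> (cosh x)\<^sup>2" unfolding power2_eq_square by argo
      moreover have "31/25 \<le> cosh x" using b by simp
      ultimately have "(1 - 2 * (sinh x)\<^sup>2) * (200/261) + (pi - 6 + (pi - 1) * cosh x) \<le> 0"
        by argo
      then have "(1 - 2 * (sinh x)\<^sup>2) / 1.305 + (pi - 6 + (pi - 1) * cosh x) \<le> 0" by simp
      then have "sinh x * ((1 - 2 * (sinh x)\<^sup>2) / 1.305 + (pi - 6 + (pi - 1) * cosh x)) \<le> 0"
        using b by (simp add: mult_le_0_iff)
      then show ?thesis by (simp add: algebra_simps)
    qed
    moreover have "- 6 * sinh x - (- x + 2 * x * (sinh x)\<^sup>2 + sinh x * (cosh x - pi - pi * cosh x)) =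
        x * (1 - 2 * (sinh x)\<^sup>2) + sinh x * (pi - 6 + (pi - 1) * cosh x)"
      by (simp add: algebra_simps)
    ultimately show "- 6 * sinh x - (- x + 2 * x * (sinh x)\<^sup>2 + sinh x * (cosh x - pi - pi * cosh x)) \<le> 0"
      by linarith
  qed
  then show ?thesis using uB_105 by simp
qed

lemma uB_ge: "- 6 * (1.653 - cosh s) \<le> uB s"
proof -
  let ?f = "\<lambda>s. 6 * (1.653 - cosh s) + uB s"
  have "?f 1.05 \<le> ?f s"
  proof (rule antimono_from_deriv[OF s(2)])
    show "(?f has_real_derivative - 6 * sinh x + (- x + 2 * x * (sinh x)\<^sup>2 + sinh x * (cosh x - pi - pi * cosh x))) (at x)" for x
      by (auto intro!: derivative_eq_intros uB_deriv)
    fix x assume x: "s \<le> x" "x \<le> 1.05"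
    note b = mid_bounds[OF this]
    have "x * sinh x \<le> 1.05 * 1.26" using b x by (intro mult_mono) auto
    then have "x * sinh x * sinh x \<le> 1.323 * sinh x" using b by (intro mult_right_mono) auto
    moreover have "1 * cosh x \<le> pi * cosh x" using b pi_gt3 by (intro mult_right_mono) auto
    then have "cosh x - pi - pi * cosh x \<le> 0" using pi_gt_zero by linarith
    then have "sinh x * (cosh x - pi - pi * cosh x) \<le> 0" using b by (intro mult_nonneg_nonpos) auto
    moreover have "2 * x * (sinh x)\<^sup>2 = 2 * (x * sinh x * sinh x)" by (simp add: power2_eq_square)
    moreover have "1.323 * sinh x \<le> 3 * sinh x" "0 \<le> x" "0 \<le> sinh x" using b by auto
    ultimately show "- 6 * sinh x + (- x + 2 * x * (sinh x)\<^sup>2 + sinh x * (cosh x - pi - pi * cosh x)) \<le> 0"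
      by linarith
  qed
  then show ?thesis using uB_105 cosh_sinh_105 by simp
qed

text \<open>Put d = 1.653 - cosh s. The numerator contains d * Qq s >= 0.6 d^2, while the
  denominator is at most (6^2 + 5.8^2) d^2 = 69.64 d^2, so d cancels; 0.02706 is just below 0.6 pi /
  69.64. The polynomial is a minorant of sinh^4 obtained from the cubic bound and Bernoulli's
  inequality, and it can be integrated exactly.\<close>

lemma density_ge:
  "0.02706 * (s ^ 4 + 2/3 * s ^ 6) \<le>
     (1.653 - cosh s) * Im (Anum (Complex pi s) / Bden (Complex pi s)) * sinh s"
proof -
  have sp: "0 < s" using s by simp
  define d where "d = 1.653 - cosh s"
  have d: "0 < d" using mid_bounds[of s] s by (auto simp: d_def)
  have "0 \<le> pi * (2 * s - sinh s * cosh s)" using Im_B_pos[of s] s by (intro mult_nonneg_nonneg) auto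
  then have v0: "0 \<le> vB s" by (simp add: vB_def algebra_simps)
  have "(uB s)\<^sup>2 \<le> (6 * d)\<^sup>2" using uB_le uB_ge by (intro abs_le_square_iff[THEN iffD1]) (auto simp: d_def)
  moreover have "(vB s)\<^sup>2 \<le> (5.8 * d)\<^sup>2" using vB_le v0 by (intro power_mono) (auto simp: d_def)
  ultimately have uv: "(uB s)\<^sup>2 + (vB s)\<^sup>2 \<le> 69.64 * d\<^sup>2" by (simp add: power_mult_distrib power_divide)
  have vpos: "0 < vB s" using Im_B_pos[of s] s pi_gt_zero by (simp add: vB_def)
  then have uvp: "0 < (uB s)\<^sup>2 + (vB s)\<^sup>2" by (simp add: sum_power2_gt_zero_iff)
  have "s * (1 + s\<^sup>2/6) \<le> sinh s"
    using sinh_ge_cubic[of s] sp by (simp add: algebra_simps power2_eq_square power3_eq_cube)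
  then have "(s * (1 + s\<^sup>2/6)) ^ 4 \<le> sinh s ^ 4" using sp by (intro power_mono) auto
  moreover have "-1 \<le> s\<^sup>2/6" by (rule order_trans[of _ 0]) auto
  then have "1 + 4 * (s\<^sup>2/6) \<le> (1 + s\<^sup>2/6) ^ 4" using Bernoulli_inequality[of "s\<^sup>2/6" 4] by simp
  then have "s ^ 4 * (1 + 4 * (s\<^sup>2/6)) \<le> s ^ 4 * (1 + s\<^sup>2/6) ^ 4" by (intro mult_left_mono) auto
  moreover have "(s * (1 + s\<^sup>2/6)) ^ 4 = s ^ 4 * (1 + s\<^sup>2/6) ^ 4" by (rule power_mult_distrib)
  moreover have "s ^ 4 * (1 + 4 * (s\<^sup>2/6)) = s ^ 4 + 2/3 * s ^ 6" by (simp add: algebra_simps flip: power_add)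
  ultimately have s4: "s ^ 4 + 2/3 * s ^ 6 \<le> sinh s ^ 4" by linarith
  have "0.02706 * (s ^ 4 + 2/3 * s ^ 6) \<le> (pi * 0.6 / 69.64) * sinh s ^ 4"
    using s4 pi_approx sp by (intro mult_mono) auto
  also have "\<dots> = pi * sinh s ^ 4 * (0.6 * d * d) / (69.64 * d\<^sup>2)"
    using d by (simp add: power2_eq_square)
  also have "\<dots> \<le> pi * sinh s ^ 4 * (Qq s * d) / ((uB s)\<^sup>2 + (vB s)\<^sup>2)"
    using uv uvp d Qq_ge[OF s] sp by (intro frac_le mult_left_mono mult_right_mono) (auto simp: d_def)
  also have "\<dots> = d * (pi * sinh s ^ 3 * Qq s / ((uB s)\<^sup>2 + (vB s)\<^sup>2)) * sinh s"
    by (simp add: power4_eq_xxxx power3_eq_cube)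
  finally show ?thesis unfolding Im_quotient_right_line[OF sp] d_def .
qed

end

section \<open>The box around the zeros of the denominator\<close>

text \<open>The remainder is the integral of \<open>f' x - f' w\<close> over the segment from
  \<open>w\<close> to \<open>z\<close>; at parameter x the integrand is bounded by x times M times
  the squared distance, hence the factor 1/2.\<close>

lemma first_order_Taylor_bound:
  fixes f f' f'' :: "complex \<Rightarrow> complex"
  assumes S: "convex S" "w \<in> S" "z \<in> S"
    and f: "\<And>x. x \<in> S \<Longrightarrow> (f has_field_derivative f' x) (at x within S)"
    and f': "\<And>x. x \<in> S \<Longrightarrow> (f' has_field_derivative f'' x) (at x within S)"
    and M: "\<And>x. x \<in> S \<Longrightarrow> cmod (f'' x) \<le> M"
  shows "cmod (f z - f w - f' w * (z - w)) \<le> M / 2 * (cmod (z - w))\<^sup>2"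
proof -
  have sub: "closed_segment w z \<subseteq> S" using S by (simp add: closed_segment_subset)
  have "((\<lambda>x. f x - f' w * x) has_field_derivative (f' x - f' w)) (at x within S)" if "x \<in> S" for x
    using f[OF that] by (auto intro!: derivative_eq_intros)
  from contour_integral_primitive[OF this, of "linepath w z"]
  have "((\<lambda>x. f' x - f' w) has_contour_integral (f z - f w - f' w * (z - w))) (linepath w z)"
    using sub by (simp add: algebra_simps)
  then have I: "((\<lambda>x. (f' (linepath w z x) - f' w) * (z - w)) has_integral (f z - f w - f' w * (z - w))) {0..1}"
    by (simp add: has_contour_integral_linepath)
  have J: "((\<lambda>x. x * (M * (cmod (z - w))\<^sup>2)) has_integral ((1\<^sup>2 - 0\<^sup>2) / 2 * (M * (cmod (z - w))\<^sup>2))) {0..1::real}"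
    by (intro has_integral_mult_left ident_has_integral) simp
  have "cmod ((f' (linepath w z x) - f' w) * (z - w)) \<le> x * (M * (cmod (z - w))\<^sup>2)" if x: "x \<in> {0..1}" for x
  proof -
    have "linepath w z x \<in> S" using sub x linepath_in_path[of x w z] by auto
    then have "cmod (f' (linepath w z x) - f' w) \<le> M * cmod (linepath w z x - w)"
      using field_differentiable_bound[OF S(1) f' M] S(2) by blast
    also have "linepath w z x - w = of_real x * (z - w)"
      by (simp add: linepath_def algebra_simps scaleR_conv_of_real)
    finally have "cmod (f' (linepath w z x) - f' w) * cmod (z - w) \<le> M * (x * cmod (z - w)) * cmod (z - w)"
      using x by (intro mult_right_mono) (auto simp: norm_mult)
    then show ?thesis by (simp add: norm_mult power2_eq_square mult_ac)
  qed
  then have "norm (integral {0..1} (\<lambda>x. (f' (linepath w z x) - f' w) * (z - w))) \<le> integral {0..1} (\<lambda>x. x * (M * (cmod (z - w))\<^sup>2))"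
    using I J by (intro integral_norm_bound_integral) (auto intro: has_integral_integrable)
  then show ?thesis using integral_unique[OF I] integral_unique[OF J] by simp
qed

section \<open>First and second derivatives and their size on the box\<close>

definition dA :: "complex \<Rightarrow> complex" where
  "dA t = - t * cos t + t\<^sup>2 * sin t + sin t - of_real pi * ((1 - cos t) * sin t)"
definition ddA :: "complex \<Rightarrow> complex" where
  "ddA t = 3 * (t * sin t) + t\<^sup>2 * cos t - of_real pi * ((sin t)\<^sup>2 + (1 - cos t) * cos t)"
definition dB :: "complex \<Rightarrow> complex" where
  "dB t = 2 * t - sin t * cos t - t * ((cos t)\<^sup>2 - (sin t)\<^sup>2) - of_real pi * ((1 - cos t) * sin t)"
definition ddB :: "complex \<Rightarrow> complex" where
  "ddB t = 2 - 2 * ((cos t)\<^sup>2 - (sin t)\<^sup>2) + 4 * (t * (sin t * cos t)) - of_real pi * ((sin t)\<^sup>2 + (1 - cos t) * cos t)"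
text \<open>The numerator over \<open>Bden\<close> of (1.653 + cos t) A/B - 1.14. Near the zero of
  \<open>Bden\<close> the factor 1.653 + cos t almost vanishes too, and 1.14 approximates the real
  part of the quotient of the derivatives of numerator and denominator at \<open>tc\<close>, so both
  \<open>NN\<close> and \<open>dN\<close> are small there.\<close>

definition NN :: "complex \<Rightarrow> complex" where
  "NN t = (of_real 1.653 + cos t) * Anum t - of_real 1.14 * Bden t"
definition dN :: "complex \<Rightarrow> complex" where
  "dN t = - sin t * Anum t + (of_real 1.653 + cos t) * dA t - of_real 1.14 * dB t"
definition ddN :: "complex \<Rightarrow> complex" where
  "ddN t = - (cos t * Anum t) - 2 * (sin t * dA t) + (of_real 1.653 + cos t) * ddA t - of_real 1.14 * ddB t"

lemma A_derivs: "(Anum has_field_derivative dA t) (at t within S)" "(dA has_field_derivative ddA t) (at t within S)"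
  unfolding Anum_def[abs_def] dA_def[abs_def] ddA_def
  by (auto intro!: derivative_eq_intros simp: algebra_simps power2_eq_square)

lemma B_derivs: "(Bden has_field_derivative dB t) (at t within S)" "(dB has_field_derivative ddB t) (at t within S)"
  unfolding Bden_def[abs_def] dB_def[abs_def] ddB_def
  by (auto intro!: derivative_eq_intros simp: algebra_simps power2_eq_square)

lemma N_derivs: "(NN has_field_derivative dN t) (at t within S)" "(dN has_field_derivative ddN t) (at t within S)"
  unfolding NN_def[abs_def] dN_def[abs_def] ddN_def
  by (auto intro!: derivative_eq_intros A_derivs B_derivs simp: algebra_simps)

abbreviation tc :: complex where "tc \<equiv> Complex pi 1.088"

text \<open>The box extends to both sides of Re t = pi in order to be centred at \<open>tc\<close>,
  the point of expansion; the contour only goes around its left half.\<close>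

definition boxS :: "complex set" where
  "boxS = {t. pi - 0.005 \<le> Re t \<and> Re t \<le> pi + 0.005 \<and> 1.083 \<le> Im t \<and> Im t \<le> 1.093}"

lemma boxS_convex: "convex boxS"
proof -
  have "boxS = cbox (Complex (pi - 0.005) 1.083) (Complex (pi + 0.005) 1.093)"
    by (auto simp: boxS_def in_cbox_complex_iff)
  then show ?thesis by (metis convex_box(1))
qed

lemma tc_boxS: "tc \<in> boxS" by (simp add: boxS_def)

lemma boxS_dist:
  assumes "t \<in> boxS" shows "(cmod (t - tc))\<^sup>2 \<le> 5/100000" "cmod (t - tc) \<le> 0.0071"
proof -
  have "\<bar>Re t - pi\<bar> \<le> 0.005" "\<bar>Im t - 1.088\<bar> \<le> 0.005"
    using assms unfolding boxS_def by (simp_all only: abs_le_iff) auto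
  then have "\<bar>Re t - pi\<bar>\<^sup>2 \<le> 0.005\<^sup>2" "\<bar>Im t - 1.088\<bar>\<^sup>2 \<le> 0.005\<^sup>2"
    by (intro power_mono; simp)+
  then show *: "(cmod (t - tc))\<^sup>2 \<le> 5/100000" by (simp add: cmod_power2 power_divide)
  show "cmod (t - tc) \<le> 0.0071"
    by (rule power2_le_imp_le) (use * in \<open>simp_all add: power_divide\<close>)
qed

lemma boxS_bounds:
  assumes "t \<in> boxS"
  shows "cmod t \<le> 3.34" "cmod (sin t) \<le> 1.66" "cmod (cos t) \<le> 1.66" "cmod (1 - cos t) \<le> 2.66"
proof -
  have i: "0 \<le> Im t" "Im t \<le> 1.093" and r: "\<bar>Re t\<bar> \<le> 3.15" using assms pi_approx by (auto simp: boxS_def abs_le_iff)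
  have "\<bar>Re t\<bar>\<^sup>2 \<le> 3.15\<^sup>2" using r by (intro power_mono) auto
  moreover have "(Im t)\<^sup>2 \<le> 1.093\<^sup>2" using i by (intro power_mono) auto
  ultimately have "(cmod t)\<^sup>2 \<le> 3.34\<^sup>2" by (simp add: cmod_power2 power_divide)
  then show "cmod t \<le> 3.34" by (rule power2_le_imp_le) simp
  have "cosh (Im t) \<le> cosh 1.093" using i by (simp add: cosh_real_nonneg_le_iff)
  then have "cosh (Im t) \<le> 1.66" by (rule order_trans) (use cosh_sinh_1093 in simp)
  then show "cmod (sin t) \<le> 1.66" and c: "cmod (cos t) \<le> 1.66"
    using cmod_sin_bounds(2)[of t] cmod_cos_bounds(2)[of t] by linarith+
  show "cmod (1 - cos t) \<le> 2.66" using norm_triangle_ineq4[of 1 "cos t"] c by simp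
qed

lemma boxS_cos_near:
  assumes "t \<in> boxS" shows "cmod (cos t - cos tc) \<le> 0.012"
proof -
  have "cmod (cos t - cos tc) \<le> 1.66 * cmod (t - tc)"
  proof (rule field_differentiable_bound[OF boxS_convex])
    show "(cos has_field_derivative - sin z) (at z within boxS)" for z
      by (auto intro!: derivative_eq_intros)
    show "cmod (- sin z) \<le> 1.66" if "z \<in> boxS" for z using boxS_bounds[OF that] by simp
  qed (use assms tc_boxS in auto)
  also have "\<dots> \<le> 1.66 * 0.0071" using boxS_dist[OF assms] by (intro mult_left_mono) auto
  finally show ?thesis by simp
qed

lemma cos_tc: "cos tc = of_real (- cosh 1.088)" and sin_tc: "sin tc = - \<i> * of_real (sinh 1.088)"
  unfolding cos_Complex sin_Complex by (simp_all add: complex_eq_iff)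

lemma ddB_bound: assumes "t \<in> boxS" shows "cmod (ddB t) \<le> 73"
proof -
  note b = boxS_bounds[OF assms]
  have s2: "cmod ((sin t)\<^sup>2) \<le> 1.66\<^sup>2" "cmod ((cos t)\<^sup>2) \<le> 1.66\<^sup>2"
    unfolding norm_power using b by (auto intro!: power_mono)
  have "cmod (t * (sin t * cos t)) \<le> 3.34 * (1.66 * 1.66)"
    unfolding norm_mult using b by (intro mult_mono) auto
  moreover have "cmod ((1 - cos t) * cos t) \<le> 2.66 * 1.66"
    unfolding norm_mult using b by (intro mult_mono) auto
  then have "cmod ((sin t)\<^sup>2 + (1 - cos t) * cos t) \<le> 1.66\<^sup>2 + 2.66 * 1.66"
    using s2 by (intro order_trans[OF norm_triangle_ineq] add_mono)
  then have "cmod (of_real pi * ((sin t)\<^sup>2 + (1 - cos t) * cos t)) \<le> 3.1416 * (1.66\<^sup>2 + 2.66 * 1.66)"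
    unfolding norm_mult using pi_approx by (intro mult_mono) auto
  moreover have "cmod ((cos t)\<^sup>2 - (sin t)\<^sup>2) \<le> 1.66\<^sup>2 + 1.66\<^sup>2"
    using s2 by (intro order_trans[OF norm_triangle_ineq4] add_mono)
  ultimately have "2 + cmod (2 * ((cos t)\<^sup>2 - (sin t)\<^sup>2)) + cmod (4 * (t * (sin t * cos t)))
      + cmod (of_real pi * ((sin t)\<^sup>2 + (1 - cos t) * cos t)) \<le>
     2 + 2 * (1.66\<^sup>2 + 1.66\<^sup>2) + 4 * (3.34 * (1.66 * 1.66)) + 3.1416 * (1.66\<^sup>2 + 2.66 * 1.66)"
    by (intro add_mono) (auto simp only: norm_mult norm_numeral intro!: mult_left_mono)
  moreover have "cmod (2 - a + b - c) \<le> 2 + cmod a + cmod b + cmod c" for a b c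
    using norm_triangle_ineq4[of "2 - a + b" c] norm_triangle_ineq[of "2 - a" b] norm_triangle_ineq4[of 2 a] by simp
  ultimately have "cmod (ddB t) \<le>
     2 + 2 * (1.66\<^sup>2 + 1.66\<^sup>2) + 4 * (3.34 * (1.66 * 1.66)) + 3.1416 * (1.66\<^sup>2 + 2.66 * 1.66)"
    unfolding ddB_def by (meson order_trans)
  also have "\<dots> \<le> 73" by (simp add: power_divide)
  finally show ?thesis .
qed

text \<open>Every product is estimated by \<open>boxS_bounds\<close>. The factor of
  \<open>ddA\<close> is at most 0.013, because 1.653 is close to cosh 1.088 and the cosine varies
  little on the box, so that term contributes hardly anything.\<close>

lemma ddN_bound: assumes "t \<in> boxS" shows "cmod (ddN t) \<le> 275"
proof -
  note b = boxS_bounds[OF assms]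
  have t2: "cmod (t\<^sup>2) \<le> 3.34\<^sup>2" unfolding norm_power using b by (intro power_mono) auto
  have tc': "cmod (t * cos t) \<le> 3.34 * 1.66" "cmod (t * sin t) \<le> 3.34 * 1.66"
    "cmod (t\<^sup>2 * cos t) \<le> 3.34\<^sup>2 * 1.66" "cmod (t\<^sup>2 * sin t) \<le> 3.34\<^sup>2 * 1.66"
    "cmod ((1 - cos t) * sin t) \<le> 2.66 * 1.66" "cmod ((1 - cos t) * cos t) \<le> 2.66 * 1.66"
    using b t2 by (simp only: norm_mult, intro mult_mono; simp)+
  have A: "cmod (Anum t) \<le> 35.3"
  proof -
    have "cmod ((1 - cos t)\<^sup>2) \<le> 2.66\<^sup>2" unfolding norm_power using b by (intro power_mono) auto
    then have p: "cmod (of_real (pi/2) * (1 - cos t)\<^sup>2) \<le> 1.5708 * 2.66\<^sup>2"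
      unfolding norm_mult using pi_approx by (intro mult_mono) auto
    have tri: "cmod (- a + b' - c) \<le> cmod a + cmod b' + cmod c" for a b' c :: complex
      using norm_triangle_ineq4[of "- a + b'" c] norm_triangle_ineq[of "- a" b'] by simp
    show ?thesis unfolding Anum_def
      by (rule order_trans[OF tri], rule order_trans[OF add_mono[OF add_mono[OF tc'(3) tc'(2)] p]])
         (simp add: power_divide)
  qed
  have dA: "cmod (dA t) \<le> 39.7"
  proof -
    have p: "cmod (of_real pi * ((1 - cos t) * sin t)) \<le> 3.1416 * (2.66 * 1.66)"
      unfolding norm_mult[of "of_real pi"] using pi_approx tc' by (intro mult_mono) auto
    have tri: "cmod (- t * cos t + b' + c - d) \<le> cmod (t * cos t) + cmod b' + cmod c + cmod d" for b' c d :: complex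
      using norm_triangle_ineq4[of "- t * cos t + b' + c" d] norm_triangle_ineq[of "- t * cos t + b'" c]
        norm_triangle_ineq[of "- t * cos t" b'] by simp
    show ?thesis unfolding dA_def
      by (rule order_trans[OF tri], rule order_trans[OF add_mono[OF add_mono[OF add_mono[OF tc'(1) tc'(4)] b(2)] p]])
         (simp add: power_divide)
  qed
  have ddA: "cmod (ddA t) \<le> 58"
  proof -
    have "cmod ((sin t)\<^sup>2) \<le> 1.66\<^sup>2" unfolding norm_power using b by (intro power_mono) auto
    then have "cmod ((sin t)\<^sup>2 + (1 - cos t) * cos t) \<le> 1.66\<^sup>2 + 2.66 * 1.66"
      using tc' by (intro order_trans[OF norm_triangle_ineq] add_mono)
    then have p: "cmod (of_real pi * ((sin t)\<^sup>2 + (1 - cos t) * cos t)) \<le> 3.1416 * (1.66\<^sup>2 + 2.66 * 1.66)"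
      unfolding norm_mult[of "of_real pi"] using pi_approx by (intro mult_mono) auto
    have tri: "cmod (3 * a + b' - c) \<le> 3 * cmod a + cmod b' + cmod c" for a b' c :: complex
      using norm_triangle_ineq4[of "3 * a + b'" c] norm_triangle_ineq[of "3 * a" b'] by (simp add: norm_mult)
    have t3: "3 * cmod (t * sin t) \<le> 3 * (3.34 * 1.66)" using tc'(2) by (intro mult_left_mono) auto
    show ?thesis unfolding ddA_def
      by (rule order_trans[OF tri], rule order_trans[OF add_mono[OF add_mono[OF t3 tc'(3)] p]])
         (simp add: power_divide)
  qed
  have "cmod (of_real 1.653 + cos t) \<le> 0.013"
  proof -
    have "of_real 1.653 + cos t = of_real (1.653 - cosh 1.088) + (cos t - cos tc)"
      unfolding cos_tc by simp
    also have "cmod \<dots> \<le> \<bar>1.653 - cosh 1.088\<bar> + 0.012"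
      using boxS_cos_near[OF assms] by (intro order_trans[OF norm_triangle_ineq] add_mono) (simp_all only: norm_of_real order_refl)
    also have "\<dots> \<le> 0.013" using cosh_sinh_1088 by simp
    finally show ?thesis .
  qed
  then have n1: "cmod ((of_real 1.653 + cos t) * ddA t) \<le> 0.013 * 58"
    unfolding norm_mult using ddA by (intro mult_mono) auto
  have n2: "cmod (cos t * Anum t) \<le> 1.66 * 35.3"
    unfolding norm_mult using A b by (intro mult_mono) auto
  have n3: "2 * cmod (sin t * dA t) \<le> 2 * (1.66 * 39.7)"
    unfolding norm_mult using dA b by (intro mult_left_mono mult_mono) auto
  have n4: "cmod (of_real 1.14 * ddB t) \<le> 1.14 * 73"
    unfolding norm_mult using ddB_bound[OF assms] by (intro mult_mono) auto
  have tri: "cmod (- a - 2 * b' + c - d) \<le> cmod a + 2 * cmod b' + cmod c + cmod d" for a b' c d :: complex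
    using norm_triangle_ineq4[of "- a - 2 * b' + c" d] norm_triangle_ineq[of "- a - 2 * b'" c]
      norm_triangle_ineq4[of "- a" "2 * b'"] by (simp add: norm_mult)
  show ?thesis unfolding ddN_def
    by (rule order_trans[OF tri], rule order_trans[OF add_mono[OF add_mono[OF add_mono[OF n2 n3] n1] n4]]) simp
qed

text \<open>One multiplication in interval arithmetic, with outward rounding to \<open>l\<close> and
  \<open>u\<close>.\<close>

lemma interval_mult:
  fixes x y :: real
  assumes "a \<le> x \<and> x \<le> b" "c \<le> y \<and> y \<le> d" "0 \<le> a" "0 \<le> c" "l \<le> a * c" "b * d \<le> u"
  shows "l \<le> x * y \<and> x * y \<le> u"
proof -
  have "a * c \<le> x * y" "x * y \<le> b * d" using assms by (auto intro!: mult_mono)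
  then show ?thesis using assms by linarith
qed

lemma center_values:
  "-0.0011 \<le> Re (Bden tc) \<and> Re (Bden tc) \<le> -0.00107" (is ?ReB)
  "0.0051 \<le> Im (Bden tc) \<and> Im (Bden tc) \<le> 0.00512" (is ?ImB)
  "4.7331 \<le> Re (Anum tc) \<and> Re (Anum tc) \<le> 4.7333" (is ?ReA)
  "7.1639 \<le> Im (Anum tc) \<and> Im (Anum tc) \<le> 7.164" (is ?ImA)
  "14.186 \<le> Re (dA tc) \<and> Re (dA tc) \<le> 14.187" (is ?RedA)
  "0.018 \<le> Im (dA tc) \<and> Im (dA tc) \<le> 0.019" (is ?ImdA)
  "-7.7354 \<le> Re (dB tc) \<and> Re (dB tc) \<le> -7.7353" (is ?RedB)
  "6.1111 \<le> Im (dB tc) \<and> Im (dB tc) \<le> 6.1112" (is ?ImdB)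
proof -
  define c :: real where "c = cosh 1.088"
  define h :: real where "h = sinh 1.088"
  have hh: "h * h = c * c - 1" using cosh_square_eq[of "1.088::real"] by (simp add: c_def h_def power2_eq_square)
  have p: "3.1415926 \<le> pi \<and> pi \<le> 3.1415927" using pi_approx by auto
  have c: "1.65261 \<le> c \<and> c \<le> 1.6526111" using cosh_sinh_1088 by (simp add: c_def)
  have h: "1.3157204 \<le> h \<and> h \<le> 1.3157215" using cosh_sinh_1088 by (simp add: h_def)
  have p2: "9.869604 \<le> pi * pi \<and> pi * pi \<le> 9.869605"
    by (rule interval_mult[OF p p]) simp_all
  have ch: "2.174372 \<le> c * h \<and> c * h \<le> 2.174376"
    by (rule interval_mult[OF c h]) simp_all
  have cc: "2.731119 \<le> c * c \<and> c * c \<le> 2.731124"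
    by (rule interval_mult[OF c c]) simp_all
  have pc: "5.191827 \<le> pi * c \<and> pi * c \<le> 5.191831"
    by (rule interval_mult[OF p c]) simp_all
  have ph: "4.133457 \<le> pi * h \<and> pi * h \<le> 4.133462"
    by (rule interval_mult[OF p h]) simp_all
  have p2c: "16.310606 \<le> (pi * pi) * c \<and> (pi * pi) * c \<le> 16.310619"
    by (rule interval_mult[OF p2 c]) simp_all
  have p2h: "12.985639 \<le> (pi * pi) * h \<and> (pi * pi) * h \<le> 12.985652"
    by (rule interval_mult[OF p2 h]) simp_all
  have pch: "6.83099 \<le> pi * (c * h) \<and> pi * (c * h) \<le> 6.831004"
    by (rule interval_mult[OF p ch]) simp_all
  have pcc: "8.580063 \<le> pi * (c * c) \<and> pi * (c * c) \<le> 8.58008"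
    by (rule interval_mult[OF p cc]) simp_all
  \<comment> \<open>With the products named, all eight claims become linear in quantities with known
    enclosures.\<close>
  define p2v where "p2v = pi * pi"
  define chv where "chv = c * h"
  define ccv where "ccv = c * c"
  define pcv where "pcv = pi * c"
  define phv where "phv = pi * h"
  define p2cv where "p2cv = (pi * pi) * c"
  define p2hv where "p2hv = (pi * pi) * h"
  define pchv where "pchv = pi * (c * h)"
  define pccv where "pccv = pi * (c * c)"
  note vs = pcc[folded pccv_def] pch[folded pchv_def] p2h[folded p2hv_def] p2c[folded p2cv_def] ph[folded phv_def] pc[folded pcv_def] cc[folded ccv_def] ch[folded chv_def] p2[folded p2v_def]
  have B: "Bden tc = Complex (p2v - 1.088 * 1.088 + 1.088 * chv - (pi + 2 * pcv + pccv) / 2)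
      (2 * 1.088 * pi - pchv)"
    unfolding Bden_right_line c_def[symmetric] h_def[symmetric] p2v_def chv_def pcv_def pccv_def pchv_def
    by (simp add: algebra_simps power2_eq_square)
  have A: "Anum tc = Complex (p2cv - 1.088 * 1.088 * c + 1.088 * h - (pi + 2 * pcv + pccv) / 2)
      (2 * 1.088 * pcv - phv)"
    unfolding Anum_right_line c_def[symmetric] h_def[symmetric] p2cv_def pcv_def pccv_def phv_def
    by (simp add: algebra_simps power2_eq_square)
  have dA: "dA tc = Complex (pcv + 2 * 1.088 * phv)
      (1.088 * c - p2hv + 1.088 * 1.088 * h - h + phv + pchv)"
    unfolding dA_def cos_tc sin_tc c_def[symmetric] h_def[symmetric] pcv_def phv_def p2hv_def pchv_def
    by (simp add: complex_eq_iff algebra_simps power2_eq_square)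
  have dB: "dB tc = Complex (3 * pi - 2 * pccv)
      (3 * 1.088 - chv - 2 * 1.088 * ccv + phv + pchv)"
  proof -
    have "dB tc = Complex (2 * pi - pi * (c * c + h * h)) (2 * 1.088 - c * h - 1.088 * (c * c + h * h) + pi * h + pi * (c * h))"
      unfolding dB_def cos_tc sin_tc c_def[symmetric] h_def[symmetric]
      by (simp add: complex_eq_iff algebra_simps power2_eq_square)
    then show ?thesis unfolding hh pccv_def chv_def ccv_def phv_def pchv_def by (simp add: field_simps)
  qed
  show ?ReB using vs p unfolding B complex.sel by (auto simp: add_divide_distrib diff_divide_distrib)
  show ?ImB using vs p unfolding B complex.sel by (auto simp: add_divide_distrib diff_divide_distrib)
  show ?ReA using vs p c h unfolding A complex.sel by (auto simp: add_divide_distrib diff_divide_distrib)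
  show ?ImA using vs p c h unfolding A complex.sel by (auto simp: add_divide_distrib diff_divide_distrib)
  show ?RedA using vs p c h unfolding dA complex.sel by (auto simp: add_divide_distrib diff_divide_distrib)
  show ?ImdA using vs p c h unfolding dA complex.sel by (auto simp: add_divide_distrib diff_divide_distrib)
  show ?RedB using vs p unfolding dB complex.sel by (auto simp: add_divide_distrib diff_divide_distrib)
  show ?ImdB using vs p unfolding dB complex.sel by (auto simp: add_divide_distrib diff_divide_distrib)
qed

lemma cmod_le_of_Re_Im:
  assumes "\<bar>Re z\<bar> \<le> a" "\<bar>Im z\<bar> \<le> b" "a\<^sup>2 + b\<^sup>2 \<le> r\<^sup>2" "0 \<le> r"
  shows "cmod z \<le> r"
proof -
  have "(Re z)\<^sup>2 \<le> a\<^sup>2" "(Im z)\<^sup>2 \<le> b\<^sup>2" using assms by (auto intro!: abs_le_square_iff[THEN iffD1])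
  then have "(cmod z)\<^sup>2 \<le> r\<^sup>2" using assms(3) by (simp add: cmod_power2)
  then show ?thesis using assms(4) by (rule power2_le_imp_le)
qed

lemma center_norms:
  "cmod (Bden tc) \<le> 0.0054" "9.855 \<le> cmod (dB tc)" "cmod (NN tc) \<le> 0.0045" "cmod (dN tc) \<le> 0.955"
proof -
  note v = center_values
  show "cmod (Bden tc) \<le> 0.0054"
    by (rule cmod_le_of_Re_Im[of _ "0.0011" "0.00512"]) (use v(1,2) in \<open>simp_all add: abs_le_iff power_divide\<close>)
  have "7.7353\<^sup>2 \<le> (- Re (dB tc))\<^sup>2" "6.1111\<^sup>2 \<le> (Im (dB tc))\<^sup>2"
    using v(7,8) by (intro power_mono; simp)+
  then have "9.855\<^sup>2 \<le> (cmod (dB tc))\<^sup>2" by (simp add: cmod_power2 power_divide)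
  then show "9.855 \<le> cmod (dB tc)" by (rule power2_le_imp_le) simp
  \<comment> \<open>This is the value of 1.653 + cos t at \<open>tc\<close>, only about
    0.0004.\<close>
  define e where "e = 1.653 - cosh (1.088::real)"
  have e: "0.0003889 \<le> e \<and> e \<le> 0.00039" using cosh_sinh_1088 by (simp add: e_def)
  have e': "of_real 1.653 + cos tc = of_real e" unfolding cos_tc e_def by simp
  have eA: "0.00184 \<le> e * Re (Anum tc) \<and> e * Re (Anum tc) \<le> 0.001847"
    by (rule interval_mult[OF e v(3)]) simp_all
  have eA': "0.002786 \<le> e * Im (Anum tc) \<and> e * Im (Anum tc) \<le> 0.002795"
    by (rule interval_mult[OF e v(4)]) simp_all
  have N: "NN tc = Complex (e * Re (Anum tc) - 1.14 * Re (Bden tc)) (e * Im (Anum tc) - 1.14 * Im (Bden tc))"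
    unfolding NN_def e' by (simp add: complex_eq_iff)
  show "cmod (NN tc) \<le> 0.0045"
    unfolding N
    by (rule cmod_le_of_Re_Im[of _ "0.00315" "0.00315"]) (use v(1,2) eA eA' in \<open>simp_all add: abs_le_iff power_divide\<close>)
  have h: "1.3157204 \<le> sinh (1.088::real) \<and> sinh (1.088::real) \<le> 1.3157215" using cosh_sinh_1088 by simp
  have hA: "6.227 \<le> sinh 1.088 * Re (Anum tc) \<and> sinh 1.088 * Re (Anum tc) \<le> 6.228"
    by (rule interval_mult[OF h v(3)]) simp_all
  have hA': "9.4256 \<le> sinh 1.088 * Im (Anum tc) \<and> sinh 1.088 * Im (Anum tc) \<le> 9.4259"
    by (rule interval_mult[OF h v(4)]) simp_all
  have ed: "0.0055 \<le> e * Re (dA tc) \<and> e * Re (dA tc) \<le> 0.0056"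
    by (rule interval_mult[OF e v(5)]) simp_all
  have ed': "0 \<le> e * Im (dA tc) \<and> e * Im (dA tc) \<le> 0.00001"
    by (rule interval_mult[OF e v(6)]) simp_all
  have dN: "dN tc = Complex (- (sinh 1.088 * Im (Anum tc)) + e * Re (dA tc) - 1.14 * Re (dB tc))
      (sinh 1.088 * Re (Anum tc) + e * Im (dA tc) - 1.14 * Im (dB tc))"
    unfolding dN_def e' sin_tc by (simp add: complex_eq_iff)
  show "cmod (dN tc) \<le> 0.955"
    unfolding dN
    by (rule cmod_le_of_Re_Im[of _ "0.603" "0.74"]) (use v(7,8) hA hA' ed ed' in \<open>simp_all add: abs_le_iff power_divide\<close>)
qed

lemma B_Taylor: "t \<in> boxS \<Longrightarrow> cmod (Bden t - Bden tc - dB tc * (t - tc)) \<le> 73/2 * (cmod (t - tc))\<^sup>2"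
  by (rule first_order_Taylor_bound[OF boxS_convex tc_boxS _ B_derivs ddB_bound])

lemma N_Taylor: "t \<in> boxS \<Longrightarrow> cmod (NN t - NN tc - dN tc * (t - tc)) \<le> 275/2 * (cmod (t - tc))\<^sup>2"
  by (rule first_order_Taylor_bound[OF boxS_convex tc_boxS _ N_derivs ddN_bound])

text \<open>The three sides of the left half of the box, which the detour follows; the fourth side
  lies on Re t = pi.\<close>

definition box_side :: "complex \<Rightarrow> bool" where
  "box_side t \<longleftrightarrow> t \<in> boxS \<and> Re t \<le> pi \<and> (Re t = pi - 0.005 \<or> Im t = 1.083 \<or> Im t = 1.093)"

text \<open>The distance r from \<open>tc\<close> lies between 0.005 and 0.0071 on these sides.
  There the linear term of \<open>Bden\<close> dominates its value at the centre and its remainder,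
  and the linear coefficient of \<open>NN\<close> is about ten times smaller.\<close>

lemma box_side_ratio:
  assumes "box_side t"
  shows "cmod (NN t) \<le> 0.33 * cmod (Bden t)" "Bden t \<noteq> 0"
proof -
  define r where "r = cmod (t - tc)"
  have tS: "t \<in> boxS" using assms by (simp add: box_side_def)
  have r1: "5/1000 \<le> r"
  proof -
    have "\<bar>Re (t - tc)\<bar> \<ge> 5/1000 \<or> \<bar>Im (t - tc)\<bar> \<ge> 5/1000" using assms by (auto simp: box_side_def)
    then show ?thesis using abs_Re_le_cmod[of "t - tc"] abs_Im_le_cmod[of "t - tc"] by (auto simp: r_def)
  qed
  have r2: "r \<le> 71/10000" using boxS_dist(2)[OF tS] by (simp add: r_def)
  \<comment> \<open>Replacing r^2 by the secant on this interval makes the final comparison linear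
    in r.\<close>
  have "0 \<le> (r - 5/1000) * (71/10000 - r)" using r1 r2 by simp
  then have rr: "r\<^sup>2 \<le> 121/10000 * r - 355/10000000" unfolding power2_eq_square by argo
  have "cmod (dB tc * (t - tc)) = cmod (dB tc) * r" by (simp add: norm_mult r_def)
  then have dB: "9.855 * r \<le> cmod (dB tc * (t - tc))" using center_norms(2) r1 by (simp add: mult_right_mono)
  have "cmod (dB tc * (t - tc)) \<le> cmod (Bden t) + cmod (Bden tc) + cmod (Bden t - Bden tc - dB tc * (t - tc))"
    using norm_triangle_ineq4[of "Bden t - Bden tc" "Bden t - Bden tc - dB tc * (t - tc)"]
      norm_triangle_ineq4[of "Bden t" "Bden tc"] by simp
  then have B: "9.855 * r - 0.0054 - 73/2 * r\<^sup>2 \<le> cmod (Bden t)"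
    using dB center_norms(1) B_Taylor[OF tS] by (simp add: r_def)
  have "cmod (dN tc * (t - tc)) = cmod (dN tc) * r" by (simp add: norm_mult r_def)
  then have dN: "cmod (dN tc * (t - tc)) \<le> 0.955 * r" using center_norms(4) r1 by (simp add: mult_right_mono)
  have "cmod (NN t) \<le> cmod (NN tc) + cmod (dN tc * (t - tc)) + cmod (NN t - NN tc - dN tc * (t - tc))"
    using norm_triangle_ineq[of "NN tc + dN tc * (t - tc)" "NN t - NN tc - dN tc * (t - tc)"]
      norm_triangle_ineq[of "NN tc" "dN tc * (t - tc)"] by simp
  then have N: "cmod (NN t) \<le> 0.0045 + 0.955 * r + 275/2 * r\<^sup>2"
    using dN center_norms(3) N_Taylor[OF tS] by (simp add: r_def)
  have "n \<le> 0.33 * b \<and> 0 < b" if "9.855 * r - 0.0054 - 73/2 * q \<le> b" "n \<le> 0.0045 + 0.955 * r + 275/2 * q"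
    "q \<le> 121/10000 * r - 355/10000000" for n b q
    using that r1 r2 by simp
  from this[OF B N rr] show "cmod (NN t) \<le> 0.33 * cmod (Bden t)" "Bden t \<noteq> 0" by auto
qed

text \<open>The square of 1 - cos t is nearly a positive real number on the box, so equality would
  force both Re B and Re B - 2 Im B to be at most 0. But B is close to its linear term
  \<open>dB tc * (t - tc)\<close>, for which Re B is clearly positive on the lower side and Re B - 2
  Im B on the left and upper sides.\<close>

lemma box_side_not_nonpos:
  assumes "box_side t" "0 \<le> l"
  shows "Bden t \<noteq> - of_real l * (1 - cos t)\<^sup>2"
proof
  assume eq: "Bden t = - of_real l * (1 - cos t)\<^sup>2"
  have tS: "t \<in> boxS" using assms by (simp add: box_side_def)
  define y where "y = pi - Re t"
  define z where "z = Im t - 1.088"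
  define E where "E = Bden t - dB tc * (t - tc)"
  have "cmod E \<le> cmod (Bden tc) + cmod (Bden t - Bden tc - dB tc * (t - tc))"
    using norm_triangle_ineq[of "Bden tc" "Bden t - Bden tc - dB tc * (t - tc)"] by (simp add: E_def)
  also have "\<dots> \<le> 0.0054 + 73/2 * (5/100000)"
    using center_norms(1) B_Taylor[OF tS] boxS_dist(1)[OF tS] by (intro add_mono) auto
  finally have E: "cmod E \<le> 0.00723" by simp
  have ER: "\<bar>Re E\<bar> \<le> 0.00723" "\<bar>Im E\<bar> \<le> 0.00723"
    using E abs_Re_le_cmod[of E] abs_Im_le_cmod[of E] by linarith+
  have y: "0 \<le> y" "y \<le> 0.005" and z: "- 0.005 \<le> z" "z \<le> 0.005"
    using assms by (auto simp: y_def z_def box_side_def boxS_def)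
  have side: "y = 0.005 \<or> z = - 0.005 \<or> z = 0.005"
    using assms by (auto simp: y_def z_def box_side_def)
  have B: "Bden t = E + dB tc * Complex (- y) z"
    by (simp add: E_def y_def z_def complex_eq_iff)
  define P where "P = - Re (dB tc)"
  define Q where "Q = Im (dB tc)"
  have P: "7.7353 \<le> P" "P \<le> 7.7354" and Q: "6.1111 \<le> Q" "Q \<le> 6.1112"
    using center_values(7,8) by (auto simp: P_def Q_def)
  have ReB: "Re (Bden t) = Re E + P * y - Q * z" and ImB: "Im (Bden t) = Im E - P * z - Q * y"
    unfolding B by (simp_all add: P_def Q_def)
  define q where "q = 1 - cos t"
  have "Re q - (1 + cosh 1.088) = Re (cos tc - cos t)" "Im q = Im (cos tc - cos t)"
    unfolding q_def cos_tc by simp_all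
  moreover have "cmod (cos tc - cos t) \<le> 0.012" using boxS_cos_near[OF tS] by (simp add: norm_minus_commute)
  ultimately have q: "\<bar>Re q - (1 + cosh 1.088)\<bar> \<le> 0.012" "\<bar>Im q\<bar> \<le> 0.012"
    using abs_Re_le_cmod[of "cos tc - cos t"] abs_Im_le_cmod[of "cos tc - cos t"] by linarith+
  have "Re q - (1 + cosh 1.088) \<le> 0.012" "- 0.012 \<le> Re q - (1 + cosh 1.088)" using q(1) by linarith+
  then have Rq: "2.6 \<le> Re q" "Re q \<le> 2.7" using cosh_sinh_1088 by auto
  have "2.6 * 2.6 \<le> Re q * Re q" using Rq by (intro mult_mono) auto
  moreover have "\<bar>Im q\<bar> * \<bar>Im q\<bar> \<le> 0.012 * 0.012" using q(2) by (intro mult_mono) auto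
  ultimately have Rq2: "6.7 \<le> Re (q\<^sup>2)" by (simp add: power2_eq_square)
  have "\<bar>Re q\<bar> * \<bar>Im q\<bar> \<le> 2.7 * 0.012" using q(2) Rq by (intro mult_mono) auto
  moreover have "\<bar>Im (q\<^sup>2)\<bar> = 2 * (\<bar>Re q\<bar> * \<bar>Im q\<bar>)" by (simp add: power2_eq_square abs_mult)
  ultimately have "\<bar>Im (q\<^sup>2)\<bar> \<le> 2 * (2.7 * 0.012)" by linarith
  then have Iq2: "\<bar>Im (q\<^sup>2)\<bar> \<le> 0.07" by (rule order_trans) simp
  have ReB': "Re (Bden t) = - (l * Re (q\<^sup>2))" and ImB': "Im (Bden t) = - (l * Im (q\<^sup>2))"
    unfolding eq q_def by simp_all
  have l1: "0 \<le> l * Re (q\<^sup>2)" "0 \<le> l * (Re (q\<^sup>2) - 2 * Im (q\<^sup>2))"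
    using assms(2) Rq2 Iq2 by (auto intro!: mult_nonneg_nonneg simp: abs_le_iff)
  have l2: "Re (Bden t) \<le> 0" "Re (Bden t) - 2 * Im (Bden t) \<le> 0"
    using l1 unfolding ReB' ImB' by (simp_all add: algebra_simps)
  have Py: "0 \<le> P * y" using P y by simp
  have Qy: "0 \<le> Q * y" using Q y by simp
  show False
  proof (cases "z = - 0.005")
    case True
    have "Re (Bden t) = Re E + P * y + Q * 0.005" unfolding ReB True by simp
    moreover have "0.03 \<le> Q * 0.005" using Q by simp
    ultimately show False using l2(1) ER Py by (simp add: abs_le_iff)
  next
    case False
    have "Re (Bden t) - 2 * Im (Bden t) = Re E - 2 * Im E + (P + 2 * Q) * y + (2 * P - Q) * z"
      unfolding ReB ImB by (simp add: algebra_simps)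
    moreover have "0.046 \<le> (P + 2 * Q) * y + (2 * P - Q) * z"
      using side
    proof (elim disjE)
      assume y': "y = 0.005"
      have "(2 * P - Q) * (- 0.005) \<le> (2 * P - Q) * z" using P Q z by (intro mult_left_mono) auto
      moreover have "0.046 \<le> (P + 2 * Q) * 0.005 + (2 * P - Q) * (- 0.005)" using P Q by (simp add: field_simps)
      ultimately show ?thesis unfolding y' by linarith
    next
      assume z': "z = 0.005"
      have "0 \<le> (P + 2 * Q) * y" using P Q y by simp
      moreover have "0.046 \<le> (2 * P - Q) * 0.005" using P Q by simp
      ultimately show ?thesis unfolding z' by linarith
    qed (use False in simp)
    ultimately show False using l2(2) ER by (simp add: abs_le_iff)
  qed
qed

section \<open>The denominator has no other zeros\<close>

text \<open>The divisor tames the growth of \<open>Bden\<close>: it is positive on Re t = pi, and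
  high up in the strip the quotient is about - i t - pi/2, with large positive real part. In the
  strip considered the quotient has the same zeros as \<open>Bred\<close>.\<close>

definition Uf :: "complex \<Rightarrow> complex" where "Uf t = Bred t / Cred t"

lemma Uf_eq: "t \<noteq> 0 \<Longrightarrow> Uf t = Bden t / (1 - cos t)\<^sup>2"
  by (simp add: Uf_def Bden_eq Cred_eq)

lemma Uf_minus: "t \<noteq> 0 \<Longrightarrow> Uf (- t) = Uf t"
  by (simp add: Uf_eq Bden_even)

lemma Uf_cnj: "t \<noteq> 0 \<Longrightarrow> Uf (cnj t) = cnj (Uf t)"
  by (simp add: Uf_eq Bden_cnj cnj_cos)

text \<open>The reflections t -> -t and t -> \<open>cnj t\<close> preserve the condition, so
  boundary points need only be examined in the first quadrant.\<close>

lemma Uf_first_quadrant: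
  assumes "Uf t \<in> \<real>\<^sub>\<le>\<^sub>0"
  shows "Uf (Complex \<bar>Re t\<bar> \<bar>Im t\<bar>) \<in> \<real>\<^sub>\<le>\<^sub>0"
proof (cases "t = 0")
  case True
  then have "Complex \<bar>Re t\<bar> \<bar>Im t\<bar> = t" by (simp add: complex_eq_iff)
  then show ?thesis using assms by simp
next
  case False
  have "Complex \<bar>Re t\<bar> \<bar>Im t\<bar> \<in> {t, - t, cnj t, - cnj t}"
    by (auto simp: complex_eq_iff abs_if)
  then show ?thesis
    using assms Uf_minus[OF False] Uf_cnj[OF False] Uf_minus[of "cnj t"] False
    by (auto simp: complex_nonpos_Reals_iff)
qed

lemma Uf_holomorphic: "Uf holomorphic_on {t. \<bar>Re t\<bar> < 2 * pi}"
  unfolding Uf_def[abs_def]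
  by (intro holomorphic_on_divide holomorphic_on_subset[OF red_holomorphic(2)] holomorphic_on_subset[OF red_holomorphic(3)])
     (auto simp: Cred_nonzero)

lemma eventually_Re_Uf_pos: "\<exists>R0>0. \<forall>R\<ge>R0. \<forall>t. \<bar>Re t\<bar> \<le> pi \<longrightarrow> Im t = R \<longrightarrow> 0 < Re (Uf t)"
proof -
  have "eventually (\<lambda>R::real. 0 < R - pi/2 - ((R + pi)\<^sup>2 + (R + pi) * (3 * cosh R + 1)) / (sinh R - 1)\<^sup>2) at_top"
    unfolding cosh_field_def sinh_field_def by real_asymp
  then have "eventually (\<lambda>R::real. 0 < R - pi/2 - ((R + pi)\<^sup>2 + (R + pi) * (3 * cosh R + 1)) / (sinh R - 1)\<^sup>2 \<and> 2 \<le> R) at_top"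
    using eventually_ge_at_top[of 2] by (rule eventually_conj)
  then obtain R0 where R0: "\<And>R. R \<ge> R0 \<Longrightarrow>
      0 < R - pi/2 - ((R + pi)\<^sup>2 + (R + pi) * (3 * cosh R + 1)) / (sinh R - 1)\<^sup>2 \<and> 2 \<le> R"
    unfolding eventually_at_top_linorder by blast
  have "0 < Re (Uf t)" if R: "R \<ge> R0" and t: "\<bar>Re t\<bar> \<le> pi" "Im t = R" for R t
  proof -
    have R2: "2 \<le> R" using R0[OF R] by simp
    have sR: "2 \<le> sinh R" using sinh_ge_self[of R] R2 by simp
    have nz: "t \<noteq> 0" using t R2 by auto
    define q where "q = 1 - cos t"
    have "sinh R \<le> cmod (cos t)" using cmod_cos_bounds(1)[of t] t sR by simp
    then have qR: "sinh R - 1 \<le> cmod q" using norm_triangle_ineq2[of "cos t" 1] by (simp add: q_def norm_minus_commute)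
    have qnz: "q \<noteq> 0" using qR sR by auto
    have cC: "cmod (cos t) \<le> cosh R" using cmod_cos_bounds(2)[of t] t by simp
    have tT: "cmod t \<le> R + pi" using cmod_le[of t] t R2 by simp
    have eR: "cmod (exp (\<i> * t)) \<le> 1" using t R2 by simp
    \<comment> \<open>Since exp (i t) is bounded in the upper half-plane, this form isolates the
      leading term - i t - pi/2 of \<open>Uf\<close>, whose real part is R - pi/2; the rest is
      \<open>E\<close> divided by the square of 1 - cos t.\<close>
    have sn: "sin t = \<i> * cos t - \<i> * exp (\<i> * t)" by (simp add: exp_Euler algebra_simps)
    have s: "t * sin t * cos t = \<i> * t * (cos t)\<^sup>2 - \<i> * t * exp (\<i> * t) * cos t"
      unfolding sn by (simp add: algebra_simps power2_eq_square)
    have c2: "(cos t)\<^sup>2 = q\<^sup>2 + 2 * cos t - 1" by (simp add: q_def power2_eq_square algebra_simps)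
    define E where "E = t\<^sup>2 - \<i> * t * (2 * cos t - 1) + \<i> * t * exp (\<i> * t) * cos t"
    have "Bden t = E + q\<^sup>2 * (- \<i> * t - of_real (pi/2))"
      unfolding Bden_def s c2 E_def q_def[symmetric] by (simp add: algebra_simps)
    then have "Uf t = E / q\<^sup>2 + (- \<i> * t - of_real (pi/2))"
      using qnz by (simp add: Uf_eq[OF nz] q_def[symmetric] add_divide_distrib)
    then have ReU: "Re (Uf t) = Re (E / q\<^sup>2) + R - pi/2" using t by simp
    have "cmod E \<le> cmod (t\<^sup>2) + cmod (\<i> * t * (2 * cos t - 1)) + cmod (\<i> * t * exp (\<i> * t) * cos t)"
      unfolding E_def by (intro order_trans[OF norm_triangle_ineq] add_mono norm_triangle_ineq4 order_refl)
    also have "\<dots> \<le> (R + pi)\<^sup>2 + (R + pi) * (2 * cosh R + 1) + (R + pi) * 1 * cosh R"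
    proof (intro add_mono)
      show "cmod (t\<^sup>2) \<le> (R + pi)\<^sup>2" unfolding norm_power using tT by (intro power_mono) auto
      have "cmod (2 * cos t - 1) \<le> 2 * cosh R + 1"
        using norm_triangle_ineq4[of "2 * cos t" 1] cC by (simp add: norm_mult)
      then show "cmod (\<i> * t * (2 * cos t - 1)) \<le> (R + pi) * (2 * cosh R + 1)"
        unfolding norm_mult using tT R2 by (intro mult_mono) auto
      show "cmod (\<i> * t * exp (\<i> * t) * cos t) \<le> (R + pi) * 1 * cosh R"
        unfolding norm_mult using tT eR cC R2 by (intro mult_mono) (auto simp: norm_mult)
    qed
    also have "\<dots> = (R + pi)\<^sup>2 + (R + pi) * (3 * cosh R + 1)" by (simp add: algebra_simps)
    finally have "cmod (E / q\<^sup>2) \<le> ((R + pi)\<^sup>2 + (R + pi) * (3 * cosh R + 1)) / (sinh R - 1)\<^sup>2"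
      unfolding norm_divide norm_power using qR sR R2
      by (intro frac_le power_mono) auto
    then have "- (((R + pi)\<^sup>2 + (R + pi) * (3 * cosh R + 1)) / (sinh R - 1)\<^sup>2) \<le> Re (E / q\<^sup>2)"
      using abs_Re_le_cmod[of "E / q\<^sup>2"] by linarith
    then show ?thesis unfolding ReU using R0[OF R] by linarith
  qed
  then show ?thesis by (intro exI[of _ "max R0 1"]) auto
qed

text \<open>The closed strip without four mirror images of the half-box. The three sides forming
  \<open>box_side\<close> are not removed, so the detour stays inside this region.\<close>

definition good :: "complex \<Rightarrow> bool" where
  "good t \<longleftrightarrow> \<bar>Re t\<bar> \<le> pi \<and> \<not> (pi - 0.005 < \<bar>Re t\<bar> \<and> 1.083 < \<bar>Im t\<bar> \<and> \<bar>Im t\<bar> < 1.093)"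

text \<open>A nonpositive value forces \<open>vB s = 0\<close>, hence s = 0 by the sign of the
  imaginary part, but \<open>uB 0\<close> is pi (pi - 2) > 0.\<close>

lemma Uf_right_line:
  assumes "0 \<le> s" "s \<le> 1.083 \<or> 1.093 \<le> s"
  shows "Uf (Complex pi s) \<notin> \<real>\<^sub>\<le>\<^sub>0"
proof
  assume np: "Uf (Complex pi s) \<in> \<real>\<^sub>\<le>\<^sub>0"
  have nz: "Complex pi s \<noteq> 0" by (simp add: complex_eq_iff)
  have c: "1 - cos (Complex pi s) = of_real (1 + cosh s)"
    unfolding cos_Complex by (simp add: complex_eq_iff)
  have U: "Uf (Complex pi s) = Complex (uB s) (vB s) / of_real ((1 + cosh s)\<^sup>2)"
    unfolding Uf_eq[OF nz] Bden_right_line' c by simp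
  have cp: "0 < (1 + cosh s)\<^sup>2" by (intro zero_less_power add_pos_pos) auto
  have "vB s / (1 + cosh s)\<^sup>2 = 0" "uB s / (1 + cosh s)\<^sup>2 \<le> 0"
    using np unfolding U complex_nonpos_Reals_iff Re_divide_of_real Im_divide_of_real by auto
  then have v: "vB s = 0" and u: "uB s \<le> 0" using cp by (auto simp: divide_le_0_iff)
  have v': "2 * s = sinh s * cosh s" using v by (simp add: vB_def)
  have "s = 0"
    using assms Im_B_pos[of s] Im_B_neg[of s] v' by (cases "s = 0") auto
  then have "pi * (pi - 2) \<le> 0" using u by (simp add: uB_def power2_eq_square algebra_simps)
  then show False using pi_gt3 by (simp add: mult_le_0_iff)
qed

lemma Uf_not_nonpos:
  assumes "good t0"
  shows "Uf t0 \<notin> \<real>\<^sub>\<le>\<^sub>0"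
proof
  assume t0: "Uf t0 \<in> \<real>\<^sub>\<le>\<^sub>0"
  obtain R0 where R0: "R0 > 0" "\<And>R t. \<lbrakk>R \<ge> R0; \<bar>Re t\<bar> \<le> pi; Im t = R\<rbrakk> \<Longrightarrow> 0 < Re (Uf t)"
    using eventually_Re_Uf_pos by blast
  \<comment> \<open>At this height the truncated region contains \<open>t0\<close>, and after
    reflection its horizontal sides are covered by the estimate for large imaginary part.\<close>
  define R where "R = R0 + \<bar>Im t0\<bar>"
  define S where "S = {t::complex. \<bar>Re t\<bar> < 2 * pi}"
  define K where "K = {t. good t \<and> \<bar>Im t\<bar> \<le> R}"
  define Z where "Z = {t \<in> K. Uf t \<in> \<real>\<^sub>\<le>\<^sub>0}"
  have KS: "K \<subseteq> S"
    using pi_gt_zero by (auto simp: K_def S_def good_def simp del: pi_gt_zero)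
  have oS: "open S" unfolding S_def by (intro open_Collect_less continuous_intros)
  have cS: "convex S"
  proof -
    have "S = {t. Re t < 2 * pi} \<inter> {t. Re t > - (2 * pi)}" by (auto simp: S_def)
    then show ?thesis by (simp add: convex_Int convex_halfspace_Re_lt convex_halfspace_Re_gt)
  qed
  have holU: "Uf holomorphic_on S" unfolding S_def by (rule Uf_holomorphic)
  have contU: "continuous_on K Uf"
    using holomorphic_on_imp_continuous_on[OF holU] KS by (rule continuous_on_subset)
  have "compact K"
  proof (rule compact_eq_bounded_closed[THEN iffD2], rule conjI)
    have "cmod t \<le> pi + R" if "t \<in> K" for t
      using that cmod_le[of t] by (auto simp: K_def good_def)
    then show "bounded K" unfolding bounded_iff by blast
    have "K = {t. \<bar>Re t\<bar> \<le> pi} \<inter> {t. \<bar>Im t\<bar> \<le> R} \<inter>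
        ({t. \<bar>Re t\<bar> \<le> pi - 0.005} \<union> {t. \<bar>Im t\<bar> \<le> 1.083} \<union> {t. 1.093 \<le> \<bar>Im t\<bar>})"
      by (auto simp: K_def good_def not_less)
    moreover have "closed \<dots>"
      by (intro closed_Int closed_Un closed_Collect_le continuous_intros)
    ultimately show "closed K" by simp
  qed
  moreover have "closedin (top_of_set K) (K \<inter> Uf -` \<real>\<^sub>\<le>\<^sub>0)"
    using contU by (rule continuous_closedin_preimage) (rule closed_nonpos_Reals_complex)
  moreover have "K \<inter> Uf -` \<real>\<^sub>\<le>\<^sub>0 = Z" by (auto simp: Z_def)
  ultimately have "compact Z" using closedin_compact by metis
  moreover have "t0 \<in> Z" using t0 assms R0(1) by (auto simp: Z_def K_def R_def)
  moreover have "continuous_on Z (\<lambda>t. Re (Uf t))"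
    by (intro continuous_intros continuous_on_subset[OF contU]) (auto simp: Z_def)
  ultimately obtain z where z: "z \<in> Z" "\<And>t. t \<in> Z \<Longrightarrow> Re (Uf z) \<le> Re (Uf t)"
    using continuous_attains_inf[of Z "\<lambda>t. Re (Uf t)"] by blast
  \<comment> \<open>The interior of the truncated region. A minimizer outside it would, after
    reflection to the first quadrant, lie on the right-hand line, on the top side or on a side of
    the box, all of which are excluded.\<close>
  define O' where "O' = {t. \<bar>Re t\<bar> < pi} \<inter> {t. \<bar>Im t\<bar> < R} \<inter>
      ({t. \<bar>Re t\<bar> < pi - 0.005} \<union> {t. \<bar>Im t\<bar> < 1.083} \<union> {t. 1.093 < \<bar>Im t\<bar>})"
  have oO: "open O'" unfolding O'_def
    by (intro open_Int open_Un open_Collect_less continuous_intros)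
  have OK: "O' \<subseteq> K" by (auto simp: O'_def K_def good_def)
  have "z \<in> O'"
  proof (rule ccontr)
    assume nz: "z \<notin> O'"
    define z' where "z' = Complex \<bar>Re z\<bar> \<bar>Im z\<bar>"
    have U': "Uf z' \<in> \<real>\<^sub>\<le>\<^sub>0" unfolding z'_def using z(1) by (intro Uf_first_quadrant) (simp add: Z_def)
    have gz: "good z" "\<bar>Im z\<bar> \<le> R" using z(1) by (auto simp: Z_def K_def)
    consider "\<bar>Re z\<bar> = pi" | "\<bar>Im z\<bar> = R" | "\<bar>Re z\<bar> < pi" "\<bar>Im z\<bar> < R" using gz by (force simp: good_def)
    then show False
    proof cases
      case 1
      then have "\<bar>Im z\<bar> \<le> 1.083 \<or> 1.093 \<le> \<bar>Im z\<bar>" using gz(1) by (auto simp: good_def)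
      then show False using Uf_right_line[of "\<bar>Im z\<bar>"] U' 1 by (auto simp: z'_def)
    next
      case 2
      then have "0 < Re (Uf z')" using gz(1) by (intro R0(2)[of R]) (auto simp: z'_def R_def good_def)
      then show False using U' by (simp add: complex_nonpos_Reals_iff)
    next
      case 3
      have side: "box_side z'"
        using nz 3 gz(1) pi_gt3 by (auto simp: box_side_def boxS_def z'_def O'_def good_def)
      have "z' \<noteq> 0" using nz 3 pi_gt3 by (auto simp: O'_def z'_def complex_eq_iff)
      moreover have "Cred z' \<noteq> 0" using 3 by (intro Cred_nonzero) (simp add: z'_def)
      ultimately have "Bden z' = Uf z' * (1 - cos z')\<^sup>2"
        by (simp add: Uf_def Bden_eq Cred_eq)
      moreover have "Uf z' = - of_real (- Re (Uf z'))" using U' by (simp add: complex_nonpos_Reals_iff complex_eq_iff)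
      ultimately have "Bden z' = - of_real (- Re (Uf z')) * (1 - cos z')\<^sup>2" by metis
      then show False using box_side_not_nonpos[OF side, of "- Re (Uf z')"] U' by (simp add: complex_nonpos_Reals_iff)
    qed
  qed
  moreover have "open (Uf ` O')"
  proof (rule open_mapping_thm[OF holU oS convex_connected[OF cS] oO])
    show "O' \<subseteq> S" using OK KS by blast
    \<comment> \<open>On Re t = pi the imaginary part is a positive multiple of \<open>vB s\<close>,
      which is 0 at s = 0 but not at s = 1.\<close>
    show "\<not> Uf constant_on S"
    proof
      assume "Uf constant_on S"
      moreover have "Complex pi 1 \<in> S" "Complex pi 0 \<in> S" by (simp_all add: S_def)
      ultimately have eq: "Uf (Complex pi 1) = Uf (Complex pi 0)" unfolding constant_on_def by metis
      have c: "1 - cos (Complex pi s) = of_real (1 + cosh s)" for s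
        unfolding cos_Complex by (simp add: complex_eq_iff)
      have U: "Uf (Complex pi s) = Complex (uB s) (vB s) / of_real ((1 + cosh s)\<^sup>2)" for s
        by (subst Uf_eq) (simp_all add: c Bden_right_line' complex_eq_iff)
      have "vB 1 / (1 + cosh 1)\<^sup>2 = vB 0 / (1 + cosh 0)\<^sup>2"
        using arg_cong[OF eq, of Im] unfolding U Im_divide_of_real by simp
      moreover have "0 < 1 + cosh (1::real)" by (simp add: add_pos_pos)
      ultimately have "vB 1 = 0" by (simp add: vB_def)
      then show False using Im_B_pos[of 1] by (simp add: vB_def)
    qed
  qed
  ultimately obtain e where e: "e > 0" "ball (Uf z) e \<subseteq> Uf ` O'"
    by (meson imageI open_contains_ball)
  \<comment> \<open>Moving left from a nonpositive real value stays among such values, so some point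
    of \<open>Z\<close> has smaller real part than the minimum.\<close>
  have "Uf z - of_real (e/2) \<in> ball (Uf z) e" using e(1) by (simp add: dist_norm norm_minus_commute)
  then obtain t where t: "t \<in> O'" "Uf t = Uf z - of_real (e/2)" using e(2) by (metis imageE subsetD)
  have "Uf z \<in> \<real>\<^sub>\<le>\<^sub>0" using z(1) by (simp add: Z_def)
  then have "t \<in> Z" using t OK e(1) by (auto simp: Z_def complex_nonpos_Reals_iff)
  from z(2)[OF this] show False using t(2) e(1) by simp
qed

lemma Bred_nonzero: "good t \<Longrightarrow> Bred t \<noteq> 0"
  using Uf_not_nonpos[of t] by (auto simp: Uf_def)

section \<open>The function g0\<close>

definition Fg :: "complex \<Rightarrow> complex" where "Fg t = Ared t / Bred t"
definition hg :: "complex \<Rightarrow> complex" where "hg z = Fg (Arccos (- z))"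

lemma Fg_eq: "t \<noteq> 0 \<Longrightarrow> Fg t = Anum t / Bden t"
  by (simp add: Fg_def Anum_eq Bden_eq)

lemma Fg_holomorphic: "Fg holomorphic_on {t. Bred t \<noteq> 0}"
  unfolding Fg_def[abs_def]
  by (intro holomorphic_on_divide holomorphic_on_subset[OF red_holomorphic(1)] holomorphic_on_subset[OF red_holomorphic(2)]) auto

lemma open_Bred_nonzero: "open {t. Bred t \<noteq> 0}"
  using holomorphic_on_imp_continuous_on[OF red_holomorphic(2)]
  by (intro open_Collect_neq) auto

text \<open>From sinh |Im t| <= |cos t| < 1 it follows that |Im t| < 1, which is below the
  half-boxes.\<close>

lemma good_of_unit_disc:
  assumes "0 < Re t" "Re t < pi" "cmod (cos t) < 1"
  shows "good t"
proof -
  have "\<bar>sinh (Im t)\<bar> < 1" using cmod_cos_bounds(1)[of t] assms(3) by linarith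
  moreover have "\<bar>Im t\<bar> \<le> \<bar>sinh (Im t)\<bar>" using sinh_ge_self[of "\<bar>Im t\<bar>"] by simp
  ultimately show ?thesis using assms by (simp add: good_def)
qed

lemma hg_holomorphic: "hg holomorphic_on ball 0 1"
proof -
  have "Fg \<circ> (\<lambda>z. Arccos (- z)) holomorphic_on ball 0 1"
    by (rule holomorphic_on_compose_gen[OF Arccos_minus_holomorphic Fg_holomorphic])
       (use cmod_cos_Arccos_strip good_of_unit_disc Bred_nonzero in blast)
  then show ?thesis by (simp add: o_def hg_def[abs_def])
qed

lemma hg_minus_cos: "\<lbrakk>0 < Re t; Re t < pi\<rbrakk> \<Longrightarrow> hg (- cos t) = Fg t"
  by (simp add: hg_def Arccos_cos)

lemma hg_of_real:
  assumes "-1 < x" "x < 1"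
  shows "hg (of_real x) = of_real (g0 x)"
proof -
  have "of_real (tau x) \<noteq> (0::complex)" using tau_pos[of x] assms by simp
  then have "hg (of_real x) = Anum (of_real (tau x)) / Bden (of_real (tau x))"
    unfolding hg_def Arccos_minus_of_real[OF assms] by (rule Fg_eq)
  also have "\<dots> = of_real ((tau x ^ 2 * x + tau x * sqrt (1 - x\<^sup>2) - pi/2 * (1 + x)\<^sup>2) /
      ((tau x)\<^sup>2 + tau x * sqrt (1 - x\<^sup>2) * x - pi/2 * (1 + x)\<^sup>2))"
    unfolding Anum_of_real Bden_of_real using assms by (simp add: cos_tau sin_tau)
  also have "(tau x ^ 2 * x + tau x * sqrt (1 - x\<^sup>2) - pi/2 * (1 + x)\<^sup>2) /
      ((tau x)\<^sup>2 + tau x * sqrt (1 - x\<^sup>2) * x - pi/2 * (1 + x)\<^sup>2) = g0 x"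
    unfolding g0_def tau_def[symmetric] by (simp add: mult_ac)
  finally show ?thesis .
qed

text \<open>For x < 1 the denominator is \<open>Bden\<close> at the real point \<open>tau x\<close>
  of the good region; at x = 1 it equals pi (pi - 2).\<close>

lemma g0_continuous: "continuous_on {0..1} g0"
proof -
  have "(tau x)\<^sup>2 + x * sqrt (1 - x\<^sup>2) * tau x - pi/2 * (1 + x)\<^sup>2 \<noteq> 0" if x: "x \<in> {0..1}" for x
  proof (cases "x = 1")
    case True
    have "pi * (pi - 2) \<noteq> 0" using pi_gt3 by simp
    then show ?thesis by (simp add: True tau_def power2_eq_square algebra_simps)
  next
    case False
    then have x1: "-1 < x" "x < 1" using x by auto
    have "tau x < pi" using arcsin_less_mono[of x 1] x1 by (simp add: tau_def abs_le_iff)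
    then have "good (of_real (tau x))" using tau_pos[of x] x1 by (simp add: good_def)
    then have "Bden (of_real (tau x)) \<noteq> 0" using Bred_nonzero tau_pos[of x] x1 by (simp add: Bden_eq)
    then have "of_real ((tau x)\<^sup>2 - tau x * sin (tau x) * cos (tau x) - pi/2 * (1 - cos (tau x))\<^sup>2) \<noteq> (0::complex)"
      unfolding Bden_of_real .
    then have "(tau x)\<^sup>2 - tau x * sin (tau x) * cos (tau x) - pi/2 * (1 - cos (tau x))\<^sup>2 \<noteq> 0"
      by (metis of_real_0)
    then show ?thesis using x1 by (simp add: cos_tau sin_tau mult_ac)
  qed
  then show ?thesis unfolding g0_def[abs_def] tau_def by (intro continuous_intros) auto
qed

text \<open>Leibniz's rule for a linear factor. The order is \<open>Suc n\<close> since the constant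
  \<open>k\<close> disappears only on differentiating.\<close>

lemma higher_deriv_linear_times:
  assumes "f holomorphic_on S" "open S" "z \<in> S"
  shows "(deriv ^^ Suc n) (\<lambda>z. (a - z) * f z - k) z =
     (a - z) * (deriv ^^ Suc n) f z - of_nat (Suc n) * (deriv ^^ n) f z"
  using assms(3)
proof (induction n arbitrary: z)
  case 0
  have "(f has_field_derivative deriv f z) (at z)" using holomorphic_derivI[OF assms(1,2) 0] .
  then have "((\<lambda>z. (a - z) * f z - k) has_field_derivative ((a - z) * deriv f z - f z)) (at z)"
    by (auto intro!: derivative_eq_intros)
  then show ?case by (simp add: DERIV_imp_deriv)
next
  case (Suc n)
  have hol: "(deriv ^^ m) f holomorphic_on S" for m using assms by (simp add: holomorphic_higher_deriv)
  have der: "((deriv ^^ m) f has_field_derivative (deriv ^^ Suc m) f z) (at z)" for m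
    using holomorphic_derivI[OF hol assms(2) Suc.prems] by simp
  have "((\<lambda>z. (a - z) * (deriv ^^ Suc n) f z - of_nat (Suc n) * (deriv ^^ n) f z) has_field_derivative
      (a - z) * (deriv ^^ Suc (Suc n)) f z - (deriv ^^ Suc n) f z - of_nat (Suc n) * (deriv ^^ Suc n) f z) (at z)"
    using der[of "Suc n"] der[of n] by (auto intro!: derivative_eq_intros simp del: of_nat_Suc funpow.simps)
  then have "((deriv ^^ Suc n) (\<lambda>z. (a - z) * f z - k) has_field_derivative
      (a - z) * (deriv ^^ Suc (Suc n)) f z - (deriv ^^ Suc n) f z - of_nat (Suc n) * (deriv ^^ Suc n) f z) (at z)"
    by (rule has_field_derivative_transform_within_open[OF _ assms(2) Suc.prems]) (rule Suc.IH[symmetric])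
  then have "deriv ((deriv ^^ Suc n) (\<lambda>z. (a - z) * f z - k)) z =
      (a - z) * (deriv ^^ Suc (Suc n)) f z - (deriv ^^ Suc n) f z - of_nat (Suc n) * (deriv ^^ Suc n) f z"
    by (rule DERIV_imp_deriv)
  moreover have "(deriv ^^ Suc (Suc n)) (\<lambda>z. (a - z) * f z - k) z = deriv ((deriv ^^ Suc n) (\<lambda>z. (a - z) * f z - k)) z"
    by simp
  moreover have "of_nat (Suc (Suc n)) * (deriv ^^ Suc n) f z = (deriv ^^ Suc n) f z + of_nat (Suc n) * (deriv ^^ Suc n) f z"
    by (simp add: algebra_simps del: funpow.simps)
  ultimately show ?case by (simp only: diff_diff_add)
qed

section \<open>The modified integrand on the box sides and on the right-hand line\<close>

definition Fd :: "complex \<Rightarrow> complex" where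
  "Fd t = (of_real 1.653 + cos t) * Fg t - of_real 1.14"

lemma Fd_holomorphic: "Fd holomorphic_on {t. Bred t \<noteq> 0}"
  unfolding Fd_def[abs_def] by (intro holomorphic_intros Fg_holomorphic)

lemma Fd_even: "Fd (- t) = Fd t"
  by (simp add: Fd_def Fg_def Ared_even Bred_even)

lemma Fd_cnj: "t \<noteq> 0 \<Longrightarrow> Fd (cnj t) = cnj (Fd t)"
  by (simp add: Fd_def Fg_eq Anum_cnj Bden_cnj cnj_cos)

lemma Fd_box_side: "box_side t \<Longrightarrow> cmod (Fd t) \<le> 0.33"
proof -
  assume t: "box_side t"
  have "t \<noteq> 0" using t by (auto simp: box_side_def boxS_def)
  then have "Fd t = NN t / Bden t"
    using box_side_ratio(2)[OF t] by (simp add: Fd_def NN_def Fg_eq field_simps)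
  then show ?thesis
    using box_side_ratio[OF t] by (simp add: norm_divide divide_le_eq)
qed

lemma sin_near_pi: assumes "pi - 0.005 \<le> x" "x \<le> pi" shows "(sin x)\<^sup>2 \<le> 0.005\<^sup>2"
proof -
  have "\<bar>sin x\<bar> = \<bar>sin (pi - x)\<bar>" by simp
  also have "\<dots> \<le> \<bar>pi - x\<bar>" by (rule abs_sin_x_le_abs_x)
  finally have "\<bar>sin x\<bar> \<le> 0.005" using assms by simp
  then have "\<bar>sin x\<bar>\<^sup>2 \<le> 0.005\<^sup>2" by (intro power_mono) auto
  then show ?thesis by simp
qed

text \<open>Here |cos t|^2 = cosh^2 (Im t) - sin^2 (Re t), and Re t is within 0.005 of pi, so |cos
  t| is hardly below cosh 1.083. The base 1.646 is also an upper bound for cosh 1.05, which allows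
  the comparison with the main term for all n at once.\<close>

lemma \<Phi>_box_side:
  assumes "box_side t"
  shows "cmod (Fd t * sin t / (- cos t) ^ Suc n) \<le> 0.33 * 1.3245 / 1.646 ^ Suc n"
proof -
  have r: "pi - 0.005 \<le> Re t" "Re t \<le> pi" and i: "1.083 \<le> Im t" "Im t \<le> 1.093"
    using assms by (auto simp: box_side_def boxS_def)
  have s2: "(sin (Re t))\<^sup>2 \<le> 0.005\<^sup>2" using r by (rule sin_near_pi)
  have "sinh (Im t) \<le> sinh 1.093" using i by (simp only: sinh_real_le_iff)
  then have "sinh (Im t) \<le> 1.324001" by (rule order_trans) (use cosh_sinh_1093 in simp)
  moreover have "0 \<le> sinh (Im t)" using i by simp
  ultimately have "(sinh (Im t))\<^sup>2 \<le> 1.324001\<^sup>2" by (intro power_mono) auto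
  then have "(cmod (sin t))\<^sup>2 \<le> 1.3245\<^sup>2" using s2 by (simp add: cmod_sin_squared power_divide)
  then have sn: "cmod (sin t) \<le> 1.3245" by (rule power2_le_imp_le) simp
  have "cosh 1.083 \<le> cosh (Im t)" using i by (simp add: cosh_real_nonneg_le_iff)
  moreover have "1.646052 \<le> cosh (1.083::real)" using cosh_sinh_1083 by simp
  ultimately have "1.646052 \<le> cosh (Im t)" by linarith
  then have "1.646052\<^sup>2 \<le> (cosh (Im t))\<^sup>2" by (intro power_mono) auto
  moreover have "(cmod (cos t))\<^sup>2 = (cosh (Im t))\<^sup>2 - (sin (Re t))\<^sup>2"
    by (simp add: cmod_cos_squared cosh_square_eq cos_squared_eq)
  ultimately have "1.646\<^sup>2 \<le> (cmod (cos t))\<^sup>2" using s2 by (simp add: power_divide)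
  then have "1.646 \<le> cmod (cos t)" by (rule power2_le_imp_le) simp
  then have "1.646 ^ Suc n \<le> cmod ((- cos t) ^ Suc n)"
    unfolding norm_power norm_minus_cancel by (intro power_mono) auto
  then show ?thesis
    unfolding norm_divide norm_mult using Fd_box_side[OF assms] sn by (intro frac_le mult_mono) auto
qed

lemma \<Phi>_box_side_cnj:
  assumes "box_side (cnj t)"
  shows "cmod (Fd t * sin t / (- cos t) ^ Suc n) \<le> 0.33 * 1.3245 / 1.646 ^ Suc n"
proof -
  have nz: "cnj t \<noteq> 0" using assms by (auto simp: box_side_def boxS_def)
  have "Fd (cnj t) * sin (cnj t) / (- cos (cnj t)) ^ Suc n = cnj (Fd t * sin t / (- cos t) ^ Suc n)"
    using Fd_cnj[of t] nz by (simp add: cnj_sin cnj_cos)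
  then have "cmod (Fd t * sin t / (- cos t) ^ Suc n) = cmod (Fd (cnj t) * sin (cnj t) / (- cos (cnj t)) ^ Suc n)"
    by (simp only: complex_mod_cnj)
  then show ?thesis using \<Phi>_box_side[OF assms] by simp
qed

definition density :: "real \<Rightarrow> real" where
  "density s = (1.653 - cosh s) * Im (Anum (Complex pi s) / Bden (Complex pi s)) * sinh s"

lemma density_even: "density (- s) = density s"
proof -
  have "Complex pi (- s) = cnj (Complex pi s)" by (simp add: complex_eq_iff)
  then have "Anum (Complex pi (- s)) / Bden (Complex pi (- s)) = cnj (Anum (Complex pi s) / Bden (Complex pi s))"
    by (simp add: Anum_cnj Bden_cnj)
  then have "Im (Anum (Complex pi (- s)) / Bden (Complex pi (- s))) = - Im (Anum (Complex pi s) / Bden (Complex pi s))"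
    by (simp only: cnj.sel)
  then show ?thesis by (simp add: density_def)
qed

lemma Re_\<Phi>_density: "Re (Fd (Complex pi s) * sin (Complex pi s) / (- cos (Complex pi s)) ^ Suc n) = density s / cosh s ^ Suc n"
proof -
  have nz: "Complex pi s \<noteq> 0" by (simp add: complex_eq_iff)
  have c: "of_real 1.653 + cos (Complex pi s) = of_real (1.653 - cosh s)"
    unfolding cos_Complex by (simp add: complex_eq_iff)
  have "Im (Fd (Complex pi s)) = (1.653 - cosh s) * Im (Anum (Complex pi s) / Bden (Complex pi s))"
    unfolding Fd_def Fg_eq[OF nz] c
    by (simp only: minus_complex.sel times_complex.sel Re_complex_of_real Im_complex_of_real mult_zero_left add_0_right diff_zero)
  then show ?thesis unfolding Re_\<Phi>_right_line[of Fd] by (simp add: density_def)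
qed

lemma density_nonneg': assumes "\<bar>s\<bar> \<le> 1.083 \<or> 1.093 \<le> \<bar>s\<bar>" shows "0 \<le> density s"
  using density_nonneg[of "\<bar>s\<bar>"] assms density_even[of s] by (cases "0 \<le> s") (auto simp: density_def)

lemma density_ge': assumes "0.7 \<le> \<bar>s\<bar>" "\<bar>s\<bar> \<le> 1.05"
  shows "0.02706 * (s ^ 4 + 2/3 * s ^ 6) \<le> density s"
proof (cases "0 \<le> s")
  case True then show ?thesis using density_ge[of s] assms by (simp add: density_def)
next
  case False then show ?thesis using density_ge[of "-s"] assms density_even[of s] by (simp add: density_def)
qed

lemma vertical_line_shift:
  assumes "f holomorphic_on cbox (Complex a p) (Complex b q)" "a \<le> b" "p \<le> q"
  shows "contour_integral (linepath (Complex a p) (Complex a q)) f =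
     contour_integral (linepath (Complex b p) (Complex b q)) f
     + contour_integral (linepath (Complex a p) (Complex b p)) f
     - contour_integral (linepath (Complex a q) (Complex b q)) f"
proof -
  have cont: "continuous_on (closed_segment z w) f"
    if "z \<in> cbox (Complex a p) (Complex b q)" "w \<in> cbox (Complex a p) (Complex b q)" for z w
    using that by (intro continuous_on_subset[OF holomorphic_on_imp_continuous_on[OF assms(1)]] closed_segment_subset) auto
  have "contour_integral (linepath (Complex b q) (Complex a q)) f = - contour_integral (linepath (Complex a q) (Complex b q)) f"
    using assms(2,3) by (intro contour_integral_reverse_linepath cont) (auto simp: in_cbox_complex_iff)
  moreover have "contour_integral (linepath (Complex a q) (Complex a p)) f = - contour_integral (linepath (Complex a p) (Complex a q)) f"
    using assms(2,3) by (intro contour_integral_reverse_linepath cont) (auto simp: in_cbox_complex_iff)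
  ultimately show ?thesis using Cauchy_theorem_rectangle[OF assms] by (simp add: algebra_simps)
qed

text \<open>On the left, two detours of length 0.005 + 0.01 + 0.005 times the bounds for
  \<open>Fd\<close> and the sine; on the right, the integral of the density minorant over
  [0.7, 1.05] and its mirror image. Both contributions carry the same factor 1 / 1.646^(n+1), so
  this one inequality serves every n.\<close>

lemma box_contribution_lt_main_integral:
  "2 * (0.02 * (0.33 * 1.3245)) < 2 * (0.02706 * ((1.05 ^ 5 - 0.7 ^ 5) / 5 + 2/21 * (1.05 ^ 7 - 0.7 ^ 7) :: real))"
  by (simp add: power_divide)

lemma polynomial_has_integral:
  assumes "a \<le> (b::real)"
  shows "((\<lambda>s. 0.02706 * (s ^ 4 + 2/3 * s ^ 6)) has_integral
     0.02706 * ((b ^ 5 - a ^ 5) / 5 + 2/21 * (b ^ 7 - a ^ 7))) {a..b}"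
proof -
  have "((\<lambda>s. 0.02706 * (s ^ 4 + 2/3 * s ^ 6)) has_integral
     0.02706 * (b ^ 5 / 5 + 2/21 * b ^ 7) - 0.02706 * (a ^ 5 / 5 + 2/21 * a ^ 7)) {a..b}"
    using assms
    by (intro fundamental_theorem_of_calculus)
       (auto intro!: derivative_eq_intros simp: has_real_derivative_iff_has_vector_derivative[symmetric])
  then show ?thesis by (simp add: algebra_simps diff_divide_distrib)
qed

text \<open>\<open>Gtop\<close> bounds |A/B| on the horizontal sides by the triangle inequality; it
  compares cosh^2 with R sinh^2 and is of order 1/R. \<open>Mtop\<close> bounds the whole integrand
  for n >= 1 and is of the same order.\<close>

definition Gtop :: "real \<Rightarrow> real" where
  "Gtop R = ((R + pi)\<^sup>2 * cosh R + (R + pi) * cosh R + pi/2 * (1 + cosh R)\<^sup>2) /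
      (R * (sinh R)\<^sup>2 - (R + pi)\<^sup>2 - pi/2 * (1 + cosh R)\<^sup>2)"

definition Mtop :: "real \<Rightarrow> real" where
  "Mtop R = ((1.653 + cosh R) * Gtop R + 1.14) * cosh R / (sinh R)\<^sup>2"

lemma Mtop_tendsto: "(Mtop \<longlongrightarrow> 0) at_top"
  unfolding Mtop_def[abs_def] Gtop_def[abs_def] cosh_field_def sinh_field_def by real_asymp

lemma Gtop_denominator: "eventually (\<lambda>R. 0 < R * (sinh R)\<^sup>2 - (R + pi)\<^sup>2 - pi/2 * (1 + cosh R)\<^sup>2) at_top"
  unfolding cosh_field_def sinh_field_def by real_asymp

lemma \<Phi>_top:
  assumes R: "2 \<le> R" and den: "0 < R * (sinh R)\<^sup>2 - (R + pi)\<^sup>2 - pi/2 * (1 + cosh R)\<^sup>2"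
    and t: "0 \<le> Re t" "Re t \<le> pi" "\<bar>Im t\<bar> = R" and n: "1 \<le> n"
  shows "cmod (Fd t * sin t / (- cos t) ^ Suc n) \<le> Mtop R"
proof -
  have sR: "2 \<le> sinh R" using sinh_ge_self[of R] R by simp
  have ch: "cosh (Im t) = cosh R" and sh: "\<bar>sinh (Im t)\<bar> = sinh R"
    using t(3) cosh_real_abs[of "Im t"] sinh_real_abs[of "Im t"] by auto
  have b: "cmod (cos t) \<le> cosh R" "sinh R \<le> cmod (cos t)" "cmod (sin t) \<le> cosh R" "sinh R \<le> cmod (sin t)"
    using cmod_cos_bounds[of t] cmod_sin_bounds[of t] ch sh by auto
  have tR: "R \<le> cmod t" "cmod t \<le> R + pi" using abs_Im_le_cmod[of t] cmod_le[of t] t by auto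
  have nz: "t \<noteq> 0" using tR R by auto
  have "cmod (1 - cos t) \<le> 1 + cosh R" using norm_triangle_ineq4[of 1 "cos t"] b by simp
  then have q: "cmod (of_real (pi/2) * (1 - cos t)\<^sup>2) \<le> pi/2 * (1 + cosh R)\<^sup>2"
    unfolding norm_mult norm_power by (intro mult_mono power_mono) auto
  have t2: "cmod (t\<^sup>2) \<le> (R + pi)\<^sup>2" unfolding norm_power using tR by (intro power_mono) auto
  have "cmod (t\<^sup>2 * cos t) \<le> (R + pi)\<^sup>2 * cosh R" "cmod (t * sin t) \<le> (R + pi) * cosh R"
    unfolding norm_mult using t2 tR b R by (auto intro!: mult_mono)
  moreover have "cmod (- x + y - z) \<le> cmod x + cmod y + cmod z" for x y z :: complex
    using norm_triangle_ineq4[of "- x + y" z] norm_triangle_ineq[of "- x" y] by simp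
  ultimately have A: "cmod (Anum t) \<le> (R + pi)\<^sup>2 * cosh R + (R + pi) * cosh R + pi/2 * (1 + cosh R)\<^sup>2"
    unfolding Anum_def using q by (meson add_mono order_trans)
  have "R * (sinh R * sinh R) \<le> cmod t * (cmod (sin t) * cmod (cos t))"
    using tR b R sR by (intro mult_mono) auto
  then have p: "R * (sinh R)\<^sup>2 \<le> cmod (t * sin t * cos t)" by (simp add: norm_mult power2_eq_square mult_ac)
  have "cmod y - cmod x - cmod z \<le> cmod (x - y - z)" for x y z :: complex
    using norm_triangle_ineq2[of y "x - z"] norm_triangle_ineq4[of x z] norm_minus_commute[of y "x - z"]
    by (simp add: algebra_simps)
  from this[of "t * sin t * cos t" "t\<^sup>2" "of_real (pi/2) * (1 - cos t)\<^sup>2"]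
  have B: "R * (sinh R)\<^sup>2 - (R + pi)\<^sup>2 - pi/2 * (1 + cosh R)\<^sup>2 \<le> cmod (Bden t)"
    unfolding Bden_def using p q t2 by linarith
  have F: "cmod (Fg t) \<le> Gtop R"
    unfolding Fg_eq[OF nz] norm_divide Gtop_def using A B den order_trans[OF norm_ge_zero A]
    by (intro frac_le) auto
  have "cmod (Fd t) \<le> cmod (of_real 1.653 + cos t) * cmod (Fg t) + 1.14"
    unfolding Fd_def using norm_triangle_ineq4[of "(of_real 1.653 + cos t) * Fg t" "of_real 1.14"]
    by (simp only: norm_mult norm_of_real) simp
  moreover have "cmod (of_real 1.653 + cos t) \<le> 1.653 + cosh R"
    using norm_triangle_ineq[of "of_real 1.653" "cos t"] b by simp
  then have "cmod (of_real 1.653 + cos t) * cmod (Fg t) \<le> (1.653 + cosh R) * Gtop R"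
    using F by (intro mult_mono) (auto intro: add_nonneg_nonneg)
  ultimately have Fd: "cmod (Fd t) \<le> (1.653 + cosh R) * Gtop R + 1.14" by linarith
  have "(sinh R)\<^sup>2 \<le> cmod (cos t) ^ 2" using b sR R by (intro power_mono) auto
  \<comment> \<open>The exponent is at least 2 because \<open>1 \<le> n\<close>, and |cos t| is at
    least 1.\<close>
  also have "\<dots> \<le> cmod (cos t) ^ Suc n" using b sR n by (intro power_increasing) auto
  finally have "(sinh R)\<^sup>2 \<le> cmod ((- cos t) ^ Suc n)" by (simp only: norm_power norm_minus_cancel)
  moreover have "0 \<le> (1.653 + cosh R) * Gtop R + 1.14" using norm_ge_zero Fd by (rule order_trans)
  ultimately show ?thesis
    unfolding norm_divide norm_mult[of "Fd t"] Mtop_def using Fd b sR R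
    by (intro frac_le mult_mono mult_nonneg_nonneg) auto
qed

lemma \<Phi>_holomorphic:
  assumes "\<And>t. t \<in> S \<Longrightarrow> good t \<and> cos t \<noteq> 0"
  shows "(\<lambda>t. Fd t * sin t / (- cos t) ^ Suc n) holomorphic_on S"
proof -
  have "Fd holomorphic_on S"
    by (rule holomorphic_on_subset[OF Fd_holomorphic]) (use assms Bred_nonzero in auto)
  then show ?thesis using assms by (intro holomorphic_intros) auto
qed

definition Hg :: "complex \<Rightarrow> complex" where "Hg z = (of_real 1.653 - z) * hg z - of_real 1.14"

lemma Hg_holomorphic: "Hg holomorphic_on ball 0 1"
  unfolding Hg_def[abs_def] by (intro holomorphic_intros hg_holomorphic)

lemma Hg_minus_cos: "\<lbrakk>0 < Re t; Re t < pi\<rbrakk> \<Longrightarrow> Hg (- cos t) = Fd t"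
  by (simp add: Hg_def Fd_def hg_minus_cos)

text \<open>The right side of the rectangle is first placed at Re t = pi - 0.005, then moved to Re t
  = pi except across the two windows 1.083 < |Im t| < 1.093. One \<open>Mtop R\<close> pays for the
  long horizontal sides, the other for the short connections at heights R and -R.\<close>

lemma Hg_coeff_ge:
  fixes n :: nat
  assumes R: "2 \<le> R" and den: "0 < R * (sinh R)\<^sup>2 - (R + pi)\<^sup>2 - pi/2 * (1 + cosh R)\<^sup>2"
    and n: "1 \<le> n"
  shows "- (2 * Mtop R) \<le> Re ((deriv ^^ n) Hg 0 / fact n)"
proof -
  let ?\<Phi> = "\<lambda>t. Fd t * sin t / (- cos t) ^ Suc n"
  let ?c = "(deriv ^^ n) Hg 0 / fact n"
  let ?I = "\<lambda>z w. contour_integral (linepath z w) ?\<Phi>"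
  define M where "M = Mtop R"
  define a where "a = pi - 0.005"
  define s1 s2 :: real where "s1 = 1.083" and "s2 = 1.093"
  define X :: real where "X = 1.646 ^ Suc n"
  define bx where "bx = 0.33 * 1.3245 / X"
  have X: "0 < X" by (simp add: X_def)
  have top: "cmod (?\<Phi> t) \<le> M" if "0 \<le> Re t" "Re t \<le> pi" "\<bar>Im t\<bar> = R" for t
    unfolding M_def by (rule \<Phi>_top[OF R den that n])
  have M0: "0 \<le> M" using order_trans[OF norm_ge_zero top[of "Complex 0 R"]] R by simp
  have a: "pi/2 < a" "a < pi" "3 < a" using pi_approx by (auto simp: a_def)
  have E1: "cmod (2 * pi * \<i> * ?c - ?I (Complex a (-R)) (Complex a R)) \<le> 2 * pi * M"
  proof (rule Taylor_coeff_right_side[OF Hg_holomorphic Fd_holomorphic open_Bred_nonzero _ _ _ _ _ _ M0 top])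
    show "cbox (Complex 0 (- R)) (Complex a R) \<subseteq> {t. Bred t \<noteq> 0}"
    proof
      fix t assume "t \<in> cbox (Complex 0 (- R)) (Complex a R)"
      then have "good t" using a by (auto simp: in_cbox_complex_iff good_def a_def)
      then show "t \<in> {t. Bred t \<noteq> 0}" using Bred_nonzero by simp
    qed
  qed (use a R in \<open>auto simp: Hg_minus_cos Fd_even\<close>)
  have cosnz: "cos t \<noteq> 0" if "a \<le> Re t" "Re t \<le> pi" for t
  proof
    assume "cos t = 0"
    then have "t = of_real (pi/2)" using that a by (intro cos_eq_0_vertical_strip) auto
    then have "Re t = pi/2" by (simp only: Re_complex_of_real)
    then show False using that a by simp
  qed
  have hol: "?\<Phi> holomorphic_on cbox (Complex a p) (Complex pi q)"
    if "q \<le> - s2 \<or> s2 \<le> p \<or> (- s1 \<le> p \<and> q \<le> s1)" for p q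
  proof (rule \<Phi>_holomorphic)
    fix t assume t: "t \<in> cbox (Complex a p) (Complex pi q)"
    then show "good t \<and> cos t \<noteq> 0"
      using that cosnz[of t] a by (auto simp: in_cbox_complex_iff good_def s1_def s2_def abs_if)
  qed
  have hola: "?\<Phi> holomorphic_on {t. Re t = a}"
    by (rule \<Phi>_holomorphic) (use cosnz a in \<open>auto simp: good_def a_def\<close>)
  have conta: "continuous_on {t. Re t = a} ?\<Phi>" by (rule holomorphic_on_imp_continuous_on[OF hola])
  have segRe: "closed_segment (Complex x p) (Complex x q) \<subseteq> {t. Re t = x}" for x p q
    by (auto simp: closed_segment_same_Re)
  have split: "?I (Complex a p) (Complex a r) = ?I (Complex a p) (Complex a q) + ?I (Complex a q) (Complex a r)"
    if "p \<le> q" "q \<le> r" for p q r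
  proof (rule contour_integral_split_linepath)
    show "continuous_on (closed_segment (Complex a p) (Complex a r)) ?\<Phi>"
      by (rule continuous_on_subset[OF conta segRe])
    show "Complex a q \<in> closed_segment (Complex a p) (Complex a r)"
      using that by (auto simp: closed_segment_same_Re closed_segment_eq_real_ivl)
  qed
  \<comment> \<open>The horizontal connection at height y between the two vertical lines.\<close>
  define h where "h y = ?I (Complex a y) (Complex pi y)" for y
  have shift: "?I (Complex a p) (Complex a q) = ?I (Complex pi p) (Complex pi q) + h p - h q"
    if "q \<le> - s2 \<or> s2 \<le> p \<or> (- s1 \<le> p \<and> q \<le> s1)" "p \<le> q" for p q
    unfolding h_def by (rule vertical_line_shift[OF hol[OF that(1)]]) (use a that in auto)
  have ord: "- R \<le> - s2" "- s2 \<le> - s1" "- s1 \<le> s1" "s1 \<le> s2" "s2 \<le> R" using R by (auto simp: s1_def s2_def)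
  \<comment> \<open>\<open>XX\<close> collects the pieces on Re t = pi, \<open>YY\<close> the
    detours around the two half-boxes and the connections at heights R and -R.\<close>
  define XX where "XX = ?I (Complex pi (-R)) (Complex pi (-s2)) + ?I (Complex pi (-s1)) (Complex pi s1)
      + ?I (Complex pi s2) (Complex pi R)"
  define YY where "YY = ?I (Complex a (-s2)) (Complex a (-s1)) + ?I (Complex a s1) (Complex a s2)
      + (- h (- s2)) + h (- s1) + (- h s1) + h s2 + h (- R) + (- h R)"
  have eq: "?I (Complex a (-R)) (Complex a R) = XX + YY"
  proof -
    have "?I (Complex a (-R)) (Complex a R) = ?I (Complex a (-R)) (Complex a (-s2)) +
      (?I (Complex a (-s2)) (Complex a (-s1)) + (?I (Complex a (-s1)) (Complex a s1) +
       (?I (Complex a s1) (Complex a s2) + ?I (Complex a s2) (Complex a R))))"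
      using ord split[of "-R" "-s2" R] split[of "-s2" "-s1" R] split[of "-s1" s1 R] split[of s1 s2 R] by simp
    then show ?thesis
      using ord shift[of "-s2" "-R"] shift[of s1 "-s1"] shift[of R s2]
      by (simp add: XX_def YY_def)
  qed
  have horiz: "cmod (h y) \<le> B * 0.005"
    if "0 \<le> B" "\<bar>y\<bar> \<le> s1 \<or> s2 \<le> \<bar>y\<bar>" "\<And>t. \<lbrakk>a \<le> Re t; Re t \<le> pi; Im t = y\<rbrakk> \<Longrightarrow> cmod (?\<Phi> t) \<le> B" for y B
  proof -
    have sub: "closed_segment (Complex a y) (Complex pi y) \<subseteq> cbox (Complex a y) (Complex pi y)"
      using a by (intro closed_segment_subset) (auto simp: in_cbox_complex_iff)
    have "continuous_on (cbox (Complex a y) (Complex pi y)) ?\<Phi>"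
      using that(2) by (intro holomorphic_on_imp_continuous_on hol) (auto simp: abs_if split: if_splits)
    then have "?\<Phi> contour_integrable_on linepath (Complex a y) (Complex pi y)"
      using sub by (intro contour_integrable_continuous_linepath) (rule continuous_on_subset)
    then have "cmod (h y) \<le> B * cmod (Complex pi y - Complex a y)"
      unfolding h_def using that(1)
    proof (rule contour_integral_bound_linepath)
      fix t assume "t \<in> closed_segment (Complex a y) (Complex pi y)"
      then have "t \<in> cbox (Complex a y) (Complex pi y)" using sub by blast
      then show "cmod (?\<Phi> t) \<le> B" by (intro that(3)) (auto simp: in_cbox_complex_iff)
    qed
    also have "cmod (Complex pi y - Complex a y) = 0.005" by (simp add: a_def cmod_def)
    finally show ?thesis .
  qed
  have bx0: "0 \<le> bx" using X by (simp add: bx_def)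
  have boxb: "cmod (?\<Phi> t) \<le> bx" if "box_side t \<or> box_side (cnj t)" for t
    using that \<Phi>_box_side[of t n] \<Phi>_box_side_cnj[of t n] by (auto simp only: bx_def X_def)
  have hb: "cmod (h s1) \<le> bx * 0.005" "cmod (h s2) \<le> bx * 0.005"
       "cmod (h (- s1)) \<le> bx * 0.005" "cmod (h (- s2)) \<le> bx * 0.005"
    by (rule horiz[OF bx0], simp add: s1_def s2_def, rule boxb, simp add: box_side_def boxS_def s1_def s2_def a_def)+
  have hR: "cmod (h R) \<le> M * 0.005" "cmod (h (- R)) \<le> M * 0.005"
    by (rule horiz[OF M0 _ top]; use a ord R in simp)+
  have vert: "cmod (?I (Complex a p) (Complex a q)) \<le> bx * 0.01"
    if "(p = s1 \<and> q = s2) \<or> (p = - s2 \<and> q = - s1)" for p q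
  proof -
    have "?\<Phi> contour_integrable_on linepath (Complex a p) (Complex a q)"
      by (intro contour_integrable_continuous_linepath continuous_on_subset[OF conta segRe])
    then have "cmod (?I (Complex a p) (Complex a q)) \<le> bx * cmod (Complex a q - Complex a p)"
      using bx0
    proof (rule contour_integral_bound_linepath)
      fix t assume t: "t \<in> closed_segment (Complex a p) (Complex a q)"
      have "closed_segment (Complex a p) (Complex a q) \<subseteq> cbox (Complex a p) (Complex a q)"
        using that by (intro closed_segment_subset) (auto simp: in_cbox_complex_iff s1_def s2_def)
      then have "t \<in> cbox (Complex a p) (Complex a q)" using t by blast
      then show "cmod (?\<Phi> t) \<le> bx"
        using that by (intro boxb) (auto simp: in_cbox_complex_iff box_side_def boxS_def s1_def s2_def a_def)
    qed
    also have "cmod (Complex a q - Complex a p) = 0.01" using that by (auto simp: cmod_def s1_def s2_def)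
    finally show ?thesis .
  qed
  have YYb: "cmod YY \<le> 2 * (0.02 * bx) + 0.01 * M"
  proof -
    have "cmod YY \<le> cmod (?I (Complex a (-s2)) (Complex a (-s1))) + cmod (?I (Complex a s1) (Complex a s2))
      + cmod (- h (- s2)) + cmod (h (- s1)) + cmod (- h s1) + cmod (h s2) + cmod (h (- R)) + cmod (- h R)"
      unfolding YY_def by (intro norm_triangle_mono order_refl)
    also have "\<dots> \<le> bx * 0.01 + bx * 0.01 + bx * 0.005 + bx * 0.005 + bx * 0.005 + bx * 0.005 + M * 0.005 + M * 0.005"
      using hb hR by (intro add_mono vert) auto
    finally show ?thesis by simp
  qed
  define J :: real where "J = 0.02706 * ((1.05 ^ 5 - 0.7 ^ 5) / 5 + 2/21 * (1.05 ^ 7 - 0.7 ^ 7))"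
  have contpi: "continuous_on {p..q} (\<lambda>s. ?\<Phi> (Complex pi s))"
    if "q \<le> - s2 \<or> s2 \<le> p \<or> (- s1 \<le> p \<and> q \<le> s1)" for p q
    by (rule continuous_on_vertical[OF holomorphic_on_imp_continuous_on[OF hol[OF that]]])
       (use a in \<open>auto simp: in_cbox_complex_iff\<close>)
  have nonneg: "0 \<le> Re (?\<Phi> (Complex pi s))" if "\<bar>s\<bar> \<le> s1 \<or> s2 \<le> \<bar>s\<bar>" for s
    unfolding Re_\<Phi>_density using density_nonneg'[of s] that by (intro divide_nonneg_nonneg) (auto simp: s1_def s2_def)
  have outer: "0 \<le> Re (?I (Complex pi p) (Complex pi q) / (2 * pi * \<i>))" if "q = - s2 \<and> p = - R \<or> p = s2 \<and> q = R" for p q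
  proof -
    have pq: "p < q" using that R by (auto simp: s2_def)
    have "0 / (2 * pi) \<le> Re (?I (Complex pi p) (Complex pi q) / (2 * pi * \<i>))"
    proof (rule Re_vertical_integral_ge[OF pq contpi, where \<phi> = "\<lambda>_. 0"])
      show "q \<le> - s2 \<or> s2 \<le> p \<or> (- s1 \<le> p \<and> q \<le> s1)" using that by auto
      show "0 \<le> Re (?\<Phi> (Complex pi s))" if "s \<in> {p..q}" for s
        using that \<open>q = - s2 \<and> p = - R \<or> p = s2 \<and> q = R\<close> by (intro nonneg) auto
    qed simp
    then show ?thesis by simp
  qed
  have inner: "2 * (J / X) / (2 * pi) \<le> Re (?I (Complex pi (- s1)) (Complex pi s1) / (2 * pi * \<i>))"
  proof -
    define w where "w s = 0.02706 * (s ^ 4 + 2/3 * s ^ 6) / X" for s :: real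
    \<comment> \<open>Only 0.7 <= |s| <= 1.05 is used for the main term; on the rest of this piece
      nonnegativity of the density suffices. The power of cosh s is replaced by \<open>X\<close>,
      since cosh 1.05 < 1.646.\<close>
    define \<phi> where "\<phi> s = (if s \<in> {0.7..1.05} then w s else 0) + (if s \<in> {-1.05..-0.7} then w s else 0)" for s
    have w1: "(w has_integral J / X) {0.7..1.05}"
      unfolding w_def[abs_def] J_def by (intro has_integral_divide polynomial_has_integral) simp
    have w2: "(w has_integral J / X) {-1.05..-0.7}"
    proof -
      have "(w has_integral 0.02706 * (((- 0.7) ^ 5 - (- 1.05) ^ 5) / 5 + 2/21 * ((- 0.7) ^ 7 - (- 1.05) ^ 7)) / X) {-1.05..-0.7}"
        unfolding w_def[abs_def] by (intro has_integral_divide polynomial_has_integral) simp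
      also have "0.02706 * (((- 0.7) ^ 5 - (- 1.05) ^ 5) / 5 + 2/21 * ((- 0.7) ^ 7 - (- 1.05) ^ 7)) = J"
        unfolding J_def by (simp add: power_divide)
      finally show ?thesis .
    qed
    have "(\<phi> has_integral J / X + J / X) {- s1..s1}"
      unfolding \<phi>_def[abs_def]
      by (intro has_integral_add has_integral_restrict[THEN iffD2] w1 w2) (auto simp: s1_def)
    then have "(J / X + J / X) / (2 * pi) \<le> Re (?I (Complex pi (- s1)) (Complex pi s1) / (2 * pi * \<i>))"
    proof (rule Re_vertical_integral_ge[rotated 2])
      show "- s1 < s1" by (simp add: s1_def)
      show "continuous_on {- s1..s1} (\<lambda>s. ?\<Phi> (Complex pi s))" by (rule contpi) simp
      fix s assume s: "s \<in> {- s1..s1}"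
      show "\<phi> s \<le> Re (?\<Phi> (Complex pi s))"
      proof (cases "0.7 \<le> \<bar>s\<bar> \<and> \<bar>s\<bar> \<le> 1.05")
        case True
        then have "\<phi> s = w s" by (auto simp: \<phi>_def abs_if split: if_splits)
        also have "w s \<le> density s / cosh s ^ Suc n"
          unfolding w_def
        proof (rule frac_le)
          show "0.02706 * (s ^ 4 + 2/3 * s ^ 6) \<le> density s" using True by (intro density_ge') auto
          show "0 \<le> density s" using True by (intro density_nonneg') auto
          have "cosh \<bar>s\<bar> \<le> cosh 1.05" using True by (subst cosh_real_nonneg_le_iff) auto
          then have "cosh s \<le> cosh 1.05" by simp
          then have "cosh s \<le> 1.646" by (rule order_trans) (use cosh_sinh_105 in simp)
          then show "cosh s ^ Suc n \<le> X" unfolding X_def by (intro power_mono) auto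
        qed simp
        finally show ?thesis unfolding Re_\<Phi>_density .
      next
        case False
        then have "\<phi> s = 0" by (auto simp: \<phi>_def abs_if split: if_splits)
        then show ?thesis using nonneg[of s] s by (auto simp: abs_le_iff)
      qed
    qed
    then show ?thesis by simp
  qed
  have main: "2 * (J / X) / (2 * pi) \<le> Re (XX / (2 * pi * \<i>))"
    unfolding XX_def add_divide_distrib plus_complex.sel
    using inner outer[of "- s2" "- R"] outer[of R s2] by simp
  have small: "2 * (0.02 * bx) \<le> 2 * (J / X)"
  proof -
    have "2 * (0.02 * (0.33 * 1.3245)) \<le> 2 * J" unfolding J_def using box_contribution_lt_main_integral by (rule less_imp_le)
    then have "2 * (0.02 * (0.33 * 1.3245)) / X \<le> 2 * J / X" using X by (intro divide_right_mono) auto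
    then show ?thesis by (simp add: bx_def)
  qed
  have nrm: "cmod (2 * pi * \<i>) = 2 * pi" by (simp add: norm_mult)
  define D where "D = 2 * pi * \<i> * ?c - ?I (Complex a (-R)) (Complex a R)"
  have "?c = (D + (XX + YY)) / (2 * pi * \<i>)" unfolding D_def eq by simp
  then have "Re ?c = Re (D / (2 * pi * \<i>)) + Re (XX / (2 * pi * \<i>)) + Re (YY / (2 * pi * \<i>))"
    by (simp only: add_divide_distrib plus_complex.sel)
  moreover have "- M \<le> Re (D / (2 * pi * \<i>))"
  proof -
    have "cmod (D / (2 * pi * \<i>)) \<le> 2 * pi * M / (2 * pi)"
      unfolding norm_divide nrm using E1 unfolding D_def by (intro divide_right_mono) auto
    then show ?thesis using abs_Re_le_cmod[of "D / (2 * pi * \<i>)"] by simp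
  qed
  moreover have "- ((2 * (0.02 * bx) + 0.01 * M) / (2 * pi)) \<le> Re (YY / (2 * pi * \<i>))"
  proof -
    have "cmod (YY / (2 * pi * \<i>)) \<le> (2 * (0.02 * bx) + 0.01 * M) / (2 * pi)"
      unfolding norm_divide nrm using YYb by (intro divide_right_mono) auto
    then show ?thesis using abs_Re_le_cmod[of "YY / (2 * pi * \<i>)"] by linarith
  qed
  moreover have "(2 * (0.02 * bx) + 0.01 * M) / (2 * pi) \<le> 2 * (J / X) / (2 * pi) + M"
  proof -
    have "0.01 * M / (2 * pi) \<le> 2 * pi * M / (2 * pi)"
      using M0 pi_gt3 by (intro divide_right_mono mult_right_mono) auto
    moreover have "2 * pi * M / (2 * pi) = M" by simp
    moreover have "2 * (0.02 * bx) / (2 * pi) \<le> 2 * (J / X) / (2 * pi)"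
      using small by (rule divide_right_mono) auto
    ultimately show ?thesis unfolding add_divide_distrib by linarith
  qed
  ultimately show ?thesis using main unfolding M_def[symmetric] by linarith
qed

lemma Hg_coeff_nonneg:
  assumes "1 \<le> n" shows "0 \<le> Re ((deriv ^^ n) Hg 0)"
proof -
  have "eventually (\<lambda>R. - (2 * Mtop R) \<le> Re ((deriv ^^ n) Hg 0 / fact n)) at_top"
    using Gtop_denominator eventually_ge_at_top[of 2]
    by eventually_elim (rule Hg_coeff_ge[OF _ _ assms])
  moreover have "((\<lambda>R. - (2 * Mtop R)) \<longlongrightarrow> - (2 * 0)) at_top"
    by (intro tendsto_intros Mtop_tendsto)
  ultimately have "- (2 * 0) \<le> Re ((deriv ^^ n) Hg 0 / fact n)"
    by (intro tendsto_upperbound[of "\<lambda>R. - (2 * Mtop R)"]) auto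
  then show ?thesis by (simp only: Re_divide_fact_nonneg mult_zero_right minus_zero)
qed

text \<open>For the Taylor coefficients c_n of \<open>hg\<close>, nonnegativity for
  \<open>Hg\<close> reads 1.653 c_(n+1) >= c_n; this carries nonnegativity upwards from c_0 =
  \<open>g0 0\<close> = 0.\<close>

lemma hg_coeff_nonneg: "0 \<le> Re ((deriv ^^ n) hg 0)"
proof (induction n)
  case 0
  have "g0 0 = 0" by (simp add: g0_def power2_eq_square)
  then show ?case using hg_of_real[of 0] by simp
next
  case (Suc n)
  have "(deriv ^^ Suc n) Hg 0 = (of_real 1.653 - 0) * (deriv ^^ Suc n) hg 0 - of_nat (Suc n) * (deriv ^^ n) hg 0"
    unfolding Hg_def[abs_def] by (rule higher_deriv_linear_times[OF hg_holomorphic]) auto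
  then have "Re ((deriv ^^ Suc n) Hg 0) = 1.653 * Re ((deriv ^^ Suc n) hg 0) - real (Suc n) * Re ((deriv ^^ n) hg 0)"
    by (simp del: funpow.simps of_nat_Suc)
  then have "real (Suc n) * Re ((deriv ^^ n) hg 0) \<le> 1.653 * Re ((deriv ^^ Suc n) hg 0)"
    using Hg_coeff_nonneg[of "Suc n"] by linarith
  moreover have "0 \<le> real (Suc n) * Re ((deriv ^^ n) hg 0)" using Suc.IH by (intro mult_nonneg_nonneg) auto
  ultimately have "0 \<le> 1.653 * Re ((deriv ^^ Suc n) hg 0)" by (rule order_trans[rotated])
  then show ?case by (simp add: zero_le_mult_iff del: funpow.simps)
qed

lemma absolutely_monotone_g0: "absolutely_monotone_01 g0"
  by (rule absolutely_monotone_01_of_Taylor_coeffs[OF hg_holomorphic hg_coeff_nonneg _ g0_continuous])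
     (simp add: hg_of_real)

theorem theorem4p2:
  shows "absolutely_monotone_01 f0 \<and> absolutely_monotone_01 g0"
  using absolutely_monotone_f0 absolutely_monotone_g0 by simp

end
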